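(* Let $G=\langle X\rangle$ and $H=\langle Y\rangle$ be groups with disjoint finite symmetric generating sets $X$ and $Y$ consisting of non-trivial elements, and let $f_X:X^*\to X^*$ and $f_Y:Y^*\to Y^*$ be logspace normal form functions for $(G,X)$ and $(H,Y)$ respectively, with $f_X(\lambda)=\lambda$ and $f_Y(\lambda)=\lambda$. Then the normal form function $f_{X\sqcup Y}:(X\sqcup Y)^*\to (X\sqcup Y)^*$ for the restricted wreath product $G\wr H$ (defined in the context) can be computed in logspace. In particular, $G\wr H$ has a logspace normal form.
   Context: A deterministic logspace transducer is a deterministic machine with a finite state control and three tapes: a read-only input tape storing the input word; a read-write work tape restricted to at most $c\log n$ squares, where $n$ is the length of the input word and $c$ is a fixed constant; and a write-only output tape written from left to right. In each transition it may modify the work tape, change state, move the input read-head, and write at most a fixed constant number of letters to the output tape. For finite alphabets $X,Y$, a function $f:X^*\to Y^*$ is logspace computable (can be computed in logspace) if some deterministic logspace transducer outputs $f(w)$ on every input $w\in X^*$ ($X^*$ is the set of finite words over $X$, including the empty word $\lambda$). Let $G$ be a group with finite symmetric (closed under inverses) generating set $X$; for $w\in X^*$ let $\overline{w}\in G$ denote the element it represents. A normal form for $(G,X)$ is a subset $L\subseteq X^*$ such that $w\mapsto\overline{w}$ restricts to a bijection $L\to G$. A normal form function for $(G,X)$ is a function $f:X^*\to X^*$ such that, for some normal form $L$, $f(w)$ is the unique element of $L$ with $\overline{f(w)}=\overline{w}$, for all $w\in X^*$; it is a logspace normal form function if it is moreover logspace computable. $G$ has a logspace normal form if $(G,X)$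 has a logspace normal form function for some finite symmetric generating set $X$. The restricted wreath product is $G\wr H=\left(\bigoplus_{h\in H}G_h\right)\rtimes H$, where each $G_h$ is a copy of $G$ and $kG_hk^{-1}=G_{kh}$ for $k,h\in H$ (via the identification of the copies). It is generated by $X\sqcup Y$, with $X$ generating $G_1$ and $Y$ generating $H$. Fix an order on $Y$ and let $<_{SL}$ be the short-lex order on $Y^*$. For $w=a_1\cdots a_n\in(X\sqcup Y)^*$ let $Y(w)$ be the word obtained from $w$ by deleting all letters not in $Y$, and for $0\le j\le n$ let $Y(j,w)=Y(a_1\cdots a_j)$. The normal form function $f_{X\sqcup Y}$ is defined by $$f_{X\sqcup Y}(w)=u_1^{v_1}u_2^{v_2}\cdots u_k^{v_k}\,f_Y(Y(w)),$$ where $u_i^{v_i}$ denotes the word $v_i\,u_i\,f_Y(v_i^{-1})$ ($v_i^{-1}$ the formal inverse word); $v_1<_{SL}v_2<_{SL}\cdots<_{SL}v_k$ are the words in $f_Y(Y^* )$ representing exactly those $h\in H$ for which the component in $G_h$ of the $\bigoplus_{h\in H}G_h$-part of the element $\overline{w}\in G\wr H$ is non-trivial; and $u_i\in f_X(X^* )$, $u_i\neq\lambda$, is the normal form word of that component at $h=\overline{v_i}$. *)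

theory Defs
  imports Complex_Main "HOL-Algebra.Generated_Groups" "HOL-Algebra.Product_Groups"
begin

section \<open>Deterministic logspace transducers\<close>

text \<open>
  The input word \<open>w\<close> occupies the squares \<open>1, ..., length w\<close> of the input tape, between two
  end markers on the squares \<open>0\<close> and \<open>length w + 1\<close>. The input head never leaves these
  \<open>length w + 2\<close> squares; otherwise its position could serve as unbounded additional memory.
\<close>

datatype 'a input_symbol = Left_End | Letter 'a | Right_End

datatype move = Move_Left | Stay | Move_Right

text \<open>
  States and work symbols are natural numbers, which loses no generality as both sets are
  required to be finite. An entry
  \<open>transition M q a s = Some (q', s', d, e, out)\<close> means: in state \<open>q\<close>, reading \<open>a\<close> on the input
  tape and \<open>s\<close> on the work tape, enter state \<open>q'\<close>, replace \<open>s\<close> by \<open>s'\<close>, move the work head by \<open>d\<close>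
  and the input head by \<open>e\<close>, and append \<open>out\<close> to the output. The entry \<open>None\<close> means that the
  machine halts.
\<close>

record ('a, 'b) transducer =
  states :: "nat set"
  start_state :: nat
  work_symbols :: "nat set"
  blank_symbol :: nat
  transition ::
    "nat \<Rightarrow> 'a input_symbol \<Rightarrow> nat \<Rightarrow> (nat \<times> nat \<times> move \<times> move \<times> 'b list) option"

definition wf_transducer :: "'a set \<Rightarrow> 'b set \<Rightarrow> ('a, 'b) transducer \<Rightarrow> bool" where
  "wf_transducer X Y M \<longleftrightarrow>
     finite (states M) \<and> start_state M \<in> states M \<and>
     finite (work_symbols M) \<and> blank_symbol M \<in> work_symbols M \<and>
     (\<exists>k. \<forall>q \<in> states M. \<forall>a \<in> {Left_End, Right_End} \<union> Letter ` X. \<forall>s \<in> work_symbols M.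
        \<forall>q' s' d e out. transition M q a s = Some (q', s', d, e, out) \<longrightarrow>
          q' \<in> states M \<and> s' \<in> work_symbols M \<and> out \<in> lists Y \<and> length out \<le> k)"

record 'b config =
  state :: nat
  input_pos :: nat
  work_tape :: "nat \<Rightarrow> nat"
  work_pos :: nat
  written :: "'b list"

definition initial_config :: "('a, 'b) transducer \<Rightarrow> 'b config" where
  "initial_config M =
     \<lparr>state = start_state M, input_pos = 0, work_tape = (\<lambda>_. blank_symbol M), work_pos = 0,
      written = []\<rparr>"

definition input_at :: "'a list \<Rightarrow> nat \<Rightarrow> 'a input_symbol" where
  "input_at w i =
     (if i = 0 then Left_End else if i \<le> length w then Letter (w ! (i - 1)) else Right_End)"

text \<open>
  The squares of a tape are numbered from \<open>0\<close>; a move to the left from square \<open>0\<close> has no effect.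
\<close>

fun move_head :: "move \<Rightarrow> nat \<Rightarrow> nat" where
  "move_head Move_Left i = i - 1"
| "move_head Stay i = i"
| "move_head Move_Right i = i + 1"

definition step :: "('a, 'b) transducer \<Rightarrow> 'a list \<Rightarrow> 'b config \<Rightarrow> 'b config option" where
  "step M w c =
     (case transition M (state c) (input_at w (input_pos c)) (work_tape c (work_pos c)) of
        None \<Rightarrow> None
      | Some (q, s, d, e, out) \<Rightarrow>
          Some \<lparr>state = q,
                input_pos = min (move_head e (input_pos c)) (length w + 1),
                work_tape = (work_tape c)(work_pos c := s),
                work_pos = move_head d (work_pos c),
                written = written c @ out\<rparr>)"

definition reachable :: "('a, 'b) transducer \<Rightarrow> 'a list \<Rightarrow> 'b config \<Rightarrow> bool" where
  "reachable M w c \<longleftrightarrow> (initial_config M, c) \<in> {(c, c'). step M w c = Some c'}\<^sup>*"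

definition outputs_on :: "('a, 'b) transducer \<Rightarrow> 'a list \<Rightarrow> 'b list \<Rightarrow> bool" where
  "outputs_on M w u \<longleftrightarrow> (\<exists>c. reachable M w c \<and> step M w c = None \<and> written c = u)"

text \<open>
  For inputs of length \<open>n \<ge> 2\<close> this allows exactly the squares \<open>0, ..., m - 1\<close> with
  \<open>m \<le> c * log 2 n\<close>. As \<open>log n\<close> is undefined or zero for \<open>n \<le> 1\<close>, inputs of length at most \<open>1\<close>
  are granted the space of inputs of length \<open>2\<close>.
\<close>

definition in_logspace_on :: "('a, 'b) transducer \<Rightarrow> nat \<Rightarrow> 'a list \<Rightarrow> bool" where
  "in_logspace_on M c w \<longleftrightarrow>
     (\<forall>cf. reachable M w cf \<longrightarrow>
        real (work_pos cf + 1) \<le> real c * log 2 (real (max 2 (length w))))"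

definition logspace_computable :: "'a set \<Rightarrow> 'b set \<Rightarrow> ('a list \<Rightarrow> 'b list) \<Rightarrow> bool" where
  "logspace_computable X Y f \<longleftrightarrow>
     finite X \<and> finite Y \<and> f \<in> lists X \<rightarrow> lists Y \<and>
     (\<exists>M c. wf_transducer X Y M \<and>
        (\<forall>w \<in> lists X. in_logspace_on M c w \<and> outputs_on M w (f w)))"


section \<open>Normal forms\<close>

definition word_eval :: "('g, 'm) monoid_scheme \<Rightarrow> 'g list \<Rightarrow> 'g" where
  "word_eval G w = foldr (\<otimes>\<^bsub>G\<^esub>) w \<one>\<^bsub>G\<^esub>"

definition inverse_word :: "('g, 'm) monoid_scheme \<Rightarrow> 'g list \<Rightarrow> 'g list" where
  "inverse_word G w = map (m_inv G) (rev w)"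

definition finite_symmetric_generating_set ::
    "('g, 'm) monoid_scheme \<Rightarrow> 'g set \<Rightarrow> bool" where
  "finite_symmetric_generating_set G X \<longleftrightarrow>
     finite X \<and> X \<subseteq> carrier G \<and> (\<forall>x \<in> X. inv\<^bsub>G\<^esub> x \<in> X) \<and> generate G X = carrier G"

definition normal_form :: "('g, 'm) monoid_scheme \<Rightarrow> 'g set \<Rightarrow> 'g list set \<Rightarrow> bool" where
  "normal_form G X L \<longleftrightarrow> L \<subseteq> lists X \<and> bij_betw (word_eval G) L (carrier G)"

definition normal_form_function ::
    "('g, 'm) monoid_scheme \<Rightarrow> 'g set \<Rightarrow> ('g list \<Rightarrow> 'g list) \<Rightarrow> bool" where
  "normal_form_function G X f \<longleftrightarrow>
     (\<exists>L. normal_form G X L \<and>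
        (\<forall>w \<in> lists X. f w \<in> L \<and> word_eval G (f w) = word_eval G w))"

definition logspace_normal_form_function ::
    "('g, 'm) monoid_scheme \<Rightarrow> 'g set \<Rightarrow> ('g list \<Rightarrow> 'g list) \<Rightarrow> bool" where
  "logspace_normal_form_function G X f \<longleftrightarrow>
     normal_form_function G X f \<and> logspace_computable X X f"

definition has_logspace_normal_form :: "('g, 'm) monoid_scheme \<Rightarrow> bool" where
  "has_logspace_normal_form G \<longleftrightarrow>
     (\<exists>X f. finite_symmetric_generating_set G X \<and> logspace_normal_form_function G X f)"


section \<open>Restricted wreath products\<close>

definition semidirect_product ::
    "('n, 'r) monoid_scheme \<Rightarrow> ('h, 's) monoid_scheme \<Rightarrow> ('h \<Rightarrow> 'n \<Rightarrow> 'n) \<Rightarrow> ('n \<times> 'h) monoid"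
  where
  "semidirect_product N H \<phi> =
     \<lparr>carrier = carrier N \<times> carrier H,
      monoid.mult = (\<lambda>(p, h) (p', h'). (p \<otimes>\<^bsub>N\<^esub> \<phi> h p', h \<otimes>\<^bsub>H\<^esub> h')),
      one = (\<one>\<^bsub>N\<^esub>, \<one>\<^bsub>H\<^esub>)\<rparr>"

definition shift :: "('h, 's) monoid_scheme \<Rightarrow> 'h \<Rightarrow> ('h \<Rightarrow> 'g) \<Rightarrow> 'h \<Rightarrow> 'g" where
  "shift H k p = (\<lambda>h \<in> carrier H. p (inv\<^bsub>H\<^esub> k \<otimes>\<^bsub>H\<^esub> h))"

definition wreath_product ::
    "('g, 'r) monoid_scheme \<Rightarrow> ('h, 's) monoid_scheme \<Rightarrow> (('h \<Rightarrow> 'g) \<times> 'h) monoid" where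
  "wreath_product G H = semidirect_product (sum_group (carrier H) (\<lambda>_. G)) H (shift H)"

definition at_component ::
    "('g, 'r) monoid_scheme \<Rightarrow> ('h, 's) monoid_scheme \<Rightarrow> 'h \<Rightarrow> 'g \<Rightarrow> ('h \<Rightarrow> 'g) \<times> 'h" where
  "at_component G H h g =
     ((\<lambda>k \<in> carrier H. if k = h then g else \<one>\<^bsub>G\<^esub>), \<one>\<^bsub>H\<^esub>)"

definition base_embed ::
    "('g, 'r) monoid_scheme \<Rightarrow> ('h, 's) monoid_scheme \<Rightarrow> 'g \<Rightarrow> ('h \<Rightarrow> 'g) \<times> 'h" where
  "base_embed G H g = at_component G H \<one>\<^bsub>H\<^esub> g"

definition top_embed ::
    "('g, 'r) monoid_scheme \<Rightarrow> ('h, 's) monoid_scheme \<Rightarrow> 'h \<Rightarrow> ('h \<Rightarrow> 'g) \<times> 'h" where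
  "top_embed G H h = ((\<lambda>k \<in> carrier H. \<one>\<^bsub>G\<^esub>), h)"

text \<open>
  The set \<open>X \<squnion> Y\<close> is formed inside the wreath product, so that its elements are again group
  elements. If \<open>X\<close> and \<open>Y\<close> consist of non-trivial elements, the two images are disjoint.
\<close>

definition wreath_generators ::
    "('g, 'r) monoid_scheme \<Rightarrow> ('h, 's) monoid_scheme \<Rightarrow> 'g set \<Rightarrow> 'h set \<Rightarrow>
      (('h \<Rightarrow> 'g) \<times> 'h) set" where
  "wreath_generators G H X Y = base_embed G H ` X \<union> top_embed G H ` Y"

lemma base_top_disjoint:
  assumes "\<one>\<^bsub>H\<^esub> \<notin> Y"
  shows "base_embed G H ` X \<inter> top_embed G H ` Y = {}"
  using assms by (auto simp: base_embed_def at_component_def top_embed_def)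

lemma group_semidirect_product:
  assumes N: "group N" and H: "group H"
    and hom: "\<And>h. h \<in> carrier H \<Longrightarrow> \<phi> h \<in> hom N N"
    and one: "\<And>p. p \<in> carrier N \<Longrightarrow> \<phi> \<one>\<^bsub>H\<^esub> p = p"
    and comp: "\<And>h k p. \<lbrakk>h \<in> carrier H; k \<in> carrier H; p \<in> carrier N\<rbrakk> \<Longrightarrow>
                 \<phi> (h \<otimes>\<^bsub>H\<^esub> k) p = \<phi> h (\<phi> k p)"
  shows "group (semidirect_product N H \<phi>)"
proof -
  interpret N: group N by fact
  interpret H: group H by fact
  have cl: "\<phi> h p \<in> carrier N" if "h \<in> carrier H" "p \<in> carrier N" for h p
    using hom[OF that(1)] that(2) by (auto simp: hom_def)
  have mult: "\<phi> h (p \<otimes>\<^bsub>N\<^esub> q) = \<phi> h p \<otimes>\<^bsub>N\<^esub> \<phi> h q"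
    if "h \<in> carrier H" "p \<in> carrier N" "q \<in> carrier N" for h p q
    using hom[OF that(1)] that(2,3) by (auto simp: hom_def)
  show ?thesis
  proof (rule groupI)
    fix x assume "x \<in> carrier (semidirect_product N H \<phi>)"
    then obtain p h where x: "x = (p, h)" and p: "p \<in> carrier N" and h: "h \<in> carrier H"
      by (auto simp: semidirect_product_def)
    let ?y = "(\<phi> (inv\<^bsub>H\<^esub> h) (inv\<^bsub>N\<^esub> p), inv\<^bsub>H\<^esub> h)"
    have "\<phi> (inv\<^bsub>H\<^esub> h) (inv\<^bsub>N\<^esub> p) \<otimes>\<^bsub>N\<^esub> \<phi> (inv\<^bsub>H\<^esub> h) p = \<phi> (inv\<^bsub>H\<^esub> h) \<one>\<^bsub>N\<^esub>"
      using mult[of "inv\<^bsub>H\<^esub> h" "inv\<^bsub>N\<^esub> p" p] p h by simp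
    also have "\<dots> = \<one>\<^bsub>N\<^esub>"
      using h hom[of "inv\<^bsub>H\<^esub> h"] N by (simp add: hom_one)
    finally show "\<exists>y \<in> carrier (semidirect_product N H \<phi>).
        y \<otimes>\<^bsub>semidirect_product N H \<phi>\<^esub> x = \<one>\<^bsub>semidirect_product N H \<phi>\<^esub>"
      using p h cl by (intro bexI[of _ ?y]) (auto simp: semidirect_product_def x)
  qed (auto simp: semidirect_product_def cl one mult comp N.m_assoc H.m_assoc)
qed

lemma shift_in_sum_group:
  assumes "group G" "group H" "k \<in> carrier H" "p \<in> carrier (sum_group (carrier H) (\<lambda>_. G))"
  shows "shift H k p \<in> carrier (sum_group (carrier H) (\<lambda>_. G))"
proof -
  interpret H: group H by fact
  have "{h \<in> carrier H. shift H k p h \<noteq> \<one>\<^bsub>G\<^esub>}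
          \<subseteq> (\<lambda>h. k \<otimes>\<^bsub>H\<^esub> h) ` {h \<in> carrier H. p h \<noteq> \<one>\<^bsub>G\<^esub>}"
  proof
    fix h assume h: "h \<in> {h \<in> carrier H. shift H k p h \<noteq> \<one>\<^bsub>G\<^esub>}"
    then have "h = k \<otimes>\<^bsub>H\<^esub> (inv\<^bsub>H\<^esub> k \<otimes>\<^bsub>H\<^esub> h)"
      using assms(3) by (simp add: H.m_assoc[symmetric])
    with h show "h \<in> (\<lambda>h. k \<otimes>\<^bsub>H\<^esub> h) ` {h \<in> carrier H. p h \<noteq> \<one>\<^bsub>G\<^esub>}"
      using assms(3) by (intro image_eqI[where x = "inv\<^bsub>H\<^esub> k \<otimes>\<^bsub>H\<^esub> h"]) (auto simp: shift_def)
  qed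
  moreover have "finite {h \<in> carrier H. p h \<noteq> \<one>\<^bsub>G\<^esub>}"
    using assms(1,4) by (simp add: carrier_sum_group)
  ultimately have "finite {h \<in> carrier H. shift H k p h \<noteq> \<one>\<^bsub>G\<^esub>}"
    by (meson finite_imageI finite_subset)
  then show ?thesis
    using assms by (auto simp: carrier_sum_group shift_def PiE_iff)
qed

lemma group_wreath_product:
  assumes G: "group G" and H: "group H"
  shows "group (wreath_product G H)"
  unfolding wreath_product_def
proof (rule group_semidirect_product)
  interpret H: group H by fact
  show "group (sum_group (carrier H) (\<lambda>_. G))" using G by simp
  show "group H" by fact
  show "shift H k \<in> hom (sum_group (carrier H) (\<lambda>_. G)) (sum_group (carrier H) (\<lambda>_. G))"
    if "k \<in> carrier H" for k
    using that shift_in_sum_group[OF G H] by (auto simp: hom_def shift_def)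
  show "shift H \<one>\<^bsub>H\<^esub> p = p" if "p \<in> carrier (sum_group (carrier H) (\<lambda>_. G))" for p
    using that G by (auto simp: shift_def carrier_sum_group PiE_iff extensional_def)
  show "shift H (h \<otimes>\<^bsub>H\<^esub> k) p = shift H h (shift H k p)"
    if "h \<in> carrier H" "k \<in> carrier H" "p \<in> carrier (sum_group (carrier H) (\<lambda>_. G))" for h k p
    using that by (auto simp: shift_def H.inv_mult_group H.m_assoc)
qed

lemma conj_at_component:
  assumes "group G" "group H" "h \<in> carrier H" "k \<in> carrier H" "g \<in> carrier G"
  shows "top_embed G H k \<otimes>\<^bsub>wreath_product G H\<^esub> at_component G H h g
           \<otimes>\<^bsub>wreath_product G H\<^esub> top_embed G H (inv\<^bsub>H\<^esub> k)
         = at_component G H (k \<otimes>\<^bsub>H\<^esub> h) g"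
proof -
  interpret G: group G by fact
  interpret H: group H by fact
  have "inv\<^bsub>H\<^esub> k \<otimes>\<^bsub>H\<^esub> l = h \<longleftrightarrow> l = k \<otimes>\<^bsub>H\<^esub> h" if "l \<in> carrier H" for l
    using that assms(3,4) by (metis H.inv_solve_left)
  then show ?thesis
    using assms(3-5)
    by (auto simp: wreath_product_def semidirect_product_def top_embed_def at_component_def
        shift_def fun_eq_iff)
qed


section \<open>The normal form function of the wreath product\<close>

definition top_word ::
    "('g, 'r) monoid_scheme \<Rightarrow> ('h, 's) monoid_scheme \<Rightarrow> 'h set \<Rightarrow>
      (('h \<Rightarrow> 'g) \<times> 'h) list \<Rightarrow> 'h list" where
  "top_word G H Y w = map snd (filter (\<lambda>a. a \<in> top_embed G H ` Y) w)"

definition component ::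
    "('g, 'r) monoid_scheme \<Rightarrow> ('h, 's) monoid_scheme \<Rightarrow>
      (('h \<Rightarrow> 'g) \<times> 'h) list \<Rightarrow> 'h \<Rightarrow> 'g" where
  "component G H w h = fst (word_eval (wreath_product G H) w) h"

text \<open>
  In the following, \<open>r\<close> is a strict linear order on \<open>Y\<close>, so that \<open>lenlex r\<close> is the short-lex order
  on words over \<open>Y\<close>. The sorted list of conjugators \<open>v\<^sub>1, ..., v\<^sub>k\<close> exists uniquely, as the
  support of an element of the wreath product is finite.
\<close>

definition conjugators ::
    "('g, 'r) monoid_scheme \<Rightarrow> ('h, 's) monoid_scheme \<Rightarrow> 'h set \<Rightarrow> ('h \<times> 'h) set \<Rightarrow>
      ('h list \<Rightarrow> 'h list) \<Rightarrow> (('h \<Rightarrow> 'g) \<times> 'h) list \<Rightarrow> 'h list list" where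
  "conjugators G H Y r fY w =
     (THE vs. sorted_wrt (\<lambda>v v'. (v, v') \<in> lenlex r) vs \<and>
        set vs = {v \<in> fY ` lists Y. component G H w (word_eval H v) \<noteq> \<one>\<^bsub>G\<^esub>})"

definition normal_form_word ::
    "('g, 'r) monoid_scheme \<Rightarrow> 'g set \<Rightarrow> ('g list \<Rightarrow> 'g list) \<Rightarrow> 'g \<Rightarrow> 'g list" where
  "normal_form_word G X f g = (THE u. u \<in> f ` lists X \<and> word_eval G u = g)"

definition wreath_normal_form ::
    "('g, 'r) monoid_scheme \<Rightarrow> ('h, 's) monoid_scheme \<Rightarrow> 'g set \<Rightarrow> 'h set \<Rightarrow> ('h \<times> 'h) set \<Rightarrow>
      ('g list \<Rightarrow> 'g list) \<Rightarrow> ('h list \<Rightarrow> 'h list) \<Rightarrow>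
      (('h \<Rightarrow> 'g) \<times> 'h) list \<Rightarrow> (('h \<Rightarrow> 'g) \<times> 'h) list" where
  "wreath_normal_form G H X Y r fX fY w =
     concat (map (\<lambda>v. map (top_embed G H) v @
                      map (base_embed G H)
                        (normal_form_word G X fX (component G H w (word_eval H v))) @
                      map (top_embed G H) (fY (inverse_word H v)))
                 (conjugators G H Y r fY w)) @
     map (top_embed G H) (fY (top_word G H Y w))"

end

theory Submission
  imports Defs "HOL-Library.Nat_Bijection"
begin

text \<open>
  Let \<open>w\<close> be a word of length \<open>n\<close> over the generators of the wreath product. Reading \<open>w\<close> from the
  left, a letter of \<open>Y\<close> changes the current element of \<open>H\<close>, and a letter of \<open>X\<close> multiplies the
  component at the current element. Hence the component at \<open>h\<close> is the product of the letters of
  \<open>X\<close> that occur at positions whose prefix represents \<open>h\<close> (lemma \<open>word_eval_wreath\<close>), and every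
  conjugator is the normal form of a prefix of \<open>w\<close>. A conjugator is thus given by a position in \<open>w\<close>,
  a number of logarithmic size, although the conjugator itself may be far too long to be stored. A
  position is relevant if the component above it is non-trivial and no earlier position has the same
  normal form; the block that belongs at place \<open>t\<close> is the block of the relevant position \<open>j\<close> for
  which exactly \<open>t\<close> relevant positions have a smaller normal form (lemma \<open>base_word_by_ranks\<close>). So
  the normal form is a concatenation, over all pairs \<open>t, j < n\<close>, of words that are either a block or
  empty, and sorting is replaced by counting.

  It remains to see that such a description can be carried out in logarithmic space, where no
  intermediate word may be written down. A word depending on the input and on numeric parameters is
  therefore represented by two functions, its length and its letter at a given position
  (\<open>log_word\<close>). The underlying class \<open>log_fun\<close> consists of the numeric functions with polynomially
  bounded values that are evaluated by programs with finitely many polynomially bounded counters. It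
  is closed under substitution and under primitive recursion as long as all intermediate values stay
  polynomial (\<open>log_fun_rec\<close>), which yields arithmetic, bounded quantifiers, comparison of words and
  concatenation over a range of indices.

  Two results link this calculus with transducers. First, a \<open>log_word\<close> is written by a logspace
  transducer (\<open>log_word_imp_logspace_computable\<close>): the counters of a program are kept in binary on
  parallel tracks of the work tape, with the least significant digits at its left end. Second, if
  \<open>f\<close> is logspace computable and \<open>v\<close> is a \<open>log_word\<close>, then so is \<open>f v\<close> (\<open>log_word_apply\<close>). For
  this, the configurations of a transducer for \<open>f\<close> on \<open>v\<close> are coded by polynomially bounded numbers;
  the successor of a code is computed from the code and from the one letter of \<open>v\<close> under the input
  head, and \<open>f v\<close> is the concatenation of the pieces emitted at the times \<open>0, 1, 2, ...\<close>. Polynomially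
  many times suffice, because a deterministic run that halts never repeats a configuration. Applied
  to the given functions \<open>fX\<close> and \<open>fY\<close>, this makes all parts of the blocks available.
\<close>

section \<open>Counter programs\<close>


text \<open>
  Programs of an intermediate language between numeric functions and transducers. Registers hold
  natural numbers; the input is read through a single head, as by a transducer. Output letters are
  numbers, so that the programs for an input alphabet form one type.
\<close>

datatype 'a com =
    Skip
  | Inc nat
  | Dec nat
  | Write nat
  | Move move
  | Seq "'a com" "'a com"
  | IfZero nat "'a com" "'a com"
  | IfInput "'a input_symbol set" "'a com" "'a com"
  | While nat "'a com"

text \<open>
  Position of the input head, contents of the registers, and output.
\<close>

type_synonym memory = "nat \<times> (nat \<Rightarrow> nat) \<times> nat list"

text \<open>
  The bound \<open>B\<close> is part of the semantics: a register cannot be incremented beyond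
      \<open>B\<close>, and a
  decrement needs a positive register. An execution thus certifies that all values fit on a tape
  with space for the binary representation of \<open>B\<close>.
\<close>

inductive exec :: "nat \<Rightarrow> 'a list \<Rightarrow> 'a com \<Rightarrow> memory
    \<Rightarrow> memory \<Rightarrow> bool"
  for B :: nat and w :: "'a list" where
  exec_Skip: "exec B w Skip s s"
| exec_Inc: "\<sigma> i < B \<Longrightarrow> exec B w (Inc i) (h, \<sigma>, u) (h, \<sigma>(i :=
    Suc (\<sigma> i)), u)"
| exec_Dec: "0 < \<sigma> i \<Longrightarrow> exec B w (Dec i) (h, \<sigma>, u) (h, \<sigma>(i :=
    \<sigma> i - 1), u)"
| exec_Write: "exec B w (Write y) (h, \<sigma>, u) (h, \<sigma>, u @ [y])"
| exec_Move: "exec B w (Move e) (h, \<sigma>, u) (min (move_head e h) (length w + 1), \<sigma>, u)"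
| exec_Seq: "exec B w c s s' \<Longrightarrow> exec B w c' s' s'' \<Longrightarrow> exec B w (Seq
    c c') s s''"
| exec_IfZero: "exec B w (if \<sigma> i = 0 then c else c') (h, \<sigma>, u) s \<Longrightarrow>
    exec B w (IfZero i c c') (h, \<sigma>, u) s"
| exec_IfInput: "exec B w (if input_at w h \<in> A then c else c') (h, \<sigma>, u) s
    \<Longrightarrow>
    exec B w (IfInput A c c') (h, \<sigma>, u) s"
| exec_While_done: "\<sigma> i = 0 \<Longrightarrow> exec B w (While i c) (h, \<sigma>, u) (h,
    \<sigma>, u)"
| exec_While_step: "\<sigma> i \<noteq> 0 \<Longrightarrow> exec B w c (h, \<sigma>, u) s
    \<Longrightarrow> exec B w (While i c) s s' \<Longrightarrow>
    exec B w (While i c) (h, \<sigma>, u) s'"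

lemma exec_mono: "exec B w c s s' \<Longrightarrow> B \<le> B' \<Longrightarrow> exec B' w c s s'"
  by (induction rule: exec.induct) (blast intro: exec.intros less_le_trans)+

section \<open>Binary counters on a tape\<close>

text \<open>
  The least significant digit comes first, and leading zeros at the end are permitted: a decrement
  never shortens a counter.
\<close>

fun value_of :: "bool list \<Rightarrow> nat" where
  "value_of [] = 0"
| "value_of (b # ds) = of_bool b + 2 * value_of ds"

fun increment :: "bool list \<Rightarrow> bool list" where
  "increment [] = [True]"
| "increment (False # ds) = True # ds"
| "increment (True # ds) = False # increment ds"

fun decrement :: "bool list \<Rightarrow> bool list" where
  "decrement [] = []"
| "decrement (True # ds) = False # ds"
| "decrement (False # ds) = True # decrement ds"

lemma value_increment: "value_of (increment ds) = Suc (value_of ds)"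
  by (induction ds rule: increment.induct) auto

lemma value_decrement: "0 < value_of ds \<Longrightarrow> value_of (decrement ds) = value_of ds - 1"
  by (induction ds rule: decrement.induct) auto

lemma length_decrement [simp]: "length (decrement ds) = length ds"
  by (induction ds rule: decrement.induct) auto

text \<open>
  A counter grows only when all its digits are \<open>True\<close>, and then its new value is
      \<open>2\<close> to the
  power of its old length.
\<close>

lemma length_increment: "length (increment ds) \<le> max (length ds) k" if "value_of ds + 1 < 2 ^ k"
  using that
proof (induction ds arbitrary: k rule: increment.induct)
  case 1
  then show ?case by (cases k) auto
next
  case (3 ds)
  then show ?case by (cases k) force+
qed auto

text \<open>
  A square of the work tape holds one digit of every counter, and a mark that distinguishes the
  square \<open>0\<close>. On a track, \<open>None\<close> is the blank beyond the last digit.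
\<close>

type_synonym square = "bool \<times> (nat \<Rightarrow> bool option)"

text \<open>
  The list in \<open>At ks\<close> is what remains to be done. The state \<open>Back ks\<close>
      returns the work head to the
  marked square before \<open>ks\<close> is continued; \<open>Boot\<close> writes the mark.
\<close>

datatype 'a control = Boot | At "'a com list" | Back "'a com list"

text \<open>
  As all counters have their least significant digit on the marked square, an increment is a sweep
  to the right that carries, a decrement one that borrows, and a test for zero one that searches a
  digit \<open>True\<close>. During a sweep the control keeps the instruction at the head of its
      list.
\<close>

fun delta :: "'a com \<Rightarrow> 'a control \<Rightarrow> 'a input_symbol \<Rightarrow> square
    \<Rightarrow>
    ('a control \<times> square \<times> move \<times> move \<times> nat list) option" where
  "delta c Boot a (m, f) = Some (At [c], (True, f), Stay, Stay, [])"
| "delta c (Back ks) a (m, f) =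
     Some (if m then (At ks, (m, f), Stay, Stay, []) else (Back ks, (m, f), Move_Left, Stay, []))"
| "delta c (At []) a (m, f) = None"
| "delta c (At (Skip # ks)) a (m, f) = Some (At ks, (m, f), Stay, Stay, [])"
| "delta c (At (Inc i # ks)) a (m, f) =
     Some (if f i = Some True then (At (Inc i # ks), (m, f(i \<mapsto> False)), Move_Right, Stay,
         [])
           else (Back ks, (m, f(i \<mapsto> True)), Stay, Stay, []))"
| "delta c (At (Dec i # ks)) a (m, f) =
     Some (if f i = Some True then (Back ks, (m, f(i \<mapsto> False)), Stay, Stay, [])
           else (At (Dec i # ks), (m, f(i \<mapsto> True)), Move_Right, Stay, []))"
| "delta c (At (Write y # ks)) a (m, f) = Some (At ks, (m, f), Stay, Stay, [y])"
| "delta c (At (Move e # ks)) a (m, f) = Some (At ks, (m, f), Stay, e, [])"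
| "delta c (At (Seq c1 c2 # ks)) a (m, f) = Some (At (c1 # c2 # ks), (m, f), Stay, Stay, [])"
| "delta c (At (IfInput A c1 c2 # ks)) a (m, f) =
     Some (At ((if a \<in> A then c1 else c2) # ks), (m, f), Stay, Stay, [])"
| "delta c (At (IfZero i c1 c2 # ks)) a (m, f) =
     Some (case f i of
       None \<Rightarrow> (Back (c1 # ks), (m, f), Stay, Stay, [])
     | Some b \<Rightarrow> if b then (Back (c2 # ks), (m, f), Stay, Stay, [])
                 else (At (IfZero i c1 c2 # ks), (m, f), Move_Right, Stay, []))"
| "delta c (At (While i c1 # ks)) a (m, f) =
     Some (case f i of
       None \<Rightarrow> (Back ks, (m, f), Stay, Stay, [])
     | Some b \<Rightarrow> if b then (Back (c1 # While i c1 # ks), (m, f), Stay, Stay, [])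
                 else (At (While i c1 # ks), (m, f), Move_Right, Stay, []))"

type_synonym 'a snapshot = "'a control \<times> nat \<times> (nat \<Rightarrow> square) \<times>
    nat \<times> nat list"

definition snapshot_step :: "'a com \<Rightarrow> 'a list \<Rightarrow> 'a snapshot \<Rightarrow>
    'a snapshot option" where
  "snapshot_step c w x = (case x of (q, h, T, p, u) \<Rightarrow>
     (case delta c q (input_at w h) (T p) of
        None \<Rightarrow> None
      | Some (q', s, d, e, v) \<Rightarrow>
          Some (q', min (move_head e h) (length w + 1), T(p := s), move_head d p, u @ v)))"

abbreviation head_of :: "'a snapshot \<Rightarrow> nat" where
  "head_of x \<equiv> fst (snd (snd (snd x)))"

definition snapshot_run :: "'a com \<Rightarrow> 'a list \<Rightarrow> nat \<Rightarrow> 'a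
    snapshot \<Rightarrow> 'a snapshot \<Rightarrow> bool" where
  "snapshot_run c w K = (\<lambda>x y. snapshot_step c w x = Some y \<and> head_of x \<le>
      K)\<^sup>*\<^sup>*"

lemma snapshot_run_refl: "snapshot_run c w K x x"
  by (simp add: snapshot_run_def)

lemma snapshot_run_trans: "snapshot_run c w K x y \<Longrightarrow> snapshot_run c w K y z
    \<Longrightarrow> snapshot_run c w K x z"
  unfolding snapshot_run_def by (rule rtranclp_trans)

lemma snapshot_run_step:
  "snapshot_step c w x = Some y \<Longrightarrow> head_of x \<le> K \<Longrightarrow> snapshot_run
      c w K y z \<Longrightarrow> snapshot_run c w K x z"
  unfolding snapshot_run_def by (rule converse_rtranclp_into_rtranclp) auto

definition column :: "(nat \<Rightarrow> bool list) \<Rightarrow> nat \<Rightarrow> nat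
    \<Rightarrow> bool option" where
  "column D p = (\<lambda>i. if p < length (D i) then Some (D i ! p) else None)"

definition tape_of :: "(nat \<Rightarrow> bool list) \<Rightarrow> nat \<Rightarrow> square" where
  "tape_of D = (\<lambda>p. (p = 0, column D p))"

lemma snapshot_step_keep:
  assumes "delta c q (input_at w h) (p = 0, column D p) =
      Some (q', (p = 0, column D p), d, e, v)"
  shows "snapshot_step c w (q, h, tape_of D, p, u) =
      Some (q', min (move_head e h) (length w + 1), tape_of D, move_head d p, u @ v)"
proof -
  have "(tape_of D)(p := (p = 0, column D p)) = tape_of D"
    by (simp add: tape_of_def fun_eq_iff)
  then show ?thesis
    using assms by (simp add: snapshot_step_def tape_of_def del: fun_upd_apply)
qed

lemma snapshot_step_write:
  assumes "delta c q (input_at w h) (p = 0, column D p) =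
      Some (q', (p = 0, (column D p)(i \<mapsto> b)), d, e, v)"
    and "D i = ds @ ds'" "p = length ds"
  shows "snapshot_step c w (q, h, tape_of D, p, u) =
      Some (q', min (move_head e h) (length w + 1), tape_of (D(i := ds @ b # tl ds')),
        move_head d p, u @ v)"
proof -
  have "(tape_of D)(p := (p = 0, (column D p)(i \<mapsto> b))) = tape_of (D(i := ds @ b # tl ds'))"
    using assms(2,3)
    by (cases ds') (auto simp: tape_of_def column_def fun_eq_iff nth_append nth_Cons')
  then show ?thesis
    using assms(1) by (simp add: snapshot_step_def tape_of_def del: fun_upd_apply)
qed

lemma step_run:
  assumes "delta c q (input_at w h) (m, column D p) = Some (q', (m, column D p), d, e, v)"
    and "m = (p = 0)" "p \<le> K"
  shows "snapshot_run c w K (q, h, tape_of D, p, u)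
      (q', min (move_head e h) (length w + 1), tape_of D, move_head d p, u @ v)"
  by (rule snapshot_run_step[OF snapshot_step_keep[where d = d and e = e and v = v and q' = q'] _
      snapshot_run_refl])
    (use assms in simp_all)

lemma back_run:
  assumes "h \<le> length w + 1" "p \<le> K"
  shows "snapshot_run c w K (Back ks, h, tape_of D, p, u) (At ks, h, tape_of D, 0, u)"
  using assms(2)
proof (induction p)
  case 0
  then show ?case
    using step_run[of c "Back ks" w h True D 0 "At ks" Stay Stay "[]" K u] assms(1) by simp
next
  case (Suc p)
  have "snapshot_run c w K (Back ks, h, tape_of D, Suc p, u) (Back ks, h, tape_of D, p, u)"
    using step_run[of c "Back ks" w h False D "Suc p" "Back ks" Move_Left Stay "[]" K u] Suc
        assms(1)
    by simp
  with Suc show ?case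
    by (meson Suc_leD snapshot_run_trans)
qed

text \<open>
  The sweep has passed the digits \<open>ds\<close>, which are already final, and has a carry to
      add to \<open>ds'\<close>.
\<close>

lemma inc_run:
  assumes "h \<le> length w + 1"
    and "length ds + length ds' \<le> K"
    and "D i = ds @ ds'"
  shows "snapshot_run c w K (At (Inc i # ks), h, tape_of D, length ds, u)
           (At ks, h, tape_of (D(i := ds @ increment ds')), 0, u)"
  using assms(2-3)
proof (induction ds' arbitrary: ds D rule: increment.induct)
  case (1 ds D)
  have "snapshot_step c w (At (Inc i # ks), h, tape_of D, length ds, u)
     = Some (Back ks, h, tape_of (D(i := ds @ [True])), length ds, u)"
    by (subst snapshot_step_write[where ds = ds and ds' = "[]" and i = i and b = True])
       (use 1 assms(1) in \<open>auto simp: column_def\<close>)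
  moreover have "length ds \<le> K" using 1 by simp
  ultimately show ?case
    unfolding increment.simps decrement.simps
    by (intro snapshot_run_step[OF _ _ back_run[OF assms(1)]]) (simp_all del: fun_upd_apply)
next
  case (2 xs ds D)
  have "snapshot_step c w (At (Inc i # ks), h, tape_of D, length ds, u)
     = Some (Back ks, h, tape_of (D(i := ds @ True # xs)), length ds, u)"
    by (subst snapshot_step_write[where ds = ds and ds' = "False # xs" and i = i and b = True])
       (use 2 assms(1) in \<open>auto simp: column_def\<close>)
  moreover have "length ds \<le> K" using 2 by simp
  ultimately show ?case
    unfolding increment.simps decrement.simps
    by (intro snapshot_run_step[OF _ _ back_run[OF assms(1)]]) (simp_all del: fun_upd_apply)
next
  case (3 xs ds D)
  have "snapshot_step c w (At (Inc i # ks), h, tape_of D, length ds, u)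
     = Some (At (Inc i # ks), h, tape_of (D(i := (ds @ [False]) @ xs)), length (ds @ [False]), u)"
    by (subst snapshot_step_write[where ds = ds and ds' = "True # xs" and i = i and b = False])
       (use 3 assms(1) in \<open>auto simp: column_def\<close>)
  then show ?case
    by (rule snapshot_run_step)
      (use 3(1)[of "ds @ [False]" "D(i := (ds @ [False]) @ xs)"] 3(2-) in \<open>simp_all add:
          fun_upd_same del: fun_upd_apply\<close>)
qed

lemma dec_run:
  assumes "h \<le> length w + 1" "0 < value_of ds'"
    and "length ds + length ds' \<le> K"
    and "D i = ds @ ds'"
  shows "snapshot_run c w K (At (Dec i # ks), h, tape_of D, length ds, u)
           (At ks, h, tape_of (D(i := ds @ decrement ds')), 0, u)"
  using assms(2-4)
proof (induction ds' arbitrary: ds D rule: decrement.induct)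
  case (2 xs ds D)
  have "snapshot_step c w (At (Dec i # ks), h, tape_of D, length ds, u)
     = Some (Back ks, h, tape_of (D(i := ds @ False # xs)), length ds, u)"
    by (subst snapshot_step_write[where ds = ds and ds' = "True # xs" and i = i and b = False])
       (use 2 assms(1) in \<open>auto simp: column_def\<close>)
  moreover have "length ds \<le> K" using 2 by simp
  ultimately show ?case
    unfolding increment.simps decrement.simps
    by (intro snapshot_run_step[OF _ _ back_run[OF assms(1)]]) (simp_all del: fun_upd_apply)
next
  case (3 xs ds D)
  have "snapshot_step c w (At (Dec i # ks), h, tape_of D, length ds, u)
     = Some (At (Dec i # ks), h, tape_of (D(i := (ds @ [True]) @ xs)), length (ds @ [True]), u)"
    by (subst snapshot_step_write[where ds = ds and ds' = "False # xs" and i = i and b = True])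
       (use 3 assms(1) in \<open>auto simp: column_def\<close>)
  then show ?case
    by (rule snapshot_run_step)
      (use 3(1)[of "ds @ [True]" "D(i := (ds @ [True]) @ xs)"] 3(2-) in \<open>simp_all add:
          fun_upd_same del: fun_upd_apply\<close>)
qed simp

lemma test_run:
  assumes h: "h \<le> length w + 1"
    and K: "length ds + length ds' \<le> K" "D i = ds @ ds'"
    and ks: "ks = IfZero i c1 c2 # ks' \<and> ks0 = c1 # ks' \<and> ks1 = c2 # ks' \<or>
      ks = While i c1 # ks' \<and> ks0 = ks' \<and> ks1 = c1 # While i c1 # ks'"
  shows "snapshot_run c w K (At ks, h, tape_of D, length ds, u)
           (At (if value_of ds' = 0 then ks0 else ks1), h, tape_of D, 0, u)"
  using K
proof (induction ds' arbitrary: ds)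
  case Nil
  have "snapshot_step c w (At ks, h, tape_of D, length ds, u)
     = Some (Back ks0, h, tape_of D, length ds, u)"
    by (subst snapshot_step_keep[where q' = "Back ks0" and d = Stay and e = Stay and v = "[]"])
        (use Nil h ks in \<open>auto simp: column_def\<close>)
  moreover have "length ds \<le> K" using Nil by simp
  ultimately show ?case
    by (intro snapshot_run_step[OF _ _ back_run[OF h]]) simp_all
next
  case (Cons b xs)
  have K': "length ds \<le> K" using Cons by simp
  show ?case
  proof (cases b)
    case True
    have "snapshot_step c w (At ks, h, tape_of D, length ds, u)
       = Some (Back ks1, h, tape_of D, length ds, u)"
      by (subst snapshot_step_keep[where q' = "Back ks1" and d = Stay and e = Stay and v = "[]"])
          (use Cons h ks True in \<open>auto simp: column_def\<close>)
    then show ?thesis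
      using K' True by (intro snapshot_run_step[OF _ _ back_run[OF h]]) simp_all
  next
    case False
    have "snapshot_step c w (At ks, h, tape_of D, length ds, u)
       = Some (At ks, h, tape_of D, length (ds @ [b]), u)"
      by (subst snapshot_step_keep[where q' = "At ks" and d = Move_Right and e = Stay and v =
          "[]"]) (use Cons h ks False in \<open>auto simp: column_def\<close>)
    then show ?thesis
      by (rule snapshot_run_step) (use Cons.IH[of "ds @ [b]"] Cons.prems False in auto)
  qed
qed

definition stores :: "nat \<Rightarrow> (nat \<Rightarrow> bool list) \<Rightarrow> (nat
    \<Rightarrow> nat) \<Rightarrow> bool" where
  "stores K D \<sigma> \<longleftrightarrow> (\<forall>i. value_of (D i) = \<sigma> i \<and>
      length (D i) \<le> K)"

lemma exec_head_bound:
  "exec B w c s s' \<Longrightarrow> fst s \<le> length w + 1 \<Longrightarrow> fst s' \<le>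
      length w + 1"
  by (induction rule: exec.induct) auto

text \<open>
  Each step of a program is imitated from the marked square to the marked square, and the work head
  never moves beyond square \<open>K\<close>.
\<close>

lemma exec_run:
  assumes "exec B w c s s'" "B < 2 ^ K" "fst s \<le> length w + 1" "stores K D (fst (snd s))"
  shows "\<exists>D'. stores K D' (fst (snd s')) \<and>
    snapshot_run c0 w K (At (c # ks), fst s, tape_of D, 0, snd (snd s))
      (At ks, fst s', tape_of D', 0, snd (snd s'))"
  using assms
proof (induction arbitrary: D ks rule: exec.induct)
  case (exec_Skip s)
  then show ?case
    using step_run[of c0 "At (Skip # ks)" w "fst s" True D 0 "At ks" Stay Stay "[]" K "snd (snd s)"]
    by (intro exI[of _ D]) auto
next
  case (exec_Inc \<sigma> i h u)
  let ?D = "D(i := increment (D i))"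
  have "length (increment (D i)) \<le> max (length (D i)) K"
    by (rule length_increment) (use exec_Inc in \<open>auto simp: stores_def\<close>)
  then have "stores K ?D (\<sigma>(i := Suc (\<sigma> i)))"
    using exec_Inc by (auto simp: stores_def value_increment)
  moreover have "snapshot_run c0 w K (At (Inc i # ks), h, tape_of D, 0, u) (At ks, h, tape_of ?D,
      0, u)"
    using inc_run[of h w "[]" "D i" K D i] exec_Inc by (auto simp: stores_def)
  ultimately show ?case by (metis fst_conv snd_conv)
next
  case (exec_Dec \<sigma> i h u)
  let ?D = "D(i := decrement (D i))"
  have "stores K ?D (\<sigma>(i := \<sigma> i - 1))"
    using exec_Dec by (auto simp: stores_def value_decrement)
  moreover have "snapshot_run c0 w K (At (Dec i # ks), h, tape_of D, 0, u) (At ks, h, tape_of ?D,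
      0, u)"
    using dec_run[of h w "D i" "[]" K D i] exec_Dec by (auto simp: stores_def)
  ultimately show ?case by (metis fst_conv snd_conv)
next
  case (exec_Write y h \<sigma> u)
  then show ?case
    using step_run[of c0 "At (Write y # ks)" w h True D 0 "At ks" Stay Stay "[y]" K u]
    by (intro exI[of _ D]) auto
next
  case (exec_Move e h \<sigma> u)
  then show ?case
    using step_run[of c0 "At (Move e # ks)" w h True D 0 "At ks" Stay e "[]" K u]
    by (intro exI[of _ D]) auto
next
  case (exec_Seq c s s' c' s'')
  have "snapshot_run c0 w K (At (Seq c c' # ks), fst s, tape_of D, 0, snd (snd s))
    (At (c # c' # ks), fst s, tape_of D, 0, snd (snd s))"
    using exec_Seq.prems step_run[of c0 "At (Seq c c' # ks)" w "fst s" True D 0 "At (c # c' # ks)"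
        Stay Stay "[]" K
      "snd (snd s)"] by auto
  moreover obtain D' where "stores K D' (fst (snd s'))"
    "snapshot_run c0 w K (At (c # c' # ks), fst s, tape_of D, 0, snd (snd s))
      (At (c' # ks), fst s', tape_of D', 0, snd (snd s'))"
    using exec_Seq.IH(1)[of D "c' # ks"] exec_Seq.prems by blast
  moreover obtain D'' where "stores K D'' (fst (snd s''))"
    "snapshot_run c0 w K (At (c' # ks), fst s', tape_of D', 0, snd (snd s'))
      (At ks, fst s'', tape_of D'', 0, snd (snd s''))"
    using exec_Seq.IH(2)[of D' ks] exec_Seq.prems exec_head_bound[OF exec_Seq.hyps(1)] calculation
    by blast
  ultimately show ?case by (blast intro: snapshot_run_trans)
next
  case (exec_IfZero \<sigma> i c c' h u s)
  have "snapshot_run c0 w K (At (IfZero i c c' # ks), h, tape_of D, 0, u)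
    (At ((if \<sigma> i = 0 then c else c') # ks), h, tape_of D, 0, u)"
    using test_run[of h w "[]" "D i" K D i "IfZero i c c' # ks" c c' ks "c # ks" "c' # ks" c0 u]
      exec_IfZero.prems by (simp add: stores_def split: if_splits)
  moreover obtain D' where "stores K D' (fst (snd s))"
    "snapshot_run c0 w K (At ((if \<sigma> i = 0 then c else c') # ks), h, tape_of D, 0, u)
      (At ks, fst s, tape_of D', 0, snd (snd s))"
    using exec_IfZero.IH[of D ks] exec_IfZero.prems unfolding fst_conv snd_conv by blast
  ultimately show ?case
    unfolding fst_conv snd_conv by (blast intro: snapshot_run_trans)
next
  case (exec_IfInput h A c c' \<sigma> u s)
  have "snapshot_run c0 w K (At (IfInput A c c' # ks), h, tape_of D, 0, u)
    (At ((if input_at w h \<in> A then c else c') # ks), h, tape_of D, 0, u)"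
    using exec_IfInput.prems step_run[of c0 "At (IfInput A c c' # ks)" w h True D 0
      "At ((if input_at w h \<in> A then c else c') # ks)" Stay Stay "[]" K u] by auto
  moreover obtain D' where "stores K D' (fst (snd s))"
    "snapshot_run c0 w K (At ((if input_at w h \<in> A then c else c') # ks), h, tape_of D, 0, u)
      (At ks, fst s, tape_of D', 0, snd (snd s))"
    using exec_IfInput.IH[of D ks] exec_IfInput.prems unfolding fst_conv snd_conv by blast
  ultimately show ?case
    unfolding fst_conv snd_conv by (blast intro: snapshot_run_trans)
next
  case (exec_While_done \<sigma> i c h u)
  have "snapshot_run c0 w K (At (While i c # ks), h, tape_of D, 0, u) (At ks, h, tape_of D, 0, u)"
    using test_run[of h w "[]" "D i" K D i "While i c # ks" c c ks ks "c # While i c # ks" c0 u]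
      exec_While_done by (auto simp: stores_def)
  with exec_While_done show ?case by auto
next
  case (exec_While_step \<sigma> i c h u s s')
  have "snapshot_run c0 w K (At (While i c # ks), h, tape_of D, 0, u)
      (At (c # While i c # ks), h, tape_of D, 0, u)"
    using test_run[of h w "[]" "D i" K D i "While i c # ks" c c ks ks "c # While i c # ks" c0 u]
      exec_While_step.prems exec_While_step.hyps by (auto simp: stores_def)
  moreover obtain D' where "stores K D' (fst (snd s))"
    "snapshot_run c0 w K (At (c # While i c # ks), h, tape_of D, 0, u)
      (At (While i c # ks), fst s, tape_of D', 0, snd (snd s))"
    using exec_While_step.IH(1)[of D "While i c # ks"] exec_While_step.prems unfolding fst_conv
        snd_conv by blast
  moreover have "fst s \<le> length w + 1"
    using exec_head_bound[OF exec_While_step.hyps(2)] exec_While_step.prems by simp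
  moreover obtain D'' where "stores K D'' (fst (snd s'))"
    "snapshot_run c0 w K (At (While i c # ks), fst s, tape_of D', 0, snd (snd s))
      (At ks, fst s', tape_of D'', 0, snd (snd s'))"
    using exec_While_step.IH(2)[of D' ks] calculation exec_While_step.prems by blast
  ultimately show ?case
    unfolding fst_conv snd_conv by (blast intro: snapshot_run_trans)
qed

section \<open>The transducer of a program\<close>

text \<open>
  The lists that can appear in the control while \<open>c\<close> is executed before
      \<open>ks\<close>. There are finitely
  many, so that the control is finite although the type of its states is not.
\<close>

fun continuations :: "'a com \<Rightarrow> 'a com list \<Rightarrow> 'a com list set" where
  "continuations (Seq c c') ks =
     insert (Seq c c' # ks) (continuations c (c' # ks) \<union> continuations c' ks)"
| "continuations (IfZero i c c') ks =
     insert (IfZero i c c' # ks) (continuations c ks \<union> continuations c' ks)"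
| "continuations (IfInput A c c') ks =
     insert (IfInput A c c' # ks) (continuations c ks \<union> continuations c' ks)"
| "continuations (While i c) ks = insert (While i c # ks) (continuations c (While i c # ks))"
| "continuations c ks = {c # ks}"

fun registers :: "'a com \<Rightarrow> nat set" where
  "registers (Inc i) = {i}"
| "registers (Dec i) = {i}"
| "registers (Seq c c') = registers c \<union> registers c'"
| "registers (IfZero i c c') = insert i (registers c \<union> registers c')"
| "registers (IfInput A c c') = registers c \<union> registers c'"
| "registers (While i c) = insert i (registers c)"
| "registers _ = {}"

fun letters :: "'a com \<Rightarrow> nat set" where
  "letters (Write y) = {y}"
| "letters (Seq c c') = letters c \<union> letters c'"
| "letters (IfZero i c c') = letters c \<union> letters c'"
| "letters (IfInput A c c') = letters c \<union> letters c'"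
| "letters (While i c) = letters c"
| "letters _ = {}"

lemma finite_continuations [simp]: "finite (continuations c ks)"
  by (induction c arbitrary: ks) auto

lemma finite_registers [simp]: "finite (registers c)"
  by (induction c) auto

lemma Cons_in_continuations [simp]: "c # ks \<in> continuations c ks"
  by (cases c) auto

lemma continuations_step:
  assumes "ks' \<in> continuations c ks" "delta c0 (At ks') a (m, f) = Some (q, s, d, e, v)"
  shows "q \<in> At ` insert ks (continuations c ks) \<union> Back ` insert ks (continuations c ks)"
  using assms
proof (induction c arbitrary: ks)
  case (Seq c c')
  consider "ks' = Seq c c' # ks" | "ks' \<in> continuations c (c' # ks)" | "ks' \<in>
      continuations c' ks"
    using Seq.prems(1) by auto
  then show ?case
  proof cases
    case 1
    then show ?thesis using Seq.prems(2) by auto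
  next
    case 2
    show ?thesis
      using Seq.IH(1)[OF 2 Seq.prems(2)] Cons_in_continuations[of c' ks] by auto
  next
    case 3
    show ?thesis
      using Seq.IH(2)[OF 3 Seq.prems(2)] by auto
  qed
next
  case (IfZero i c c')
  then show ?case
    using IfZero.IH(1)[of ks] IfZero.IH(2)[of ks] by (auto simp: image_Un split: option.splits
        if_splits)
next
  case (IfInput A c c')
  then show ?case
    using IfInput.IH(1)[of ks] IfInput.IH(2)[of ks] by (auto simp: image_Un split: if_splits)
next
  case (While i c)
  then show ?case
    using While.IH(1)[of "While i c # ks"] by (auto split: option.splits if_splits)
qed (auto split: if_splits)

lemma continuations_subset:
  assumes "ks' \<in> continuations c ks" "c' \<in> set ks'"
  shows "c' \<in> set ks \<or> registers c' \<subseteq> registers c \<and> letters c' \<subseteq>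
      letters c"
  using assms
proof (induction c arbitrary: ks)
  case (Seq c1 c2)
  then show ?case using Seq.IH(1)[of "c2 # ks"] Seq.IH(2)[of ks] by auto
next
  case (IfZero i c1 c2)
  then show ?case using IfZero.IH(1)[of ks] IfZero.IH(2)[of ks] by auto
next
  case (IfInput A c1 c2)
  then show ?case using IfInput.IH(1)[of ks] IfInput.IH(2)[of ks] by auto
next
  case (While i c1)
  then show ?case using While.IH[of "While i c1 # ks"] by auto
qed auto

definition control_states :: "'a com \<Rightarrow> 'a control set" where
  "control_states c =
     {Boot} \<union> At ` insert [] (continuations c []) \<union> Back ` insert [] (continuations
         c [])"

definition squares :: "'a com \<Rightarrow> square set" where
  "squares c = UNIV \<times> {f. dom f \<subseteq> registers c}"

lemma finite_control_states: "finite (control_states c)"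
  by (simp add: control_states_def)

lemma finite_squares: "finite (squares c)"
proof -
  have "{f :: nat \<Rightarrow> bool option. dom f \<subseteq> registers c}
      \<subseteq> (\<Union>A\<in>Pow (registers c). {f. dom f = A \<and> ran f \<subseteq> UNIV})"
    by auto
  moreover have "finite (\<Union>A\<in>Pow (registers c). {f :: nat \<Rightarrow> bool option. dom
      f = A \<and> ran f \<subseteq> UNIV})"
    by (intro finite_UN_I finite_set_of_finite_maps)
       (auto intro: finite_subset[OF _ finite_registers])
  ultimately have "finite {f :: nat \<Rightarrow> bool option. dom f \<subseteq> registers c}"
    by (rule finite_subset)
  then show ?thesis
    unfolding squares_def by (rule finite_cartesian_product[OF finite])
qed

lemma delta_closed:
  assumes "q \<in> control_states c" "s \<in> squares c" "delta c q a s = Some (q', s', d, e, v)"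
  shows "q' \<in> control_states c \<and> s' \<in> squares c \<and> set v \<subseteq> letters c
      \<and> length v \<le> 1"
proof -
  obtain m f where s: "s = (m, f)" and f: "dom f \<subseteq> registers c"
    using assms(2) by (auto simp: squares_def)
  show ?thesis
  proof (cases q)
    case Boot
    then show ?thesis using assms(3) s f by (auto simp: control_states_def squares_def)
  next
    case (Back ks)
    then show ?thesis using assms(1,3) s f
      by (auto simp: control_states_def squares_def split: if_splits)
  next
    case (At ks)
    show ?thesis
    proof (cases ks)
      case Nil
      then show ?thesis using assms(3) s At by simp
    next
      case (Cons k ks')
      have mem: "k # ks' \<in> continuations c []"
        using assms(1) At Cons by (auto simp: control_states_def)
      have "q' \<in> control_states c"
        using continuations_step[OF mem, of c a m f q'] assms(3)
        unfolding control_states_def s At Cons by blast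
      moreover have "registers k \<subseteq> registers c \<and> letters k \<subseteq> letters c"
        using continuations_subset[OF mem, of k] by simp
      moreover have "x \<in> registers c" if "f x = Some y" for x y
        using f that by auto
      ultimately show ?thesis using assms(3) unfolding s At Cons
        by (cases k) (auto simp: squares_def split: if_splits option.splits)
    qed
  qed
qed

text \<open>
  Counters with polynomially bounded values have logarithmically many binary digits.
\<close>

lemma log_space_for_polynomial:
  "\<exists>k. (n + 2) ^ d < (2 :: nat) ^ k \<and> real (k + 1) \<le> real (4 * d + 2) * log 2
      (real (max 2 n))"
proof -
  define m where "m = max 2 n"
  have m2: "2 \<le> m" by (simp add: m_def)
  \<comment> \<open>the integer part of the binary logarithm of \<open>m\<close>\<close>
  obtain l where l: "2 ^ l \<le> m" "m < 2 ^ (l + 1)"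
    using ex_power_ivl1[of 2 m] m2 by auto
  have "l \<noteq> 0" using l m2 by (cases l) auto
  have "n + 2 \<le> m ^ 2"
  proof (cases "n \<le> 1")
    case True
    then show ?thesis by (simp add: m_def)
  next
    case False
    then have "m = n" "2 * n \<le> n * n" by (auto simp: m_def)
    moreover have "n + 2 \<le> 2 * n" using False by simp
    ultimately have "m = n" "n + 2 \<le> n * n" by linarith+
    then show ?thesis by (simp add: power2_eq_square)
  qed
  then have "(n + 2) ^ d \<le> (m ^ 2) ^ d" by (rule power_mono) simp
  also have "\<dots> \<le> ((2 ^ (l + 1)) ^ 2) ^ d"
    using l by (intro power_mono) auto
  also have "\<dots> = 2 ^ (2 * d * (l + 1))" by (simp only: power_mult[symmetric] mult_ac)
  also have "\<dots> < 2 ^ (2 * d * (l + 1) + 1)" by simp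
  finally have "(n + 2) ^ d < 2 ^ (2 * d * (l + 1) + 1)" .
  moreover have "real (2 * d * (l + 1) + 1 + 1) \<le> real (4 * d + 2) * log 2 (real m)"
  proof -
    have "d * (l + 1) \<le> d * (2 * l)" using \<open>l \<noteq> 0\<close> by (intro
        mult_le_mono2) simp
    then have "2 * (d * (l + 1)) + 2 \<le> 2 * (d * (2 * l)) + 2 * l"
      using \<open>l \<noteq> 0\<close> by linarith
    then have "2 * d * (l + 1) + 1 + 1 \<le> (4 * d + 2) * l"
      using \<open>l \<noteq> 0\<close> by (auto simp: algebra_simps)
    then have "real (2 * d * (l + 1) + 1 + 1) \<le> real (4 * d + 2) * real l"
      by (metis of_nat_le_iff of_nat_mult)
    also have "real l \<le> log 2 (real m)"
      using l m2 by (simp add: le_log2_of_power)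
    finally show ?thesis by (simp add: mult_left_mono)
  qed
  ultimately show ?thesis unfolding m_def by blast
qed

context
  fixes c :: "'a com" and dec :: "nat \<Rightarrow> 'b" and Y :: "'b set" and X :: "'a set"
    and cq :: "'a control \<Rightarrow> nat" and cs :: "square \<Rightarrow> nat"
  assumes inj_cq: "inj_on cq (control_states c)" and inj_cs: "inj_on cs (squares c)"
    and dec: "dec ` letters c \<subseteq> Y"
begin

definition machine :: "('a, 'b) transducer" where
  "machine = \<lparr>states = cq ` control_states c, start_state = cq Boot,
     work_symbols = cs ` squares c, blank_symbol = cs (False, Map.empty),
     transition = (\<lambda>q a s.
       if q \<in> cq ` control_states c \<and> s \<in> cs ` squares c
       then map_option (\<lambda>(q', s', d, e, v). (cq q', cs s', d, e, map dec v))
         (delta c (inv_into (control_states c) cq q) a (inv_into (squares c) cs s))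
       else None)\<rparr>"

definition config_of :: "'a snapshot \<Rightarrow> 'b config" where
  "config_of x = (case x of (q, h, T, p, u) \<Rightarrow>
     \<lparr>state = cq q, input_pos = h, work_tape = (\<lambda>j. cs (T j)), work_pos = p,
       written = map dec u\<rparr>)"

definition proper :: "'a snapshot \<Rightarrow> bool" where
  "proper x \<longleftrightarrow> fst x \<in> control_states c \<and> (\<forall>j. fst (snd (snd
      x)) j \<in> squares c)"

lemma transition_machine:
  assumes "q \<in> control_states c" "s \<in> squares c"
  shows "transition machine (cq q) a (cs s) =
      map_option (\<lambda>(q', s', d, e, v). (cq q', cs s', d, e, map dec v)) (delta c q a s)"
  using assms inj_cq inj_cs by (simp add: machine_def del: split_paired_all)

lemma wf_machine: "wf_transducer X Y machine"
  unfolding wf_transducer_def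
proof (intro conjI exI[of _ 1] ballI allI impI)
  have "(False, Map.empty) \<in> squares c" "Boot \<in> control_states c"
    by (auto simp: squares_def control_states_def)
  then show "start_state machine \<in> states machine" "blank_symbol machine \<in> work_symbols
      machine"
    by (simp_all add: machine_def)
  fix q a s q' s' d e v
  assume "q \<in> states machine" "s \<in> work_symbols machine"
    and tr: "transition machine q a s = Some (q', s', d, e, v)"
  then obtain q0 s0 where qs: "q = cq q0" "q0 \<in> control_states c" "s = cs s0" "s0 \<in>
      squares c"
    by (auto simp: machine_def)
  then obtain q1 s1 v1 where *: "delta c q0 a s0 = Some (q1, s1, d, e, v1)"
      "q' = cq q1" "s' = cs s1" "v = map dec v1"
    using tr by (auto simp: transition_machine)
  note closed = delta_closed[OF qs(2,4) *(1)]
  show "q' \<in> states machine" "s' \<in> work_symbols machine" "length v \<le> 1"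
    using closed *(2-) by (simp_all add: machine_def)
  have "dec ` set v1 \<subseteq> Y"
    by (rule subset_trans[OF image_mono dec]) (use closed in simp)
  then show "v \<in> lists Y"
    using *(4) by auto
qed (simp_all add: machine_def finite_control_states finite_squares)

lemma step_machine:
  assumes "proper x"
  shows "step machine w (config_of x) = map_option config_of (snapshot_step c w x)"
proof -
  obtain q h T p u where x: "x = (q, h, T, p, u)" by (cases x)
  have "q \<in> control_states c" "T p \<in> squares c"
    using assms by (simp_all add: x proper_def)
  note tr = transition_machine[OF this]
  show ?thesis
  proof (cases "delta c q (input_at w h) (T p)")
    case None
    then show ?thesis by (simp add: x step_def snapshot_step_def config_of_def tr)
  next
    case (Some y)
    then show ?thesis
      by (cases y) (simp add: x step_def snapshot_step_def config_of_def tr fun_eq_iff)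
  qed
qed

lemma proper_step:
  assumes "proper x" "snapshot_step c w x = Some y"
  shows "proper y"
proof -
  obtain q h T p u where x: "x = (q, h, T, p, u)" by (cases x)
  obtain q' s d e v where *: "delta c q (input_at w h) (T p) = Some (q', s, d, e, v)"
      "y = (q', min (move_head e h) (length w + 1), T(p := s), move_head d p, u @ v)"
    using assms(2) by (auto simp: x snapshot_step_def split: option.splits)
  have "q \<in> control_states c" "T p \<in> squares c"
    using assms by (simp_all add: x proper_def)
  from delta_closed[OF this *(1)] show ?thesis
    using assms(1) by (simp add: proper_def x *(2))
qed

lemma machine_run:
  assumes "snapshot_run c w k x y" "proper x"
  shows "(config_of x, config_of y) \<in> {(c, c'). step machine w c = Some c'}\<^sup>* \<and>
      proper y"
  using assms(1)[unfolded snapshot_run_def] assms(2)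
proof (induction rule: converse_rtranclp_induct)
  case (step x z)
  have "step machine w (config_of x) = Some (config_of z)"
    unfolding step_machine[OF step.prems] conjunct1[OF step.hyps(1)] by (rule option.map(2))
  moreover have "proper z"
    by (rule proper_step[OF step.prems conjunct1[OF step.hyps(1)]])
  ultimately show ?case
    using converse_rtrancl_into_rtrancl[OF _ conjunct1[OF step.IH]] step.IH by simp
qed simp

text \<open>
  As the machine is deterministic, every reachable configuration lies on the run that halts, so the
  bound on the work head along this run holds for all of them.
\<close>

lemma machine_head:
  assumes "snapshot_run c w k x y" "proper x" "snapshot_step c w y = None" "head_of y \<le> k"
    and "(config_of x, cf) \<in> {(c, c'). step machine w c = Some c'}\<^sup>*"
  shows "work_pos cf \<le> k"
  using assms(1)[unfolded snapshot_run_def] assms(2-)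
proof (induction arbitrary: cf rule: converse_rtranclp_induct)
  case base
  have "cf = config_of y"
    using base(4)
  proof (cases rule: converse_rtranclE)
    case (step c')
    then show ?thesis
      using step_machine[OF base(1), of w] base(2) by simp
  qed simp
  then show ?case using base(3) by (simp add: config_of_def split: prod.splits)
next
  case (step x z)
  have *: "step machine w (config_of x) = Some (config_of z)" "proper z"
    unfolding step_machine[OF step.prems(1)] conjunct1[OF step.hyps(1)]
    by (rule option.map(2)) (rule proper_step[OF step.prems(1) conjunct1[OF step.hyps(1)]])
  note IH = step.IH[OF *(2) step.prems(2,3)]
  have head: "head_of x \<le> k" using step.hyps by simp
  from step.prems(4) show ?case
  proof (cases rule: converse_rtranclE)
    case base
    then show ?thesis using head by (auto simp: config_of_def split: prod.splits)
  next
    case (step c')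
    then have "c' = config_of z" using *(1) by auto
    then show ?thesis using IH step(2) by simp
  qed
qed

lemma machine_correct:
  assumes "exec B w c (0, \<lambda>_. 0, []) (h, \<sigma>, u)" "B < 2 ^ k"
  shows "outputs_on machine w (map dec u)" "reachable machine w cf \<Longrightarrow> work_pos cf
      \<le> k"
proof -
  let ?x = "(Boot, 0, \<lambda>_. (False, Map.empty), 0, []) :: 'a snapshot"
  have init: "initial_config machine = config_of ?x"
    by (simp add: initial_config_def machine_def config_of_def)
  have proper: "proper ?x" by (auto simp: proper_def control_states_def squares_def)
  obtain D where D: "snapshot_run c w k (At [c], 0, tape_of (\<lambda>_. []), 0, []) (At [], h,
      tape_of D, 0, u)"
    using exec_run[OF assms, of "\<lambda>_. []" c "[]"] by (auto simp: stores_def)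
  have "snapshot_step c w ?x = Some (At [c], 0, tape_of (\<lambda>_. []), 0, [])"
    by (auto simp: snapshot_step_def tape_of_def column_def fun_eq_iff)
  then have run: "snapshot_run c w k ?x (At [], h, tape_of D, 0, u)"
    by (rule snapshot_run_step[OF _ _ D]) simp
  have halt: "snapshot_step c w (At [], h, tape_of D, 0, u) = None"
    by (simp add: snapshot_step_def tape_of_def)
  note * = machine_run[OF run proper]
  have "step machine w (config_of (At [], h, tape_of D, 0, u)) = None"
    using step_machine[of "(At [], h, tape_of D, 0, u)" w] * halt by simp
  then show "outputs_on machine w (map dec u)"
    using * unfolding outputs_on_def reachable_def init
    by (intro exI[of _ "config_of (At [], h, tape_of D, 0, u)"]) (simp add: config_of_def)
  show "work_pos cf \<le> k" if "reachable machine w cf"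
    using machine_head[OF run proper halt] that unfolding reachable_def init by simp
qed

end

text \<open>
  Control states and squares are coded by numbers, using that both sets are finite.
\<close>

theorem program_logspace_computable:
  fixes c :: "'a com" and f :: "'a list \<Rightarrow> 'b list"
  assumes "finite X" "finite Y" "f \<in> lists X \<rightarrow> lists Y" "dec ` letters c
      \<subseteq> Y"
    and run: "\<And>w. w \<in> lists X \<Longrightarrow>
      \<exists>h \<sigma> u. exec ((length w + 2) ^ d) w c (0, \<lambda>_. 0, []) (h, \<sigma>, u)
          \<and> map dec u = f w"
  shows "logspace_computable X Y f"
proof -
  obtain cq :: "'a control \<Rightarrow> nat" where cq: "inj_on cq (control_states c)"
    using finite_imp_inj_to_nat_seg[OF finite_control_states[of c]] by auto
  obtain cs :: "square \<Rightarrow> nat" where cs: "inj_on cs (squares c)"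
    using finite_imp_inj_to_nat_seg[OF finite_squares[of c]] by auto
  let ?M = "machine c dec cq cs"
  have "in_logspace_on ?M (4 * d + 2) w \<and> outputs_on ?M w (f w)" if w: "w \<in> lists X" for w
  proof -
    obtain h \<sigma> u where *: "exec ((length w + 2) ^ d) w c (0, \<lambda>_. 0, []) (h,
        \<sigma>, u)" "map dec u = f w"
      using run[OF w] by blast
    obtain k where k: "(length w + 2) ^ d < (2 :: nat) ^ k"
        "real (k + 1) \<le> real (4 * d + 2) * log 2 (real (max 2 (length w)))"
      using log_space_for_polynomial by blast
    have "real (work_pos cf + 1) \<le> real (4 * d + 2) * log 2 (real (max 2 (length w)))"
      if "reachable ?M w cf" for cf
      using machine_correct(2)[OF cq cs assms(4) *(1) k(1) that] k(2) by linarith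
    then show ?thesis
      using machine_correct(1)[OF cq cs assms(4) *(1) k(1)] *(2)
      unfolding in_logspace_on_def by auto
  qed
  then show ?thesis
    unfolding logspace_computable_def using assms(1-3) wf_machine[OF cq cs assms(4)]
    by (intro conjI exI[of _ ?M] exI[of _ "4 * d + 2"]) simp_all
qed

section \<open>Executions on registers\<close>

text \<open>
  Subprograms that compute numbers move the input head, but nothing depends on where they leave it:
  it is moved to the left end before the input is read.
\<close>

definition run :: "nat \<Rightarrow> 'a list \<Rightarrow> 'a com \<Rightarrow> (nat \<Rightarrow>
    nat) \<Rightarrow> (nat \<Rightarrow> nat) \<Rightarrow> bool" where
  "run B w c \<sigma> \<sigma>' \<longleftrightarrow> (\<forall>h u. h \<le> length w + 1
      \<longrightarrow>
     (\<exists>h'. h' \<le> length w + 1 \<and> exec B w c (h, \<sigma>, u) (h', \<sigma>', u)))"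

lemma run_mono: "run B w c \<sigma> \<sigma>' \<Longrightarrow> B \<le> B' \<Longrightarrow> run
    B' w c \<sigma> \<sigma>'"
  unfolding run_def using exec_mono by blast

lemma run_Skip: "run B w Skip \<sigma> \<sigma>"
  unfolding run_def using exec_Skip by blast

lemma run_Inc: "\<sigma> i < B \<Longrightarrow> run B w (Inc i) \<sigma> (\<sigma>(i := Suc
    (\<sigma> i)))"
  unfolding run_def using exec_Inc by blast

lemma run_Dec: "0 < \<sigma> i \<Longrightarrow> run B w (Dec i) \<sigma> (\<sigma>(i := \<sigma>
    i - 1))"
  unfolding run_def using exec_Dec by blast

lemma run_Seq:
  assumes "run B w c \<sigma> \<sigma>'" "run B w c' \<sigma>' \<sigma>''"
  shows "run B w (Seq c c') \<sigma> \<sigma>''"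
  unfolding run_def
proof (intro allI impI)
  fix h u assume "h \<le> length w + 1"
  then obtain h' where h': "h' \<le> length w + 1" "exec B w c (h, \<sigma>, u) (h', \<sigma>', u)"
    using assms(1) unfolding run_def by blast
  then obtain h'' where "h'' \<le> length w + 1" "exec B w c' (h', \<sigma>', u) (h'', \<sigma>'',
      u)"
    using assms(2) unfolding run_def by blast
  with h'(2) show "\<exists>h'. h' \<le> length w + 1 \<and> exec B w (Seq c c') (h, \<sigma>, u)
      (h', \<sigma>'', u)"
    by (blast intro: exec_Seq)
qed

lemma run_While:
  assumes "\<And>j. j < N \<Longrightarrow> run B w c (S j) (S (Suc j))" "\<And>j. j < N
      \<Longrightarrow> S j i \<noteq> 0" "S N i = 0"
  shows "run B w (While i c) (S 0) (S N)"
proof -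
  have "run B w (While i c) (S j) (S N)" if "j \<le> N" for j
    using that
  proof (induction rule: inc_induct)
    case base
    then show ?case unfolding run_def using exec_While_done[of "S N" i, OF assms(3)] by blast
  next
    case (step j)
    show ?case
      unfolding run_def
    proof (intro allI impI)
      fix h u assume "h \<le> length w + 1"
      then obtain h' where "h' \<le> length w + 1" "exec B w c (h, S j, u) (h', S (Suc j), u)"
        using assms(1)[OF step(2)] unfolding run_def by blast
      moreover then obtain h'' where
        "h'' \<le> length w + 1" "exec B w (While i c) (h', S (Suc j), u) (h'', S N, u)"
        using step.IH unfolding run_def by blast
      ultimately show "\<exists>h'. h' \<le> length w + 1 \<and> exec B w (While i c) (h, S j, u)
          (h', S N, u)"
        using exec_While_step[of "S j" i, OF assms(2)[OF step(2)]] by blast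
    qed
  qed
  then show ?thesis by simp
qed

definition clear :: "nat \<Rightarrow> 'a com" where
  "clear t = While t (Dec t)"

lemma run_clear: "run B w (clear t) \<sigma> (\<sigma>(t := 0))"
proof -
  have "run B w (While t (Dec t)) (\<sigma>(t := \<sigma> t - 0)) (\<sigma>(t := \<sigma> t -
      \<sigma> t))"
  proof (rule run_While)
    fix j assume "j < \<sigma> t"
    then show "run B w (Dec t) (\<sigma>(t := \<sigma> t - j)) (\<sigma>(t := \<sigma> t - Suc j))"
      using run_Dec[of "\<sigma>(t := \<sigma> t - j)" t B w] by simp
  qed auto
  then show ?thesis by (simp add: clear_def)
qed

text \<open>
  The register \<open>m\<close> is scratch space: the value of \<open>a\<close> is moved to both
      \<open>t\<close> and \<open>m\<close> and then
  moved back.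
\<close>

definition transfer :: "nat \<Rightarrow> nat \<Rightarrow> nat \<Rightarrow> 'a com" where
  "transfer a t m = Seq (clear t) (Seq
     (While a (Seq (Dec a) (Seq (Inc t) (Inc m))))
     (While m (Seq (Dec m) (Inc a))))"

definition copy :: "nat \<Rightarrow> nat \<Rightarrow> nat \<Rightarrow> 'a com" where
  "copy a t m = (if a = t then Skip else transfer a t m)"

lemma run_transfer:
  assumes "a \<noteq> t" "a \<noteq> m" "t \<noteq> m" "\<sigma> m = 0" "\<sigma> a \<le> B"
  shows "run B w (transfer a t m) \<sigma> (\<sigma>(t := \<sigma> a))"
proof -
  define S where "S = (\<lambda>j. \<sigma>(t := j, m := j, a := \<sigma> a - j))"
  define S' where "S' = (\<lambda>j. \<sigma>(t := \<sigma> a, m := \<sigma> a - j, a := j))"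
  have r1: "run B w (While a (Seq (Dec a) (Seq (Inc t) (Inc m)))) (S 0) (S (\<sigma> a))"
  proof (rule run_While)
    fix j assume j: "j < \<sigma> a"
    have s1: "run B w (Dec a) (S j) ((S j)(a := \<sigma> a - Suc j))"
      using run_Dec[of "S j" a B w] j by (simp add: S_def)
    have s2: "run B w (Inc t) ((S j)(a := \<sigma> a - Suc j)) ((S j)(a := \<sigma> a - Suc j, t
        := Suc j))"
      using run_Inc[of "(S j)(a := \<sigma> a - Suc j)" t B w] j assms by (simp add: S_def)
    have s3: "run B w (Inc m) ((S j)(a := \<sigma> a - Suc j, t := Suc j))
        ((S j)(a := \<sigma> a - Suc j, t := Suc j, m := Suc j))"
      using run_Inc[of "(S j)(a := \<sigma> a - Suc j, t := Suc j)" m B w] j assms by (simp add: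
          S_def)
    have "(S j)(a := \<sigma> a - Suc j, t := Suc j, m := Suc j) = S (Suc j)"
      using assms by (auto simp: S_def fun_eq_iff)
    then show "run B w (Seq (Dec a) (Seq (Inc t) (Inc m))) (S j) (S (Suc j))"
      using run_Seq[OF s1 run_Seq[OF s2 s3]] by simp
  qed (auto simp: S_def)
  have r2: "run B w (While m (Seq (Dec m) (Inc a))) (S' 0) (S' (\<sigma> a))"
  proof (rule run_While)
    fix j assume j: "j < \<sigma> a"
    have s1: "run B w (Dec m) (S' j) ((S' j)(m := \<sigma> a - Suc j))"
      using run_Dec[of "S' j" m B w] j assms by (simp add: S'_def)
    have s2: "run B w (Inc a) ((S' j)(m := \<sigma> a - Suc j)) ((S' j)(m := \<sigma> a - Suc j, a
        := Suc j))"
      using run_Inc[of "(S' j)(m := \<sigma> a - Suc j)" a B w] j assms by (simp add: S'_def)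
    have "(S' j)(m := \<sigma> a - Suc j, a := Suc j) = S' (Suc j)"
      using assms by (auto simp: S'_def fun_eq_iff)
    then show "run B w (Seq (Dec m) (Inc a)) (S' j) (S' (Suc j))"
      using run_Seq[OF s1 s2] by simp
  qed (use assms in \<open>auto simp: S'_def\<close>)
  have eqs: "\<sigma>(t := 0) = S 0" "S' 0 = S (\<sigma> a)" "\<sigma>(t := \<sigma> a) = S'
      (\<sigma> a)"
    using assms by (auto simp: S_def S'_def fun_eq_iff)
  have "run B w (clear t) \<sigma> (S 0)"
    using run_clear[of B w t \<sigma>] unfolding eqs .
  from run_Seq[OF this run_Seq[OF r1 r2[unfolded eqs]]] show ?thesis
    unfolding transfer_def eqs .
qed

lemma run_copy:
  assumes "a < m" "t < m" "\<sigma> m = 0" "\<sigma> a \<le> B"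
  shows "run B w (copy a t m) \<sigma> (\<sigma>(t := \<sigma> a))"
  using assms run_transfer[of a t m \<sigma> B w] run_Skip[of B w \<sigma>]
  by (cases "a = t") (auto simp: copy_def)

lemma letters_copy [simp]: "letters (clear t) = {}" "letters (copy a t m) = {}"
  by (auto simp: copy_def transfer_def clear_def)

section \<open>Numeric functions of a word in logarithmic space\<close>

text \<open>
  The functions take the input word and an assignment of numbers to variables. Values are compared
  with powers of \<open>length w + 2\<close>, because these exceed \<open>1\<close> also for the
      empty word.
\<close>

definition poly_bounded :: "'a set \<Rightarrow> ('a list \<Rightarrow> (nat \<Rightarrow> nat)
    \<Rightarrow> nat) \<Rightarrow> bool" where
  "poly_bounded X F \<longleftrightarrow> (\<forall>d. \<exists>d'. \<forall>w \<in> lists X.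
      \<forall>s. (\<forall>i. s i \<le> (length w + 2) ^ d) \<longrightarrow>
     F w s \<le> (length w + 2) ^ d')"

text \<open>
  The variable \<open>i\<close> is kept in the register \<open>\<rho> i\<close>; all registers
      from \<open>m\<close> on are free for
  intermediate results and are returned empty. The same program must serve all polynomial bounds on
  the registers.
\<close>

definition computes ::
    "'a set \<Rightarrow> nat \<Rightarrow> (nat \<Rightarrow> nat) \<Rightarrow> nat
        \<Rightarrow> 'a com \<Rightarrow> ('a list \<Rightarrow> (nat \<Rightarrow> nat)
        \<Rightarrow> nat) \<Rightarrow> bool" where
  "computes X m \<rho> t c F \<longleftrightarrow> letters c = {} \<and>
     (\<forall>d. \<exists>d'. \<forall>w \<in> lists X. \<forall>\<sigma>.
        (\<forall>i. \<sigma> i \<le> (length w + 2) ^ d) \<longrightarrow> (\<forall>i\<ge>m.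
            \<sigma> i = 0) \<longrightarrow>
          run ((length w + 2) ^ d') w c \<sigma> (\<sigma>(t := F w (\<lambda>i. \<sigma> (\<rho>
              i)))))"

text \<open>
  A program is demanded for every layout \<open>\<rho>\<close> of the variables, including layouts
      that keep several
  variables in one register. Renaming and identifying variables then only changes the layout.
\<close>

definition log_fun :: "'a set \<Rightarrow> ('a list \<Rightarrow> (nat \<Rightarrow> nat)
    \<Rightarrow> nat) \<Rightarrow> bool" where
  "log_fun X F \<longleftrightarrow> poly_bounded X F \<and>
     (\<forall>m \<rho> t. (\<forall>i. \<rho> i < m) \<longrightarrow> t < m \<longrightarrow>
         (\<exists>c. computes X m \<rho> t c F))"

lemma power_le [intro]: "d \<le> d' \<Longrightarrow> ((n :: nat) + 2) ^ d \<le> (n + 2) ^ d'"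
  by (rule power_increasing) auto

lemma poly_boundE:
  assumes "poly_bounded X F"
  obtains d' where "d \<le> d'" "\<And>w (s :: nat \<Rightarrow> nat). w \<in> lists X
      \<Longrightarrow> (\<And>i. s i \<le> (length w + 2) ^ d) \<Longrightarrow>
     F w s \<le> (length w + 2) ^ d'"
proof -
  obtain d1 where d1: "\<And>w (s :: nat \<Rightarrow> nat). w \<in> lists X \<Longrightarrow>
      (\<And>i. s i \<le> (length w + 2) ^ d) \<Longrightarrow>
     F w s \<le> (length w + 2) ^ d1"
    using assms[unfolded poly_bounded_def, rule_format, of d] by blast
  show ?thesis
  proof (rule that[of "max d d1"])
    fix w and s :: "nat \<Rightarrow> nat" assume "w \<in> lists X" "\<And>i. s i \<le> (length w
        + 2) ^ d"
    from d1[OF this] show "F w s \<le> (length w + 2) ^ max d d1"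
      by (rule order_trans) auto
  qed simp
qed

lemma log_fun_poly_bounded: "log_fun X F \<Longrightarrow> poly_bounded X F"
  by (simp add: log_fun_def)

lemmas log_fun_bound = poly_boundE[OF log_fun_poly_bounded]

lemma log_fun_compute:
  assumes "log_fun X F" "\<And>i. \<rho> i < m" "t < m"
  obtains c where "computes X m \<rho> t c F"
  using assms unfolding log_fun_def by blast

lemma computes_run:
  assumes "computes X m \<rho> t c F"
  obtains d' where "d \<le> d'" "\<And>w \<sigma> e. w \<in> lists X \<Longrightarrow> (\<And>i.
      \<sigma> i \<le> (length w + 2) ^ d) \<Longrightarrow>
     (\<And>i. m \<le> i \<Longrightarrow> \<sigma> i = 0) \<Longrightarrow> d' \<le> e
         \<Longrightarrow>
     run ((length w + 2) ^ e) w c \<sigma> (\<sigma>(t := F w (\<lambda>i. \<sigma> (\<rho> i))))"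
proof -
  obtain d1 where d1: "\<And>w \<sigma>. w \<in> lists X \<Longrightarrow> (\<And>i. \<sigma> i
      \<le> (length w + 2) ^ d) \<Longrightarrow>
     (\<And>i. m \<le> i \<Longrightarrow> \<sigma> i = 0) \<Longrightarrow> run ((length w + 2) ^
         d1) w c \<sigma> (\<sigma>(t := F w (\<lambda>i. \<sigma> (\<rho> i))))"
    using conjunct2[OF assms[unfolded computes_def], rule_format, of d] by blast
  show ?thesis
  proof (rule that[of "max d d1"])
    fix w \<sigma> e assume *: "w \<in> lists X" "\<And>i. \<sigma> i \<le> (length w + 2) ^ d"
        "\<And>i. m \<le> i \<Longrightarrow> \<sigma> i = 0"
      and "max d d1 \<le> e"
    show "run ((length w + 2) ^ e) w c \<sigma> (\<sigma>(t := F w (\<lambda>i. \<sigma> (\<rho>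
        i))))"
      by (rule run_mono[OF d1[OF *]]) (use \<open>max d d1 \<le> e\<close> in auto)
  qed simp
qed

lemma log_funI:
  assumes "\<And>d. \<exists>d'. \<forall>w s. w \<in> lists X \<longrightarrow> (\<forall>i. s i
      \<le> (length w + 2) ^ d) \<longrightarrow>
      F w s \<le> (length w + 2) ^ d'"
    and "\<And>m \<rho> t. (\<And>i. \<rho> i < m) \<Longrightarrow> t < m \<Longrightarrow>
        \<exists>c. computes X m \<rho> t c F"
  shows "log_fun X F"
  unfolding log_fun_def poly_bounded_def
proof (intro conjI allI impI)
  fix d show "\<exists>d'. \<forall>w\<in>lists X. \<forall>s. (\<forall>i. s i \<le> (length w +
      2) ^ d) \<longrightarrow> F w s \<le> (length w + 2) ^ d'"
    using assms(1)[of d] by blast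
next
  fix m t :: nat and \<rho> assume "\<forall>i :: nat. \<rho> i < m" "t < m"
  then show "\<exists>c. computes X m \<rho> t c F" using assms(2) by simp
qed

lemma computesI:
  assumes "letters c = {}"
    and "\<And>d. \<exists>d'. \<forall>w \<sigma>. w \<in> lists X \<longrightarrow> (\<forall>i.
        \<sigma> i \<le> (length w + 2) ^ d) \<longrightarrow>
      (\<forall>i\<ge>m. \<sigma> i = 0) \<longrightarrow>
      run ((length w + 2) ^ d') w c \<sigma> (\<sigma>(t := F w (\<lambda>i. \<sigma> (\<rho> i))))"
  shows "computes X m \<rho> t c F"
  unfolding computes_def
proof (intro conjI allI)
  fix d show "\<exists>d'. \<forall>w\<in>lists X. \<forall>\<sigma>. (\<forall>i. \<sigma> i
      \<le> (length w + 2) ^ d) \<longrightarrow> (\<forall>i\<ge>m. \<sigma> i = 0)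
      \<longrightarrow>
     run ((length w + 2) ^ d') w c \<sigma> (\<sigma>(t := F w (\<lambda>i. \<sigma> (\<rho> i))))"
    using assms(2)[of d] by blast
qed (rule assms(1))

lemma log_fun_cong:
  assumes "log_fun X F" "\<And>w s. w \<in> lists X \<Longrightarrow> F w s = F' w s"
  shows "log_fun X F'"
proof (rule log_funI)
  fix d
  obtain d' where "\<And>w s. w \<in> lists X \<Longrightarrow> (\<And>i. s i \<le> (length w + 2)
      ^ d) \<Longrightarrow>
      F w s \<le> (length w + 2) ^ d'"
    by (rule log_fun_bound[OF assms(1), of d]) blast
  then show "\<exists>d'. \<forall>w s. w \<in> lists X \<longrightarrow> (\<forall>i. s i \<le>
      (length w + 2) ^ d) \<longrightarrow> F' w s \<le> (length w + 2) ^ d'"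
    using assms(2) by (intro exI[of _ d']) simp
next
  fix m \<rho> and t :: nat assume *: "\<And>i :: nat. \<rho> i < m" "t < m"
  obtain c where "computes X m \<rho> t c F"
    using log_fun_compute[OF assms(1) *] .
  then have "computes X m \<rho> t c F'"
    unfolding computes_def using assms(2) by simp
  then show "\<exists>c. computes X m \<rho> t c F'" ..
qed

lemma log_fun_weaken:
  assumes "log_fun X E" shows "log_fun X (\<lambda>w s. E w (\<lambda>i. s (f i)))"
proof (rule log_funI)
  fix d
  obtain d' where "\<And>w s. w \<in> lists X \<Longrightarrow> (\<And>i. s i \<le> (length w + 2)
      ^ d) \<Longrightarrow>
      E w s \<le> (length w + 2) ^ d'"
    by (rule log_fun_bound[OF assms, of d]) blast
  then show "\<exists>d'. \<forall>w s. w \<in> lists X \<longrightarrow> (\<forall>i. s i \<le>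
      (length w + 2) ^ d) \<longrightarrow>
      E w (\<lambda>i. s (f i)) \<le> (length w + 2) ^ d'"
    by (intro exI[of _ d']) simp
next
  fix m \<rho> and t :: nat assume *: "\<And>i :: nat. \<rho> i < m" "t < m"
  obtain c where "computes X m (\<lambda>i. \<rho> (f i)) t c E"
    using log_fun_compute[OF assms, of "\<lambda>i. \<rho> (f i)" m t] * by blast
  then have "computes X m \<rho> t c (\<lambda>w s. E w (\<lambda>i. s (f i)))"
    unfolding computes_def .
  then show "\<exists>c. computes X m \<rho> t c (\<lambda>w s. E w (\<lambda>i. s (f i)))" ..
qed

lemma log_fun_var: "log_fun X (\<lambda>w s. s i)"
proof (rule log_funI)
  fix m \<rho> and t :: nat assume *: "\<And>i :: nat. \<rho> i < m" "t < m"
  have "computes X m \<rho> t (copy (\<rho> i) t m) (\<lambda>w s. s i)"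
  proof (rule computesI)
    fix d show "\<exists>d'. \<forall>w \<sigma>. w \<in> lists X \<longrightarrow> (\<forall>i.
        \<sigma> i \<le> (length w + 2) ^ d) \<longrightarrow> (\<forall>i\<ge>m. \<sigma> i = 0)
        \<longrightarrow>
      run ((length w + 2) ^ d') w (copy (\<rho> i) t m) \<sigma> (\<sigma>(t := \<sigma> (\<rho>
          i)))"
      by (intro exI[of _ d]) (simp add: run_copy[OF *])
  qed simp
  then show "\<exists>c. computes X m \<rho> t c (\<lambda>w s. s i)" ..
qed blast

lemma log_fun_zero: "log_fun X (\<lambda>w s. 0)"
proof (rule log_funI)
  fix m \<rho> and t :: nat assume *: "\<And>i :: nat. \<rho> i < m" "t < m"
  have "computes X m \<rho> t (clear t) (\<lambda>w s. 0)"
    by (rule computesI) (simp, use run_clear in blast)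
  then show "\<exists>c. computes X m \<rho> t c (\<lambda>w s. 0)" ..
qed blast

lemma less_next_power: "k \<le> (n + 2) ^ d \<Longrightarrow> k < (n + 2 :: nat) ^ Suc d"
proof -
  assume "k \<le> (n + 2) ^ d"
  moreover have "0 < (n + 2) ^ d" by simp
  ultimately have "k < 2 * (n + 2) ^ d" by linarith
  also have "\<dots> \<le> (n + 2) * (n + 2) ^ d" by (rule mult_le_mono1) simp
  finally show ?thesis by simp
qed

lemma log_fun_Suc:
  assumes "log_fun X E" shows "log_fun X (\<lambda>w s. Suc (E w s))"
proof (rule log_funI)
  fix d
  obtain d' where d': "\<And>w s. w \<in> lists X \<Longrightarrow> (\<And>i. s i \<le> (length w
      + 2) ^ d) \<Longrightarrow>
      E w s \<le> (length w + 2) ^ d'"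
    by (rule log_fun_bound[OF assms, of d]) blast
  show "\<exists>d'. \<forall>w s. w \<in> lists X \<longrightarrow> (\<forall>i. s i \<le>
      (length w + 2) ^ d) \<longrightarrow>
      Suc (E w s) \<le> (length w + 2) ^ d'"
    by (rule exI[of _ "Suc d'"]) (use d' less_next_power in \<open>simp add: Suc_le_eq del:
        power_Suc\<close>)
next
  fix m \<rho> and t :: nat assume *: "\<And>i :: nat. \<rho> i < m" "t < m"
  obtain c where c: "computes X m \<rho> t c E"
    using log_fun_compute[OF assms *] .
  have "computes X m \<rho> t (Seq c (Inc t)) (\<lambda>w s. Suc (E w s))"
  proof (rule computesI)
    show "letters (Seq c (Inc t)) = {}" using c by (simp add: computes_def)
    fix d
    obtain d1 where d1: "d \<le> d1" "\<And>w s. w \<in> lists X \<Longrightarrow> (\<And>i. s i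
        \<le> (length w + 2) ^ d) \<Longrightarrow>
      E w s \<le> (length w + 2) ^ d1"
      by (rule log_fun_bound[OF assms, of d]) blast
    obtain d2 where d2: "d \<le> d2" "\<And>w \<sigma> e. w \<in> lists X \<Longrightarrow>
        (\<And>i. \<sigma> i \<le> (length w + 2) ^ d) \<Longrightarrow>
      (\<And>i. m \<le> i \<Longrightarrow> \<sigma> i = 0) \<Longrightarrow> d2 \<le> e
          \<Longrightarrow>
      run ((length w + 2) ^ e) w c \<sigma> (\<sigma>(t := E w (\<lambda>i. \<sigma> (\<rho> i))))"
      by (rule computes_run[OF c, of d]) blast
    have "run ((length w + 2) ^ max d2 (Suc d1)) w (Seq c (Inc t)) \<sigma>
         (\<sigma>(t := Suc (E w (\<lambda>i. \<sigma> (\<rho> i)))))"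
      if w: "w \<in> lists X" and \<sigma>: "\<forall>i. \<sigma> i \<le> (length w + 2) ^ d"
          "\<forall>i\<ge>m. \<sigma> i = 0" for w \<sigma>
    proof (rule run_Seq)
      show "run ((length w + 2) ^ max d2 (Suc d1)) w c \<sigma> (\<sigma>(t := E w (\<lambda>i.
          \<sigma> (\<rho> i))))"
        by (rule d2(2)) (use w \<sigma> in auto)
      have "E w (\<lambda>i. \<sigma> (\<rho> i)) < (length w + 2) ^ Suc d1"
        by (rule less_next_power, rule d1(2)) (use w \<sigma> in auto)
      also have "\<dots> \<le> (length w + 2) ^ max d2 (Suc d1)" by (rule power_le) simp
      finally show "run ((length w + 2) ^ max d2 (Suc d1)) w (Inc t) (\<sigma>(t := E w
          (\<lambda>i. \<sigma> (\<rho> i))))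
         (\<sigma>(t := Suc (E w (\<lambda>i. \<sigma> (\<rho> i)))))"
        using run_Inc[of "\<sigma>(t := E w (\<lambda>i. \<sigma> (\<rho> i)))" t "(length w + 2)
            ^ max d2 (Suc d1)" w]
        by (simp del: power_Suc)
    qed
    then show "\<exists>d'. \<forall>w \<sigma>. w \<in> lists X \<longrightarrow> (\<forall>i.
        \<sigma> i \<le> (length w + 2) ^ d) \<longrightarrow> (\<forall>i\<ge>m. \<sigma> i = 0)
        \<longrightarrow>
      run ((length w + 2) ^ d') w (Seq c (Inc t)) \<sigma> (\<sigma>(t := Suc (E w (\<lambda>i.
          \<sigma> (\<rho> i)))))"
      by blast
  qed
  then show "\<exists>c. computes X m \<rho> t c (\<lambda>w s. Suc (E w s))" ..
qed

text \<open>
  Substitution for the variable \<open>0\<close>: its value is computed into the first free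
      register, which then
  becomes the register of a new variable.
\<close>

lemma log_fun_let:
  assumes E: "log_fun X E" and F: "log_fun X (\<lambda>w s. F w (s 0) (\<lambda>i. s (Suc i)))"
  shows "log_fun X (\<lambda>w s. F w (E w s) s)"
proof (rule log_funI)
  fix d
  obtain d1 where d1: "d \<le> d1" "\<And>w s. w \<in> lists X \<Longrightarrow> (\<And>i. s i
      \<le> (length w + 2) ^ d) \<Longrightarrow>
      E w s \<le> (length w + 2) ^ d1"
    by (rule log_fun_bound[OF E, of d]) blast
  obtain d2 where d2: "\<And>w s. w \<in> lists X \<Longrightarrow> (\<And>i. s i \<le> (length w
      + 2) ^ d1) \<Longrightarrow>
      F w (s 0) (\<lambda>i. s (Suc i)) \<le> (length w + 2) ^ d2"
    by (rule log_fun_bound[OF F, of d1]) blast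
  have "F w (E w s) s \<le> (length w + 2) ^ d2"
    if "w \<in> lists X" "\<forall>i. s i \<le> (length w + 2) ^ d" for w s
  proof -
    have "case_nat (E w s) s i \<le> (length w + 2) ^ d1" for i
      using d1(2)[of w s] that order_trans[OF _ power_le[OF d1(1), of "length w"]]
      by (simp split: nat.split)
    from d2[OF that(1), of "case_nat (E w s) s", OF this] show ?thesis by simp
  qed
  then show "\<exists>d'. \<forall>w s. w \<in> lists X \<longrightarrow> (\<forall>i. s i \<le>
      (length w + 2) ^ d) \<longrightarrow>
      F w (E w s) s \<le> (length w + 2) ^ d'"
    by blast
next
  fix m \<rho> and t :: nat assume *: "\<And>i :: nat. \<rho> i < m" "t < m"
  have \<rho>: "\<rho> i < Suc m" "case_nat m \<rho> i < Suc m" for i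
    using *(1) by (auto split: nat.split intro: less_SucI)
  obtain c1 where c1: "computes X (Suc m) \<rho> m c1 E"
    using log_fun_compute[OF E \<rho>(1) lessI] .
  obtain c2 where c2: "computes X (Suc m) (case_nat m \<rho>) t c2 (\<lambda>w s. F w (s 0)
      (\<lambda>i. s (Suc i)))"
    using log_fun_compute[OF F \<rho>(2) less_SucI[OF *(2)]] .
  have "computes X m \<rho> t (Seq c1 (Seq c2 (clear m))) (\<lambda>w s. F w (E w s) s)"
  proof (rule computesI)
    show "letters (Seq c1 (Seq c2 (clear m))) = {}" using c1 c2 by (simp add: computes_def)
    fix d
    obtain d1 where d1: "d \<le> d1" "\<And>w s. w \<in> lists X \<Longrightarrow> (\<And>i. s i
        \<le> (length w + 2) ^ d) \<Longrightarrow>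
      E w s \<le> (length w + 2) ^ d1"
      by (rule log_fun_bound[OF E, of d]) blast
    obtain d2 where d2: "d \<le> d2" "\<And>w \<sigma> e. w \<in> lists X \<Longrightarrow>
        (\<And>i. \<sigma> i \<le> (length w + 2) ^ d) \<Longrightarrow>
      (\<And>i. Suc m \<le> i \<Longrightarrow> \<sigma> i = 0) \<Longrightarrow> d2 \<le> e
          \<Longrightarrow>
      run ((length w + 2) ^ e) w c1 \<sigma> (\<sigma>(m := E w (\<lambda>i. \<sigma> (\<rho> i))))"
      by (rule computes_run[OF c1, of d]) blast
    obtain d3 where d3: "d1 \<le> d3" "\<And>w \<sigma> e. w \<in> lists X \<Longrightarrow>
        (\<And>i. \<sigma> i \<le> (length w + 2) ^ d1) \<Longrightarrow>
      (\<And>i. Suc m \<le> i \<Longrightarrow> \<sigma> i = 0) \<Longrightarrow> d3 \<le> e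
          \<Longrightarrow>
      run ((length w + 2) ^ e) w c2 \<sigma>
        (\<sigma>(t := F w (\<sigma> (case_nat m \<rho> 0)) (\<lambda>i. \<sigma> (case_nat m
            \<rho> (Suc i)))))"
      by (rule computes_run[OF c2, of d1]) blast
    have "run ((length w + 2) ^ max d2 d3) w (Seq c1 (Seq c2 (clear m))) \<sigma>
         (\<sigma>(t := F w (E w (\<lambda>i. \<sigma> (\<rho> i))) (\<lambda>i. \<sigma> (\<rho>
             i))))"
      if w: "w \<in> lists X" and \<sigma>: "\<forall>i. \<sigma> i \<le> (length w + 2) ^ d"
          "\<forall>i\<ge>m. \<sigma> i = 0" for w \<sigma>
    proof -
      let ?\<sigma>1 = "\<sigma>(m := E w (\<lambda>i. \<sigma> (\<rho> i)))"
      let ?\<sigma>2 = "?\<sigma>1(t := F w (E w (\<lambda>i. \<sigma> (\<rho> i))) (\<lambda>i.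
          \<sigma> (\<rho> i)))"
      have r1: "run ((length w + 2) ^ max d2 d3) w c1 \<sigma> ?\<sigma>1"
        by (rule d2(2)) (use w \<sigma> in auto)
      have bound: "?\<sigma>1 i \<le> (length w + 2) ^ d1" for i
        using d1(2)[OF w, of "\<lambda>i. \<sigma> (\<rho> i)"] \<sigma>(1)
          order_trans[OF _ power_le[OF d1(1), of "length w"]] by simp
      have zero: "?\<sigma>1 i = 0" if "Suc m \<le> i" for i
        using \<sigma>(2) that by simp
      have "run ((length w + 2) ^ max d2 d3) w c2 ?\<sigma>1
          (?\<sigma>1(t := F w (?\<sigma>1 (case_nat m \<rho> 0)) (\<lambda>i. ?\<sigma>1
              (case_nat m \<rho> (Suc i)))))"
        by (rule d3(2)[OF w bound zero]) simp_all
      then have r2: "run ((length w + 2) ^ max d2 d3) w c2 ?\<sigma>1 ?\<sigma>2"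
        using *(1)[THEN less_imp_neq] by simp
      have r3: "run ((length w + 2) ^ max d2 d3) w (clear m) ?\<sigma>2 (?\<sigma>2(m := 0))"
        by (rule run_clear)
      note run_Seq[OF r1 run_Seq[OF r2 r3]]
      moreover have "?\<sigma>2(m := 0) = \<sigma>(t := F w (E w (\<lambda>i. \<sigma> (\<rho>
          i))) (\<lambda>i. \<sigma> (\<rho> i)))"
        using *(2) \<sigma>(2) by (auto simp: fun_eq_iff)
      ultimately show ?thesis by simp
    qed
    then show "\<exists>d'. \<forall>w \<sigma>. w \<in> lists X \<longrightarrow> (\<forall>i.
        \<sigma> i \<le> (length w + 2) ^ d) \<longrightarrow> (\<forall>i\<ge>m. \<sigma> i = 0)
        \<longrightarrow>
      run ((length w + 2) ^ d') w (Seq c1 (Seq c2 (clear m))) \<sigma>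
       (\<sigma>(t := F w (E w (\<lambda>i. \<sigma> (\<rho> i))) (\<lambda>i. \<sigma> (\<rho>
           i))))"
      by blast
  qed
  then show "\<exists>c. computes X m \<rho> t c (\<lambda>w s. F w (E w s) s)" ..
qed

lemma case_nat_less: "(\<And>i. \<rho> i < m) \<Longrightarrow> a < m \<Longrightarrow> case_nat a
    \<rho> i < (m :: nat)"
  by (simp split: nat.split)

text \<open>
  Primitive recursion. The registers \<open>m\<close>, \<open>m + 1\<close>, \<open>m + 2\<close>,
      \<open>m + 3\<close> hold the number of rounds left,
  the number of rounds done, the current value and the next value. The bound \<open>Bd\<close> is
      needed since
  recursion can otherwise leave the polynomially bounded functions.
\<close>

lemma log_fun_rec:
  assumes N: "log_fun X N" and G: "log_fun X G"
    and H: "log_fun X (\<lambda>w s. H w (s 0) (s (Suc 0)) (\<lambda>i. s (Suc (Suc i))))"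
    and Bd: "poly_bounded X Bd"
    and bd: "\<And>w s t. w \<in> lists X \<Longrightarrow> t \<le> N w s \<Longrightarrow>
      rec_nat (G w s) (\<lambda>t r. H w t r s) t \<le> Bd w s"
  shows "log_fun X (\<lambda>w s. rec_nat (G w s) (\<lambda>t r. H w t r s) (N w s))"
proof (rule log_funI)
  fix d
  obtain d1 where d1: "\<And>w s. w \<in> lists X \<Longrightarrow> (\<And>i. s i \<le> (length w
      + 2) ^ d) \<Longrightarrow>
      Bd w s \<le> (length w + 2) ^ d1"
    by (rule poly_boundE[OF Bd, of d]) blast
  show "\<exists>d'. \<forall>w s. w \<in> lists X \<longrightarrow> (\<forall>i. s i \<le>
      (length w + 2) ^ d) \<longrightarrow>
      rec_nat (G w s) (\<lambda>t r. H w t r s) (N w s) \<le> (length w + 2) ^ d'"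
  proof (intro exI[of _ d1] allI impI)
    fix w and s :: "nat \<Rightarrow> nat" assume "w \<in> lists X" "\<forall>i. s i \<le> (length
        w + 2) ^ d"
    then show "rec_nat (G w s) (\<lambda>t r. H w t r s) (N w s) \<le> (length w + 2) ^ d1"
      using order_trans[OF bd d1] by simp
  qed
next
  fix m \<rho> and t :: nat assume *: "\<And>i :: nat. \<rho> i < m" "t < m"
  let ?M = "m + 4"
  have \<rho>: "\<rho> i < ?M" for i using *(1)[of i] by simp
  have M: "m < ?M" "m + 2 < ?M" "m + 3 < ?M" by simp_all
  obtain cN where cN: "computes X ?M \<rho> m cN N"
    using log_fun_compute[OF N \<rho> M(1)] .
  obtain cG where cG: "computes X ?M \<rho> (m + 2) cG G"
    using log_fun_compute[OF G \<rho> M(2)] .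
  let ?\<rho> = "case_nat (m + 1) (case_nat (m + 2) \<rho>)"
  have \<rho>': "?\<rho> i < ?M" for i by (intro case_nat_less \<rho>) simp_all
  obtain cH where cH: "computes X ?M ?\<rho> (m + 3) cH (\<lambda>w s. H w (s 0) (s (Suc 0))
      (\<lambda>i. s (Suc (Suc i))))"
    using log_fun_compute[OF H \<rho>' M(3)] .
  let ?body = "Seq (Dec m) (Seq cH (Seq (copy (m + 3) (m + 2) ?M) (Inc (m + 1))))"
  let ?c = "Seq cN (Seq cG (Seq (While m ?body) (Seq (copy (m + 2) t ?M)
    (Seq (clear (m + 1)) (Seq (clear (m + 2)) (clear (m + 3)))))))"
  have "computes X m \<rho> t ?c (\<lambda>w s. rec_nat (G w s) (\<lambda>t r. H w t r s) (N w s))"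
  proof (rule computesI)
    show "letters ?c = {}" using cN cG cH by (simp add: computes_def)
    fix d
    obtain dN where dN: "d \<le> dN" "\<And>w s. w \<in> lists X \<Longrightarrow> (\<And>i. s i
        \<le> (length w + 2) ^ d) \<Longrightarrow>
        N w s \<le> (length w + 2) ^ dN"
      by (rule log_fun_bound[OF N, of d]) blast
    obtain dB where dB: "d \<le> dB" "\<And>w s. w \<in> lists X \<Longrightarrow> (\<And>i. s i
        \<le> (length w + 2) ^ d) \<Longrightarrow>
        Bd w s \<le> (length w + 2) ^ dB"
      by (rule poly_boundE[OF Bd, of d]) blast
    \<comment> \<open>a degree that bounds all values of the registers at the start of every
        round\<close>
    define D where "D = max dN dB"
    obtain e1 where e1: "D \<le> e1" "\<And>w \<sigma> e. w \<in> lists X \<Longrightarrow>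
        (\<And>i. \<sigma> i \<le> (length w + 2) ^ D) \<Longrightarrow>
        (\<And>i. ?M \<le> i \<Longrightarrow> \<sigma> i = 0) \<Longrightarrow> e1 \<le> e
            \<Longrightarrow>
        run ((length w + 2) ^ e) w cN \<sigma> (\<sigma>(m := N w (\<lambda>i. \<sigma> (\<rho>
            i))))"
      by (rule computes_run[OF cN, of D]) blast
    obtain e2 where e2: "D \<le> e2" "\<And>w \<sigma> e. w \<in> lists X \<Longrightarrow>
        (\<And>i. \<sigma> i \<le> (length w + 2) ^ D) \<Longrightarrow>
        (\<And>i. ?M \<le> i \<Longrightarrow> \<sigma> i = 0) \<Longrightarrow> e2 \<le> e
            \<Longrightarrow>
        run ((length w + 2) ^ e) w cG \<sigma> (\<sigma>(m + 2 := G w (\<lambda>i. \<sigma>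
            (\<rho> i))))"
      by (rule computes_run[OF cG, of D]) blast
    obtain e3 where e3: "D \<le> e3" "\<And>w \<sigma> e. w \<in> lists X \<Longrightarrow>
        (\<And>i. \<sigma> i \<le> (length w + 2) ^ D) \<Longrightarrow>
        (\<And>i. ?M \<le> i \<Longrightarrow> \<sigma> i = 0) \<Longrightarrow> e3 \<le> e
            \<Longrightarrow>
        run ((length w + 2) ^ e) w cH \<sigma> (\<sigma>(m + 3 :=
          H w (\<sigma> (?\<rho> 0)) (\<sigma> (?\<rho> (Suc 0))) (\<lambda>i. \<sigma> (?\<rho>
              (Suc (Suc i))))))"
      by (rule computes_run[OF cH, of D]) blast
    define e where "e = max e1 (max e2 e3)"
    have e: "e1 \<le> e" "e2 \<le> e" "e3 \<le> e" "D \<le> e" using e1(1) by (auto simp: e_def)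
    have "run ((length w + 2) ^ e) w ?c \<sigma> (\<sigma>(t := rec_nat (G w (\<lambda>i. \<sigma>
        (\<rho> i)))
          (\<lambda>t r. H w t r (\<lambda>i. \<sigma> (\<rho> i))) (N w (\<lambda>i. \<sigma>
              (\<rho> i)))))"
      if w: "w \<in> lists X" and \<sigma>: "\<forall>i. \<sigma> i \<le> (length w + 2) ^ d"
          "\<forall>i\<ge>m. \<sigma> i = 0" for w \<sigma>
    proof -
      let ?B = "(length w + 2) ^ e"
      define s where "s = (\<lambda>i. \<sigma> (\<rho> i))"
      define n where "n = N w s"
      define R where "R = rec_nat (G w s) (\<lambda>t r. H w t r s)"
      define S where "S = (\<lambda>j. \<sigma>(m := n - j, m + 1 := j, m + 2 := R j,
        m + 3 := (if j = 0 then 0 else R j)))"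
      have s: "s i \<le> (length w + 2) ^ d" for i using \<sigma>(1) by (simp add: s_def)
      have n: "n \<le> (length w + 2) ^ D"
        unfolding n_def by (rule order_trans[OF dN(2)[OF w s] power_le]) (simp add: D_def)
      have R: "R j \<le> (length w + 2) ^ D" if "j \<le> n" for j
        unfolding R_def
        by (rule order_trans[OF order_trans[OF bd[OF w] dB(2)[OF w s]] power_le])
           (use that in \<open>simp_all add: D_def n_def\<close>)
      have \<sigma>D: "\<sigma> i \<le> (length w + 2) ^ D" for i
        by (rule order_trans[OF _ power_le[of d D]]) (use \<sigma>(1) dN(1) in \<open>simp_all
            add: D_def\<close>)
      have De: "x \<le> ?B" if "x \<le> (length w + 2) ^ D" for x
        by (rule order_trans[OF that power_le[OF e(4)]])
      have \<sigma>0: "\<sigma> i = 0" if "m \<le> i" for i using \<sigma>(2) that by simp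
      have \<rho>m: "\<rho> i \<noteq> m + k" for i k using *(1)[of i] by simp
      have \<rho>m0: "\<rho> i \<noteq> m" for i using \<rho>m[of i 0] by simp
      have r1: "run ?B w cN \<sigma> (\<sigma>(m := n))"
        unfolding n_def s_def by (rule e1(2)[OF w \<sigma>D _ e(1)]) (simp add: \<sigma>0)
      have "run ?B w cG (\<sigma>(m := n)) (\<sigma>(m := n, m + 2 := G w (\<lambda>i. (\<sigma>(m
          := n)) (\<rho> i))))"
        by (rule e2(2)[OF w _ _ e(2)]) (use \<sigma>0 \<sigma>D n in simp_all)
      moreover have "(\<lambda>i. (\<sigma>(m := n)) (\<rho> i)) = s"
        using \<rho>m0 by (simp add: s_def)
      moreover have "\<sigma>(m := n, m + 2 := G w s) = S 0"
        using \<sigma>0 by (simp add: S_def R_def fun_eq_iff)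
      ultimately have r2: "run ?B w cG (\<sigma>(m := n)) (S 0)"
        by simp
      have r3: "run ?B w (While m ?body) (S 0) (S n)"
      proof (rule run_While)
        fix j assume j: "j < n"
        let ?\<sigma>1 = "(S j)(m := n - Suc j)"
        let ?\<sigma>2 = "?\<sigma>1(m + 3 := R (Suc j))"
        let ?\<sigma>3 = "?\<sigma>2(m + 2 := R (Suc j))"
        have s1: "run ?B w (Dec m) (S j) ?\<sigma>1"
          using run_Dec[of "S j" m ?B w] j by (simp add: S_def)
        have b: "?\<sigma>1 i \<le> (length w + 2) ^ D" for i
          using R[of j] j n \<sigma>D order_trans[OF diff_le_self n, of "Suc j"] by (auto simp:
              S_def)
        have z: "?\<sigma>1 i = 0" if "?M \<le> i" for i
          using that \<sigma>0 by (simp add: S_def)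
        have "run ?B w cH ?\<sigma>1 (?\<sigma>1(m + 3 :=
          H w (?\<sigma>1 (?\<rho> 0)) (?\<sigma>1 (?\<rho> (Suc 0))) (\<lambda>i. ?\<sigma>1
              (?\<rho> (Suc (Suc i))))))"
          by (rule e3(2)[OF w b z e(3)])
        moreover have "(\<lambda>i. ?\<sigma>1 (?\<rho> (Suc (Suc i)))) = s"
          using \<rho>m0 \<rho>m[of _ 1] \<rho>m[of _ 2] \<rho>m[of _ 3] by (simp add: S_def s_def)
        moreover have "?\<sigma>1 (?\<rho> 0) = j" "?\<sigma>1 (?\<rho> (Suc 0)) = R j"
          by (simp_all add: S_def)
        moreover have "H w j (R j) s = R (Suc j)"
          by (simp add: R_def)
        ultimately have s2: "run ?B w cH ?\<sigma>1 ?\<sigma>2" by simp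
        have s3: "run ?B w (copy (m + 3) (m + 2) ?M) ?\<sigma>2 ?\<sigma>3"
          using run_copy[of "m + 3" ?M "m + 2" ?\<sigma>2 ?B w] De[OF R[of "Suc j"]] j z by simp
        have "j < ?B" using De[OF n] j by simp
        then have s4: "run ?B w (Inc (m + 1)) ?\<sigma>3 (?\<sigma>3(m + 1 := Suc j))"
          using run_Inc[of ?\<sigma>3 "m + 1" ?B w] by (simp add: S_def)
        have "?\<sigma>3(m + 1 := Suc j) = S (Suc j)"
          by (simp add: S_def fun_eq_iff)
        then show "run ?B w ?body (S j) (S (Suc j))"
          using run_Seq[OF s1 run_Seq[OF s2 run_Seq[OF s3 s4]]] by simp
      qed (simp_all add: S_def)
      have r4: "run ?B w (copy (m + 2) t ?M) (S n) ((S n)(t := R n))"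
        using run_copy[of "m + 2" ?M t "S n" ?B w] De[OF R[of n]] *(2) \<sigma>0 by (simp add:
            S_def)
      note r5 = run_clear[of ?B w "m + 1" "(S n)(t := R n)"]
      note r6 = run_clear[of ?B w "m + 2" "(S n)(t := R n, m + 1 := 0)"]
      note r7 = run_clear[of ?B w "m + 3" "(S n)(t := R n, m + 1 := 0, m + 2 := 0)"]
      have "(S n)(t := R n, m + 1 := 0, m + 2 := 0, m + 3 := 0) = \<sigma>(t := R n)"
        using *(2) \<sigma>0 by (simp add: S_def fun_eq_iff)
      then show ?thesis
        using run_Seq[OF r1 run_Seq[OF r2 run_Seq[OF r3 run_Seq[OF r4 run_Seq[OF r5 run_Seq[OF r6
            r7]]]]]]
        unfolding R_def n_def s_def by simp
    qed
    then show "\<exists>d'. \<forall>w \<sigma>. w \<in> lists X \<longrightarrow> (\<forall>i.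
        \<sigma> i \<le> (length w + 2) ^ d) \<longrightarrow> (\<forall>i\<ge>m. \<sigma> i = 0)
        \<longrightarrow>
      run ((length w + 2) ^ d') w ?c \<sigma> (\<sigma>(t := rec_nat (G w (\<lambda>i. \<sigma>
          (\<rho> i)))
          (\<lambda>t r. H w t r (\<lambda>i. \<sigma> (\<rho> i))) (N w (\<lambda>i. \<sigma>
              (\<rho> i)))))"
      by blast
  qed
  then show "\<exists>c. computes X m \<rho> t c (\<lambda>w s. rec_nat (G w s) (\<lambda>t r. H w
      t r s) (N w s))" ..
qed

text \<open>
  Loops are controlled by registers only, so a flag in register \<open>m\<close> ends the loop
      when the input
  head has reached the left end marker.
\<close>

definition home :: "nat \<Rightarrow> 'a com" where
  "home m = Seq (Inc m) (While m (IfInput {Left_End} (Dec m) (Move Move_Left)))"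

definition forward :: "nat \<Rightarrow> 'a com" where
  "forward t = While t (Seq (Dec t) (Move Move_Right))"

lemma exec_home:
  assumes "h \<le> length w + 1" "\<sigma> m = 0" "0 < B"
  shows "exec B w (home m) (h, \<sigma>, u) (0, \<sigma>, u)"
proof -
  let ?c = "IfInput {Left_End} (Dec m) (Move Move_Left)"
  have "exec B w (While m ?c) (h, \<sigma>(m := Suc 0), u) (0, \<sigma>, u)"
    using assms(1)
  proof (induction h)
    case 0
    have "exec B w (Dec m) (0, \<sigma>(m := Suc 0), u) (0, \<sigma>(m := 0), u)"
      using exec_Dec[of "\<sigma>(m := Suc 0)" m B w 0 u] by simp
    then have "exec B w ?c (0, \<sigma>(m := Suc 0), u) (0, \<sigma>(m := 0), u)"
      by (intro exec_IfInput) (simp add: input_at_def)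
    moreover have "exec B w (While m ?c) (0, \<sigma>(m := 0), u) (0, \<sigma>(m := 0), u)"
      by (rule exec_While_done) simp
    moreover have "\<sigma>(m := 0) = \<sigma>" using assms(2) by auto
    ultimately show ?case by (intro exec_While_step[of "\<sigma>(m := Suc 0)" m]) simp_all
  next
    case (Suc h)
    have "exec B w (Move Move_Left) (Suc h, \<sigma>(m := Suc 0), u) (h, \<sigma>(m := Suc 0), u)"
      using exec_Move[of B w Move_Left "Suc h" "\<sigma>(m := Suc 0)" u] Suc.prems by simp
    then have "exec B w ?c (Suc h, \<sigma>(m := Suc 0), u) (h, \<sigma>(m := Suc 0), u)"
      by (intro exec_IfInput) (simp add: input_at_def)
    then show ?case
      using exec_While_step[of "\<sigma>(m := Suc 0)" m, OF _ _ Suc.IH] Suc.prems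
      by (simp del: fun_upd_apply add: fun_upd_same)
  qed
  moreover have "exec B w (Inc m) (h, \<sigma>, u) (h, \<sigma>(m := Suc 0), u)"
    using exec_Inc[of \<sigma> m B w h u] assms by simp
  ultimately show ?thesis unfolding home_def by (intro exec_Seq)
qed

lemma exec_forward:
  assumes "h \<le> length w + 1" "\<sigma> t = k"
  shows "exec B w (forward t) (h, \<sigma>, u) (min (h + k) (length w + 1), \<sigma>(t := 0), u)"
  using assms
proof (induction k arbitrary: h \<sigma>)
  case 0
  then show ?case
    using exec_While_done[of \<sigma> t B w _ h u] by (simp add: forward_def fun_upd_idem)
next
  case (Suc k)
  let ?h = "min (h + 1) (length w + 1)"
  have "exec B w (Dec t) (h, \<sigma>, u) (h, \<sigma>(t := k), u)"
    using exec_Dec[of \<sigma> t B w h u] Suc.prems by simp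
  moreover have "exec B w (Move Move_Right) (h, \<sigma>(t := k), u) (?h, \<sigma>(t := k), u)"
    using exec_Move[of B w Move_Right h "\<sigma>(t := k)" u] by simp
  ultimately have "exec B w (Seq (Dec t) (Move Move_Right)) (h, \<sigma>, u) (?h, \<sigma>(t :=
      k), u)"
    by (rule exec_Seq)
  moreover have "exec B w (forward t) (?h, \<sigma>(t := k), u)
      (min (?h + k) (length w + 1), \<sigma>(t := k, t := 0), u)"
    by (rule Suc.IH) simp_all
  moreover have "min (?h + k) (length w + 1) = min (h + Suc k) (length w + 1)"
    by simp
  ultimately show ?case
    using Suc.prems exec_While_step[of \<sigma> t B w _ h u] unfolding forward_def fun_upd_upd
    by (simp del: fun_upd_apply)
qed

lemma log_fun_input:
  assumes E: "log_fun X E"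
  shows "log_fun X (\<lambda>w s. of_bool (input_at w (E w s) \<in> A))"
proof (rule log_funI)
  fix d
  have "of_bool b \<le> (n + 2 :: nat) ^ 0" for b n by simp
  then show "\<exists>d'. \<forall>w s. w \<in> lists X \<longrightarrow> (\<forall>i. s i \<le>
      (length w + 2) ^ d) \<longrightarrow>
      of_bool (input_at w (E w s) \<in> A) \<le> (length w + 2) ^ d'"
    by blast
next
  fix m \<rho> and t :: nat assume *: "\<And>i :: nat. \<rho> i < m" "t < m"
  obtain c where c: "computes X m \<rho> t c E"
    using log_fun_compute[OF E *] .
  let ?c = "Seq c (Seq (home m) (Seq (forward t) (IfInput A (Inc t) Skip)))"
  have "computes X m \<rho> t ?c (\<lambda>w s. of_bool (input_at w (E w s) \<in> A))"
  proof (rule computesI)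
    show "letters ?c = {}" using c by (simp add: computes_def home_def forward_def)
    fix d
    obtain d2 where d2: "d \<le> d2" "\<And>w \<sigma> e. w \<in> lists X \<Longrightarrow>
        (\<And>i. \<sigma> i \<le> (length w + 2) ^ d) \<Longrightarrow>
      (\<And>i. m \<le> i \<Longrightarrow> \<sigma> i = 0) \<Longrightarrow> d2 \<le> e
          \<Longrightarrow>
      run ((length w + 2) ^ e) w c \<sigma> (\<sigma>(t := E w (\<lambda>i. \<sigma> (\<rho> i))))"
      by (rule computes_run[OF c, of d]) blast
    have "run ((length w + 2) ^ d2) w ?c \<sigma> (\<sigma>(t := of_bool (input_at w (E w
        (\<lambda>i. \<sigma> (\<rho> i))) \<in> A)))"
      if w: "w \<in> lists X" and \<sigma>: "\<forall>i. \<sigma> i \<le> (length w + 2) ^ d"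
          "\<forall>i\<ge>m. \<sigma> i = 0" for w \<sigma>
    proof (rule run_Seq)
      let ?B = "(length w + 2) ^ d2"
      let ?k = "E w (\<lambda>i. \<sigma> (\<rho> i))"
      let ?\<sigma>1 = "\<sigma>(t := ?k)"
      let ?\<sigma>2 = "\<sigma>(t := of_bool (input_at w ?k \<in> A))"
      let ?h = "min ?k (length w + 1)"
      show "run ?B w c \<sigma> ?\<sigma>1"
        by (rule d2(2)) (use w \<sigma> in auto)
      have at: "input_at w ?h = input_at w ?k" by (simp add: input_at_def min_def)
      have "exec ?B w (Seq (home m) (Seq (forward t) (IfInput A (Inc t) Skip))) (h, ?\<sigma>1, u)
          (?h, ?\<sigma>2, u)"
        if h: "h \<le> length w + 1" for h u
      proof (rule exec_Seq)
        show "exec ?B w (home m) (h, ?\<sigma>1, u) (0, ?\<sigma>1, u)"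
          by (rule exec_home[OF h]) (use * \<sigma>(2) in simp_all)
        show "exec ?B w (Seq (forward t) (IfInput A (Inc t) Skip)) (0, ?\<sigma>1, u) (?h,
            ?\<sigma>2, u)"
        proof (rule exec_Seq)
          show "exec ?B w (forward t) (0, ?\<sigma>1, u) (?h, \<sigma>(t := 0), u)"
            using exec_forward[of 0 w ?\<sigma>1 t ?k ?B u] by simp
          show "exec ?B w (IfInput A (Inc t) Skip) (?h, \<sigma>(t := 0), u) (?h, ?\<sigma>2, u)"
          proof (rule exec_IfInput, cases "input_at w ?k \<in> A")
            case True
            then show "exec ?B w (if input_at w ?h \<in> A then Inc t else Skip) (?h, \<sigma>(t
                := 0), u) (?h, ?\<sigma>2, u)"
              unfolding at using exec_Inc[of "\<sigma>(t := 0)" t ?B w ?h u] by simp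
          next
            case False
            then show "exec ?B w (if input_at w ?h \<in> A then Inc t else Skip) (?h, \<sigma>(t
                := 0), u) (?h, ?\<sigma>2, u)"
              unfolding at using exec_Skip[of ?B w "(?h, \<sigma>(t := 0), u)"] by simp
          qed
        qed
      qed
      then show "run ?B w (Seq (home m) (Seq (forward t) (IfInput A (Inc t) Skip))) ?\<sigma>1
          ?\<sigma>2"
        unfolding run_def by (meson min.cobounded2)
    qed
    then show "\<exists>d'. \<forall>w \<sigma>. w \<in> lists X \<longrightarrow> (\<forall>i.
        \<sigma> i \<le> (length w + 2) ^ d) \<longrightarrow> (\<forall>i\<ge>m. \<sigma> i = 0)
        \<longrightarrow>
      run ((length w + 2) ^ d') w ?c \<sigma> (\<sigma>(t := of_bool (input_at w (E w (\<lambda>i.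
          \<sigma> (\<rho> i))) \<in> A)))"
      by blast
  qed
  then show "\<exists>c. computes X m \<rho> t c (\<lambda>w s. of_bool (input_at w (E w s) \<in>
      A))" ..
qed

text \<open>
  Counting the moves from the left to the right end marker. This is the only source of unbounded
  numbers that does not come from a variable.
\<close>

lemma log_fun_length: "log_fun X (\<lambda>w s. length w + 1)"
proof (rule log_funI)
  fix d
  have "n + 1 \<le> (n + 2) ^ 1" for n :: nat by simp
  then show "\<exists>d'. \<forall>w s. w \<in> lists X \<longrightarrow> (\<forall>i. s i \<le>
      (length w + 2) ^ d) \<longrightarrow>
      length w + 1 \<le> (length w + 2) ^ d'"
    by blast
next
  fix m \<rho> and t :: nat assume *: "\<And>i :: nat. \<rho> i < m" "t < m"
  let ?b = "IfInput {Right_End} (Dec m) (Seq (Inc t) (Move Move_Right))"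
  let ?c = "Seq (clear t) (Seq (home m) (Seq (Inc m) (While m ?b)))"
  have "computes X m \<rho> t ?c (\<lambda>w s. length w + 1)"
  proof (rule computesI)
    show "letters ?c = {}" by (simp add: home_def)
    fix d
    have "run ((length w + 2) ^ 1) w ?c \<sigma> (\<sigma>(t := length w + 1))"
      if \<sigma>: "\<forall>i\<ge>m. \<sigma> i = 0" for w :: "'a list" and \<sigma>
    proof (rule run_Seq[OF run_clear])
      let ?B = "(length w + 2) ^ 1"
      let ?\<sigma> = "\<lambda>j. \<sigma>(t := j)"
      have loop: "exec ?B w (While m ?b) (h, (?\<sigma> h)(m := Suc 0), u) (length w + 1,
          ?\<sigma> (length w + 1), u)"
        if "h \<le> length w + 1" for h u
        using that
      proof (induction rule: inc_induct)
        case base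
        have "exec ?B w (Dec m) (length w + 1, (?\<sigma> (length w + 1))(m := Suc 0), u)
            (length w + 1, (?\<sigma> (length w + 1))(m := 0), u)"
          using exec_Dec[of "(?\<sigma> (length w + 1))(m := Suc 0)" m ?B w "length w + 1" u] by
              simp
        moreover have "input_at w (length w + 1) \<in> {Right_End}"
          by (simp add: input_at_def)
        ultimately have "exec ?B w ?b (length w + 1, (?\<sigma> (length w + 1))(m := Suc 0), u)
            (length w + 1, (?\<sigma> (length w + 1))(m := 0), u)"
          by (intro exec_IfInput) (simp only: if_True)
        moreover have "exec ?B w (While m ?b) (length w + 1, (?\<sigma> (length w + 1))(m := 0), u)
            (length w + 1, (?\<sigma> (length w + 1))(m := 0), u)"
          by (rule exec_While_done) simp
        moreover have "(?\<sigma> (length w + 1))(m := 0) = ?\<sigma> (length w + 1)"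
          using \<sigma> *(2) by auto
        ultimately show ?case
          using exec_While_step[of "(?\<sigma> (length w + 1))(m := Suc 0)" m]
          by (simp del: fun_upd_apply add: fun_upd_same)
      next
        case (step h)
        have "exec ?B w (Inc t) (h, (?\<sigma> h)(m := Suc 0), u) (h, (?\<sigma> (Suc h))(m := Suc
            0), u)"
          using exec_Inc[of "(?\<sigma> h)(m := Suc 0)" t ?B w h u] step(2) *(2)
          by (simp add: fun_upd_twist[of m t])
        moreover have "exec ?B w (Move Move_Right) (h, (?\<sigma> (Suc h))(m := Suc 0), u)
            (Suc h, (?\<sigma> (Suc h))(m := Suc 0), u)"
          using exec_Move[of ?B w Move_Right h "(?\<sigma> (Suc h))(m := Suc 0)" u] step(2)
          by (simp del: fun_upd_apply)
        ultimately have "exec ?B w (Seq (Inc t) (Move Move_Right)) (h, (?\<sigma> h)(m := Suc 0), u)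
            (Suc h, (?\<sigma> (Suc h))(m := Suc 0), u)"
          by (rule exec_Seq)
        moreover have "input_at w h \<notin> {Right_End}"
          using step(2) by (simp add: input_at_def)
        ultimately have "exec ?B w ?b (h, (?\<sigma> h)(m := Suc 0), u) (Suc h, (?\<sigma> (Suc
            h))(m := Suc 0), u)"
          by (intro exec_IfInput) (simp only: if_False)
        then show ?case
          using exec_While_step[of "(?\<sigma> h)(m := Suc 0)" m, OF _ _ step.IH]
          by (simp del: fun_upd_apply add: fun_upd_same)
      qed
      have "exec ?B w (Seq (home m) (Seq (Inc m) (While m ?b))) (h, \<sigma>(t := 0), u)
          (length w + 1, ?\<sigma> (length w + 1), u)" if h: "h \<le> length w + 1" for h u
      proof (rule exec_Seq, rule exec_home[OF h])
        have "exec ?B w (Inc m) (0, \<sigma>(t := 0), u) (0, (?\<sigma> 0)(m := Suc 0), u)"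
          using exec_Inc[of "\<sigma>(t := 0)" m ?B w 0 u] \<sigma> *(2) by simp
        then show "exec ?B w (Seq (Inc m) (While m ?b)) (0, \<sigma>(t := 0), u)
            (length w + 1, ?\<sigma> (length w + 1), u)"
          by (rule exec_Seq) (rule loop, simp)
      qed (use \<sigma> *(2) in simp_all)
      then show "run ?B w (Seq (home m) (Seq (Inc m) (While m ?b))) (\<sigma>(t := 0)) (?\<sigma>
          (length w + 1))"
        unfolding run_def by blast
    qed
    then show "\<exists>d'. \<forall>w \<sigma>. w \<in> lists X \<longrightarrow> (\<forall>i.
        \<sigma> i \<le> (length w + 2) ^ d) \<longrightarrow> (\<forall>i\<ge>m. \<sigma> i = 0)
        \<longrightarrow>
      run ((length w + 2) ^ d') w ?c \<sigma> (\<sigma>(t := length w + 1))"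
      by blast
  qed
  then show "\<exists>c. computes X m \<rho> t c (\<lambda>w s. length w + 1)" ..
qed

section \<open>Arithmetic in logarithmic space\<close>

lemma log_fun_const: "log_fun X (\<lambda>w s. n)"
proof (induction n)
  case (Suc n)
  then show ?case by (rule log_fun_Suc)
qed (rule log_fun_zero)

lemma log_fun_comp1:
  assumes "log_fun X (\<lambda>w s. A w (s 0))" "log_fun X E"
  shows "log_fun X (\<lambda>w s. A w (E w s))"
  by (rule log_fun_let[OF assms(2), where F = "\<lambda>w x s. A w x"]) (rule assms(1))

lemma poly_bounded_add:
  assumes "poly_bounded X E" "poly_bounded X F"
  shows "poly_bounded X (\<lambda>w s. E w s + F w s)"
  unfolding poly_bounded_def
proof
  fix d
  obtain d1 where d1: "\<And>w s. w \<in> lists X \<Longrightarrow> (\<And>i. s i \<le> (length w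
      + 2) ^ d) \<Longrightarrow>
      E w s \<le> (length w + 2) ^ d1"
    by (rule poly_boundE[OF assms(1), of d]) blast
  obtain d2 where d2: "\<And>w s. w \<in> lists X \<Longrightarrow> (\<And>i. s i \<le> (length w
      + 2) ^ d) \<Longrightarrow>
      F w s \<le> (length w + 2) ^ d2"
    by (rule poly_boundE[OF assms(2), of d]) blast
  have "E w s + F w s \<le> (length w + 2) ^ Suc (max d1 d2)"
    if "w \<in> lists X" "\<forall>i. s i \<le> (length w + 2) ^ d" for w s
  proof -
    have "E w s \<le> (length w + 2) ^ max d1 d2"
      by (rule order_trans[OF d1 power_le]) (use that in simp_all)
    moreover have "F w s \<le> (length w + 2) ^ max d1 d2"
      by (rule order_trans[OF d2 power_le]) (use that in simp_all)
    moreover have "2 * (length w + 2) ^ max d1 d2 \<le> (length w + 2) * (length w + 2) ^ max d1 d2"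
      by (rule mult_le_mono1) simp
    ultimately show ?thesis unfolding power_Suc by linarith
  qed
  then show "\<exists>d'. \<forall>w\<in>lists X. \<forall>s. (\<forall>i. s i \<le> (length w +
      2) ^ d) \<longrightarrow>
      E w s + F w s \<le> (length w + 2) ^ d'"
    by blast
qed

lemma poly_bounded_sum:
  assumes "poly_bounded X N" "poly_bounded X (\<lambda>w s. F w (s 0) (\<lambda>i. s (Suc i)))"
  shows "poly_bounded X (\<lambda>w s. \<Sum>i<N w s. F w i s)"
  unfolding poly_bounded_def
proof
  fix d
  obtain d1 where d1: "d \<le> d1" "\<And>w s. w \<in> lists X \<Longrightarrow> (\<And>i. s i
      \<le> (length w + 2) ^ d) \<Longrightarrow>
      N w s \<le> (length w + 2) ^ d1"
    by (rule poly_boundE[OF assms(1), of d]) blast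
  obtain d2 where d2: "\<And>w s. w \<in> lists X \<Longrightarrow> (\<And>i. s i \<le> (length w
      + 2) ^ d1) \<Longrightarrow>
      F w (s 0) (\<lambda>i. s (Suc i)) \<le> (length w + 2) ^ d2"
    by (rule poly_boundE[OF assms(2), of d1]) blast
  have "(\<Sum>i<N w s. F w i s) \<le> (length w + 2) ^ (d1 + d2)"
    if w: "w \<in> lists X" and s: "\<forall>i. s i \<le> (length w + 2) ^ d" for w s
  proof -
    have n: "N w s \<le> (length w + 2) ^ d1" using d1(2) w s by blast
    have "F w i s \<le> (length w + 2) ^ d2" if "i < N w s" for i
    proof -
      have "case_nat i s j \<le> (length w + 2) ^ d1" for j
        using that n order_trans[OF _ power_le[OF d1(1), of "length w"]] s
        by (simp split: nat.split)
      from d2[OF w, of "case_nat i s", OF this] show ?thesis by simp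
    qed
    then have "(\<Sum>i<N w s. F w i s) \<le> of_nat (card {..<N w s}) * (length w + 2) ^ d2"
      by (intro sum_bounded_above) simp
    also have "\<dots> = N w s * (length w + 2) ^ d2" by simp
    also have "\<dots> \<le> (length w + 2) ^ (d1 + d2)"
      unfolding power_add using n by (rule mult_le_mono1)
    finally show ?thesis .
  qed
  then show "\<exists>d'. \<forall>w\<in>lists X. \<forall>s. (\<forall>i. s i \<le> (length w +
      2) ^ d) \<longrightarrow>
      (\<Sum>i<N w s. F w i s) \<le> (length w + 2) ^ d'"
    by blast
qed

lemma log_fun_pred:
  assumes "log_fun X E" shows "log_fun X (\<lambda>w s. E w s - 1)"
proof -
  have eq: "rec_nat 0 (\<lambda>t r. t) n = n - 1" for n :: nat by (cases n) simp_all
  have "log_fun X (\<lambda>w s. rec_nat 0 (\<lambda>t r. t) (E w s))"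
    by (rule log_fun_rec[where H = "\<lambda>w t r s. t", OF assms log_fun_zero log_fun_var
        log_fun_poly_bounded[OF assms]])
       (simp add: eq)
  then show ?thesis unfolding eq .
qed

lemma log_fun_diff:
  assumes "log_fun X E" "log_fun X F" shows "log_fun X (\<lambda>w s. E w s - F w s)"
proof -
  have eq: "rec_nat m (\<lambda>t r. r - 1) n = m - n" for m n :: nat by (induction n) simp_all
  have "log_fun X (\<lambda>w s. rec_nat (E w s) (\<lambda>t r. r - 1) (F w s))"
    by (rule log_fun_rec[where H = "\<lambda>w t r s. r - 1" and Bd = E])
       (simp_all only: eq assms log_fun_poly_bounded log_fun_pred log_fun_var diff_le_self)
  then show ?thesis unfolding eq .
qed

lemma log_fun_add:
  assumes "log_fun X E" "log_fun X F" shows "log_fun X (\<lambda>w s. E w s + F w s)"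
proof -
  have eq: "rec_nat m (\<lambda>t r. Suc r) n = m + n" for m n :: nat by (induction n) simp_all
  have "log_fun X (\<lambda>w s. rec_nat (E w s) (\<lambda>t r. Suc r) (F w s))"
    by (rule log_fun_rec[where H = "\<lambda>w t r s. Suc r" and Bd = "\<lambda>w s. E w s + F w
        s"])
       (simp_all only: eq assms log_fun_poly_bounded poly_bounded_add log_fun_Suc log_fun_var
           add_le_cancel_left)
  then show ?thesis unfolding eq .
qed

lemma log_fun_sum:
  assumes "log_fun X N" "log_fun X (\<lambda>w s. F w (s 0) (\<lambda>i. s (Suc i)))"
  shows "log_fun X (\<lambda>w s. \<Sum>i<N w s. F w i s)"
proof -
  have eq: "rec_nat 0 (\<lambda>t r. r + f t) n = (\<Sum>i<n. f i)" for f and n :: nat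
    by (induction n) simp_all
  have "log_fun X (\<lambda>w s. rec_nat 0 (\<lambda>t r. r + F w t s) (N w s))"
  proof (rule log_fun_rec[where H = "\<lambda>w t r s. r + F w t s" and Bd = "\<lambda>w s.
      \<Sum>i<N w s. F w i s"])
    have "log_fun X (\<lambda>w s. F w (s 0) (\<lambda>i. s (Suc (Suc i))))"
      using log_fun_weaken[OF assms(2), of "\<lambda>i. if i = 0 then 0 else Suc i"] by simp
    then show "log_fun X (\<lambda>w s. s (Suc 0) + F w (s 0) (\<lambda>i. s (Suc (Suc i))))"
      by (rule log_fun_add[OF log_fun_var])
    show "poly_bounded X (\<lambda>w s. \<Sum>i<N w s. F w i s)"
      by (intro poly_bounded_sum log_fun_poly_bounded assms)
  qed (auto simp only: eq assms log_fun_zero intro!: sum_mono2)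
  then show ?thesis unfolding eq .
qed

lemma log_fun_mult:
  assumes "log_fun X E" "log_fun X F" shows "log_fun X (\<lambda>w s. E w s * F w s)"
proof -
  have "log_fun X (\<lambda>w s. \<Sum>i<F w s. E w s)"
    by (rule log_fun_sum[where F = "\<lambda>w i s. E w s", OF assms(2) log_fun_weaken[OF
        assms(1)]])
  then show ?thesis by (simp add: mult.commute)
qed

lemma log_fun_power:
  assumes "log_fun X E" shows "log_fun X (\<lambda>w s. E w s ^ k)"
proof (induction k)
  case 0
  show ?case unfolding power_0 by (rule log_fun_const)
next
  case (Suc k)
  show ?case unfolding power_Suc by (rule log_fun_mult[OF assms Suc])
qed

definition log_pred :: "'a set \<Rightarrow> ('a list \<Rightarrow> (nat \<Rightarrow> nat)
    \<Rightarrow> bool) \<Rightarrow> bool" where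
  "log_pred X P \<longleftrightarrow> log_fun X (\<lambda>w s. of_bool (P w s))"

lemma log_pred_not: assumes "log_pred X P" shows "log_pred X (\<lambda>w s. \<not> P w s)"
proof -
  have "log_fun X (\<lambda>w s. 1 - of_bool (P w s))"
    using assms unfolding log_pred_def by (intro log_fun_diff log_fun_const)
  also have "(\<lambda>w s. 1 - of_bool (P w s)) = (\<lambda>w s. of_bool (\<not> P w s) :: nat)"
    by (simp add: fun_eq_iff)
  finally show ?thesis unfolding log_pred_def .
qed

lemma log_pred_conj: assumes "log_pred X P" "log_pred X Q" shows "log_pred X (\<lambda>w s. P w s
    \<and> Q w s)"
  using log_fun_mult[OF assms[unfolded log_pred_def]] unfolding log_pred_def of_bool_conj .

lemma log_pred_disj: assumes "log_pred X P" "log_pred X Q" shows "log_pred X (\<lambda>w s. P w s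
    \<or> Q w s)"
  using log_pred_not[OF log_pred_conj[OF log_pred_not[OF assms(1)] log_pred_not[OF assms(2)]]] by
      simp

lemma log_pred_const: "log_pred X (\<lambda>w s. b)"
  unfolding log_pred_def by (rule log_fun_const)

lemma log_pred_zero: assumes "log_fun X E" shows "log_pred X (\<lambda>w s. E w s = 0)"
proof -
  have "log_fun X (\<lambda>w s. 1 - E w s)" by (intro log_fun_diff log_fun_const assms)
  also have "(\<lambda>w s. 1 - E w s) = (\<lambda>w s. of_bool (E w s = 0))" by (simp add:
      fun_eq_iff)
  finally show ?thesis unfolding log_pred_def .
qed

lemma log_pred_le: assumes "log_fun X E" "log_fun X F" shows "log_pred X (\<lambda>w s. E w s
    \<le> F w s)"
  using log_pred_zero[OF log_fun_diff[OF assms]] by simp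

lemma log_pred_less: assumes "log_fun X E" "log_fun X F" shows "log_pred X (\<lambda>w s. E w s <
    F w s)"
  using log_pred_not[OF log_pred_le[OF assms(2,1)]] unfolding not_le .

lemma log_pred_eq: assumes "log_fun X E" "log_fun X F" shows "log_pred X (\<lambda>w s. E w s = F
    w s)"
proof -
  have "E w s = F w s \<longleftrightarrow> E w s \<le> F w s \<and> F w s \<le> E w s" for w s by
      auto
  then show ?thesis by (simp only: log_pred_conj[OF log_pred_le[OF assms] log_pred_le[OF
      assms(2,1)]])
qed

lemma log_fun_if: assumes "log_pred X P" "log_fun X E" "log_fun X F" shows "log_fun X (\<lambda>w
    s. if P w s then E w s else F w s)"
proof -
  have "log_fun X (\<lambda>w s. of_bool (P w s) * E w s + of_bool (\<not> P w s) * F w s)"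
    using assms(1) log_pred_not[OF assms(1)] unfolding log_pred_def by (intro log_fun_add
        log_fun_mult assms(2,3))
  also have "(\<lambda>w s. of_bool (P w s) * E w s + of_bool (\<not> P w s) * F w s)
      = (\<lambda>w s. if P w s then E w s else F w s)" by (simp add: fun_eq_iff)
  finally show ?thesis .
qed

lemma log_pred_ex:
  assumes "log_fun X N" "log_pred X (\<lambda>w s. P w (s 0) (\<lambda>i. s (Suc i)))"
  shows "log_pred X (\<lambda>w s. \<exists>i<N w s. P w i s)"
proof -
  have "log_pred X (\<lambda>w s. \<not> (\<Sum>i<N w s. of_bool (P w i s)) = (0 :: nat))"
    by (intro log_pred_not log_pred_zero log_fun_sum[where F = "\<lambda>w i s. of_bool (P w i
        s)"] assms(1)
        assms(2)[unfolded log_pred_def])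
  also have "(\<lambda>w s. \<not> (\<Sum>i<N w s. of_bool (P w i s)) = (0 :: nat)) = (\<lambda>w
      s. \<exists>i<N w s. P w i s)"
    by (auto simp: fun_eq_iff)
  finally show ?thesis .
qed

lemma log_pred_all:
  assumes "log_fun X N" "log_pred X (\<lambda>w s. P w (s 0) (\<lambda>i. s (Suc i)))"
  shows "log_pred X (\<lambda>w s. \<forall>i<N w s. P w i s)"
  using log_pred_not[OF log_pred_ex[where P = "\<lambda>w i s. \<not> P w i s", OF assms(1)
      log_pred_not[OF assms(2)]]]
  by simp

text \<open>
  The quotient counts the positive multiples of the divisor that do not exceed the dividend.
\<close>

lemma log_fun_div:
  assumes "log_fun X E" shows "log_fun X (\<lambda>w s. E w s div Suc k)"
proof -
  have eq: "(\<Sum>q<x. of_bool (Suc q * Suc k \<le> x)) = x div Suc k" for x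
  proof -
    have "(\<Sum>q<x. of_bool (Suc q * Suc k \<le> x)) = card ({..<x} \<inter> {q. Suc q * Suc k
        \<le> x})"
      unfolding sum_of_bool_eq[OF finite_lessThan] by simp
    also have "{..<x} \<inter> {q. Suc q * Suc k \<le> x} = {..<x div Suc k}"
    proof -
      have "Suc q * Suc k \<le> x \<longleftrightarrow> q < x div Suc k" for q
        using less_eq_div_iff_mult_less_eq[of "Suc k" "Suc q" x] by (simp only: Suc_le_eq
            zero_less_Suc)
      moreover have "q < x" if "q < x div Suc k" for q
        using that div_le_dividend[of x "Suc k"] by (rule less_le_trans)
      ultimately show ?thesis by blast
    qed
    finally show ?thesis by simp
  qed
  have "log_fun X (\<lambda>w s. \<Sum>q<E w s. of_bool (Suc q * Suc k \<le> E w s))"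
    by (rule log_fun_sum[where F = "\<lambda>w q s. of_bool (Suc q * Suc k \<le> E w s)"])
      (intro assms log_pred_le[unfolded log_pred_def] log_fun_mult log_fun_Suc log_fun_var
          log_fun_const log_fun_weaken[OF assms])+
  then show ?thesis unfolding eq .
qed

lemma log_fun_mod:
  assumes "log_fun X E" shows "log_fun X (\<lambda>w s. E w s mod Suc k)"
  unfolding minus_div_mult_eq_mod[symmetric]
  by (intro log_fun_diff log_fun_mult log_fun_div log_fun_const assms)

lemma log_fun_prod_encode:
  assumes "log_fun X E" "log_fun X F" shows "log_fun X (\<lambda>w s. prod_encode (E w s, F w s))"
proof -
  have eq: "triangle n = (\<Sum>i<n. Suc i)" for n by (induction n) simp_all
  show ?thesis
    unfolding prod_encode_def eq prod.case
    by (intro log_fun_add log_fun_sum[where F = "\<lambda>w i s. Suc i"] log_fun_Suc log_fun_var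
        assms)
qed

text \<open>
  The components of a coded pair are at most its code and are found by search.
\<close>

lemma log_fun_prod_decode:
  assumes "log_fun X E"
  shows "log_fun X (\<lambda>w s. fst (prod_decode (E w s)))" "log_fun X (\<lambda>w s. snd
      (prod_decode (E w s)))"
proof -
  have eq1: "(\<Sum>a<Suc x. if \<exists>b<Suc x. prod_encode (a, b) = x then a else 0) = fst
      (prod_decode x)" for x
  proof -
    obtain a b where ab: "prod_decode x = (a, b)" by (cases "prod_decode x")
    then have x: "x = prod_encode (a, b)" by (metis prod_decode_inverse)
    have "a < Suc x" "b < Suc x" unfolding x using le_prod_encode_1 le_prod_encode_2 by (simp_all
        add: less_Suc_eq_le)
    then have "(\<exists>b<Suc x. prod_encode (a', b) = x) \<longleftrightarrow> a' = a" for a'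
      unfolding x by auto
    then have "(\<Sum>a'<Suc x. if \<exists>b<Suc x. prod_encode (a', b) = x then a' else 0)
        = (\<Sum>a'<Suc x. if a' = a then a' else 0)" by simp
    also have "\<dots> = a" using \<open>a < Suc x\<close> by (simp add: sum.delta)
    finally show ?thesis using ab by simp
  qed
  have eq2: "(\<Sum>b<Suc x. if \<exists>a<Suc x. prod_encode (a, b) = x then b else 0) = snd
      (prod_decode x)" for x
  proof -
    obtain a b where ab: "prod_decode x = (a, b)" by (cases "prod_decode x")
    then have x: "x = prod_encode (a, b)" by (metis prod_decode_inverse)
    have "a < Suc x" "b < Suc x" unfolding x using le_prod_encode_1 le_prod_encode_2 by (simp_all
        add: less_Suc_eq_le)
    then have "(\<exists>a<Suc x. prod_encode (a, b') = x) \<longleftrightarrow> b' = b" for b'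
      unfolding x by auto
    then have "(\<Sum>b'<Suc x. if \<exists>a<Suc x. prod_encode (a, b') = x then b' else 0)
        = (\<Sum>b'<Suc x. if b' = b then b' else 0)" by simp
    also have "\<dots> = b" using \<open>b < Suc x\<close> by (simp add: sum.delta)
    finally show ?thesis using ab by simp
  qed
  note E = log_fun_weaken[OF assms]
  show "log_fun X (\<lambda>w s. fst (prod_decode (E w s)))"
    unfolding eq1[symmetric]
    by (rule log_fun_sum[where F = "\<lambda>w a s. if \<exists>b<Suc (E w s). prod_encode (a, b)
        = E w s then a else 0"],
        intro log_fun_Suc assms, rule log_fun_if,
        rule log_pred_ex[where P = "\<lambda>w b s. prod_encode (s 0, b) = E w (\<lambda>i. s (Suc
            i))"])
       (intro log_pred_eq log_fun_prod_encode log_fun_Suc log_fun_var log_fun_const E)+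
  show "log_fun X (\<lambda>w s. snd (prod_decode (E w s)))"
    unfolding eq2[symmetric]
    by (rule log_fun_sum[where F = "\<lambda>w b s. if \<exists>a<Suc (E w s). prod_encode (a, b)
        = E w s then b else 0"],
        intro log_fun_Suc assms, rule log_fun_if,
        rule log_pred_ex[where P = "\<lambda>w a s. prod_encode (a, s 0) = E w (\<lambda>i. s (Suc
            i))"])
       (intro log_pred_eq log_fun_prod_encode log_fun_Suc log_fun_var log_fun_const E)+
qed

section \<open>Functions with finitely many values\<close>

text \<open>
  Letters, input symbols and entries of transition tables are not numbers. Such a value is
  represented by the predicates that it equals a given object, and then any function may be applied
  to it by a finite case distinction, as in \<open>log_fin_map\<close>.
\<close>

definition log_fin :: "'a set \<Rightarrow> ('a list \<Rightarrow> (nat \<Rightarrow> nat)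
    \<Rightarrow> 'z) \<Rightarrow> bool" where
  "log_fin X E \<longleftrightarrow> (\<exists>C. finite C \<and> (\<forall>w \<in> lists X.
      \<forall>s. E w s \<in> C)) \<and>
     (\<forall>z. log_pred X (\<lambda>w s. E w s = z))"

lemma log_finI:
  assumes "finite C" "\<And>w s. w \<in> lists X \<Longrightarrow> E w s \<in> C" "\<And>z.
      log_pred X (\<lambda>w s. E w s = z)"
  shows "log_fin X E"
  unfolding log_fin_def by (intro conjI exI[of _ C] ballI allI assms)

lemma log_fin_range:
  assumes "log_fin X E"
  obtains C where "finite C" "\<And>w s. w \<in> lists X \<Longrightarrow> E w s \<in> C"
  using assms unfolding log_fin_def by blast

lemma log_finD: "log_fin X E \<Longrightarrow> log_pred X (\<lambda>w s. E w s = z)"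
  by (simp add: log_fin_def)

lemma log_pred_weaken: "log_pred X P \<Longrightarrow> log_pred X (\<lambda>w s. P w (\<lambda>i.
    s (f i)))"
  unfolding log_pred_def by (rule log_fun_weaken)

lemma log_fun_finite_sum:
  assumes "finite C" "\<And>c. c \<in> C \<Longrightarrow> log_fun X (F c)"
  shows "log_fun X (\<lambda>w s. \<Sum>c\<in>C. F c w s)"
  using assms
proof (induction rule: finite_induct)
  case empty
  show ?case unfolding sum.empty by (rule log_fun_zero)
next
  case (insert c C)
  show ?case unfolding sum.insert[OF insert.hyps]
    by (intro log_fun_add insert.prems insert.IH) simp_all
qed

lemma log_pred_cong:
  assumes "log_pred X P" "\<And>w s. w \<in> lists X \<Longrightarrow> P w s = P' w s"
  shows "log_pred X P'"
  unfolding log_pred_def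
  by (rule log_fun_cong[OF assms(1)[unfolded log_pred_def]]) (simp add: assms(2))

lemma log_fin_cong:
  assumes "log_fin X E" "\<And>w s. w \<in> lists X \<Longrightarrow> E w s = E' w s"
  shows "log_fin X E'"
proof -
  obtain C where C: "finite C" "\<And>w s. w \<in> lists X \<Longrightarrow> E w s \<in> C"
    by (rule log_fin_range[OF assms(1)]) blast
  show ?thesis
  proof (rule log_finI[OF C(1)])
    show "E' w s \<in> C" if "w \<in> lists X" for w s using C(2)[OF that] assms(2)[OF that] by
        metis
    show "log_pred X (\<lambda>w s. E' w s = z)" for z
      by (rule log_pred_cong[OF log_finD[OF assms(1)]]) (simp add: assms(2))
  qed
qed

lemma log_fin_lc:
  assumes "log_fin X E"
  shows "log_fun X (\<lambda>w s. h (E w s))"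
proof -
  obtain C where C: "finite C" "\<And>w s. w \<in> lists X \<Longrightarrow> E w s \<in> C"
    by (rule log_fin_range[OF assms]) blast
  have "log_fun X (\<lambda>w s. \<Sum>c\<in>C. h c * of_bool (E w s = c))"
    by (intro log_fun_finite_sum C log_fun_mult log_fun_const log_finD[OF assms, unfolded
        log_pred_def])
  then show ?thesis
  proof (rule log_fun_cong)
    fix w and s :: "nat \<Rightarrow> nat" assume w: "w \<in> lists X"
    have "(\<Sum>c\<in>C. h c * of_bool (E w s = c)) = (\<Sum>c\<in>C. if E w s = c then h c else
        0)"
      by (intro sum.cong) auto
    also have "\<dots> = h (E w s)"
      using C(1) C(2)[OF w] by simp
    finally show "(\<Sum>c\<in>C. h c * of_bool (E w s = c)) = h (E w s)" .
  qed
qed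

lemma log_fin_lcb: "log_fin X E \<Longrightarrow> log_pred X (\<lambda>w s. P (E w s))"
  unfolding log_pred_def by (rule log_fin_lc)

lemma log_fin_map:
  assumes "log_fin X E" shows "log_fin X (\<lambda>w s. g (E w s))"
proof -
  obtain C where C: "finite C" "\<And>w s. w \<in> lists X \<Longrightarrow> E w s \<in> C"
    by (rule log_fin_range[OF assms]) blast
  show ?thesis
  proof (rule log_finI[of "g ` C"])
    show "log_pred X (\<lambda>w s. g (E w s) = z)" for z
      by (rule log_fin_lcb[OF assms, of "\<lambda>x. g x = z"])
  qed (simp_all add: C)
qed

lemma log_fin_pair:
  assumes "log_fin X E" "log_fin X F" shows "log_fin X (\<lambda>w s. (E w s, F w s))"
proof -
  obtain C where C: "finite C" "\<And>w s. w \<in> lists X \<Longrightarrow> E w s \<in> C"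
    by (rule log_fin_range[OF assms(1)]) blast
  obtain D where D: "finite D" "\<And>w s. w \<in> lists X \<Longrightarrow> F w s \<in> D"
    by (rule log_fin_range[OF assms(2)]) blast
  have "log_pred X (\<lambda>w s. (E w s, F w s) = z)" for z
    unfolding prod_eq_iff fst_conv snd_conv by (intro log_pred_conj log_finD assms)
  then show ?thesis by (intro log_finI[of "C \<times> D"]) (simp_all add: C D)
qed

lemma log_fin_map2:
  assumes "log_fin X E" "log_fin X F" shows "log_fin X (\<lambda>w s. g (E w s) (F w s))"
  using log_fin_map[OF log_fin_pair[OF assms], of "case_prod g"] by simp

lemma log_fin_const: "log_fin X (\<lambda>w s. z)"
  by (rule log_finI[of "{z}"]) (simp_all add: log_pred_const)

lemma log_fin_bool: assumes "log_pred X P" shows "log_fin X P"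
proof (rule log_finI[of UNIV])
  show "log_pred X (\<lambda>w s. P w s = z)" for z
    by (cases z) (simp_all add: assms log_pred_not[OF assms])
qed simp_all

lemma log_fin_if:
  assumes "log_pred X P" "log_fin X E" "log_fin X F" shows "log_fin X (\<lambda>w s. if P w s then
      E w s else F w s)"
  using log_fin_map2[OF log_fin_bool[OF assms(1)] log_fin_pair[OF assms(2,3)], of "\<lambda>b (x,
      y). if b then x else y"]
  by simp

lemma log_fin_less:
  assumes "log_fun X E" "\<And>w s. w \<in> lists X \<Longrightarrow> E w s < k" shows "log_fin X E"
  by (rule log_finI[of "{..<k}"]) (simp_all add: assms log_pred_eq log_fun_const)

lemma log_fun_min: "log_fun X E \<Longrightarrow> log_fun X F \<Longrightarrow> log_fun X
    (\<lambda>w s. min (E w s) (F w s))"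
  unfolding min_def by (intro log_fun_if log_pred_le)

lemma log_fin_min: "log_fun X E \<Longrightarrow> log_fin X (\<lambda>w s. min (E w s) k)"
  by (rule log_fin_less[of _ _ "Suc k"]) (simp_all add: log_fun_min log_fun_const less_Suc_eq_le)

lemma log_fin_weaken:
  assumes "log_fin X E" shows "log_fin X (\<lambda>w s. E w (\<lambda>i. s (f i)))"
proof -
  obtain C where C: "finite C" "\<And>w s. w \<in> lists X \<Longrightarrow> E w s \<in> C"
    by (rule log_fin_range[OF assms]) blast
  show ?thesis
    by (rule log_finI[OF C log_pred_weaken[OF log_finD[OF assms]]])
qed

lemma log_fin_let:
  assumes E: "log_fun X E" and F: "log_fin X (\<lambda>w s. F w (s 0) (\<lambda>i. s (Suc i)))"
  shows "log_fin X (\<lambda>w s. F w (E w s) s)"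
proof -
  obtain C where C: "finite C" "\<And>w s. w \<in> lists X \<Longrightarrow> F w (s 0)
      (\<lambda>i. s (Suc i)) \<in> C"
    by (rule log_fin_range[OF F]) blast
  show ?thesis
  proof (rule log_finI[OF C(1)])
    show "F w (E w s) s \<in> C" if "w \<in> lists X" for w s
      using C(2)[OF that, of "case_nat (E w s) s"] by simp
    show "log_pred X (\<lambda>w s. F w (E w s) s = z)" for z
      unfolding log_pred_def
      by (rule log_fun_let[OF E, of "\<lambda>w x s. of_bool (F w x s = z)"]) (rule log_finD[OF F,
          unfolded log_pred_def])
  qed
qed

lemma log_fin_input:
  assumes "finite X" "log_fun X E"
  shows "log_fin X (\<lambda>w s. input_at w (E w s))"
proof (rule log_finI[of "{Left_End, Right_End} \<union> Letter ` X"])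
  show "input_at w (E w s) \<in> {Left_End, Right_End} \<union> Letter ` X" if "w \<in> lists X"
      for w s
  proof (cases "E w s = 0 \<or> length w < E w s")
    case False
    then have "w ! (E w s - 1) \<in> set w" by (intro nth_mem) auto
    then show ?thesis using that False by (auto simp: input_at_def)
  qed (auto simp: input_at_def)
  show "log_pred X (\<lambda>w s. input_at w (E w s) = z)" for z
    using log_fun_input[OF assms(2), of "{z}"] unfolding log_pred_def by simp
qed (use assms(1) in simp)

section \<open>Words given by their letters\<close>

definition letter :: "'z list \<Rightarrow> nat \<Rightarrow> 'z option" where
  "letter v p = (if p < length v then Some (v ! p) else None)"

text \<open>
  In the second condition the position is the variable \<open>0\<close> and the variables of the
      word are shifted
  by one. It also says that all words of the family have letters in one finite set.
\<close>

definition log_word :: "'a set \<Rightarrow> ('a list \<Rightarrow> (nat \<Rightarrow> nat)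
    \<Rightarrow> 'z list) \<Rightarrow> bool" where
  "log_word X V \<longleftrightarrow> log_fun X (\<lambda>w s. length (V w s)) \<and>
     log_fin X (\<lambda>w s. letter (V w (\<lambda>i. s (Suc i))) (s 0))"

lemma log_word_length: "log_word X V \<Longrightarrow> log_fun X (\<lambda>w s. length (V w s))"
  by (simp add: log_word_def)

lemma log_word_weaken: "log_word X V \<Longrightarrow> log_word X (\<lambda>w s. V w (\<lambda>i.
    s (f i)))"
  unfolding log_word_def
  using log_fun_weaken[of X "\<lambda>w s. length (V w s)" f]
    log_fin_weaken[of X "\<lambda>w s. letter (V w (\<lambda>i. s (Suc i))) (s 0)" "case_nat 0
        (\<lambda>i. Suc (f i))"]
  by simp

lemma log_word_letter:
  assumes "log_word X V" "log_fun X E" shows "log_fin X (\<lambda>w s. letter (V w s) (E w s))"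
  by (rule log_fin_let[where F = "\<lambda>w x s. letter (V w s) x"]) (use assms in
      \<open>simp_all add: log_word_def\<close>)

lemma log_wordI:
  assumes "log_fun X (\<lambda>w s. length (V w s))" "log_fin X (\<lambda>w s. letter (V w
      (\<lambda>i. s (Suc i))) (s 0))"
  shows "log_word X V"
  using assms by (simp add: log_word_def)

lemma log_word_let:
  assumes E: "log_fun X E" and V: "log_word X (\<lambda>w s. V w (s 0) (\<lambda>i. s (Suc i)))"
  shows "log_word X (\<lambda>w s. V w (E w s) s)"
proof (rule log_wordI)
  show "log_fun X (\<lambda>w s. length (V w (E w s) s))"
    by (rule log_fun_let[OF E, where F = "\<lambda>w x s. length (V w x s)"]) (rule
        log_word_length[OF V])
  have "log_word X (\<lambda>w s. V w (s 0) (\<lambda>i. s (Suc (Suc i))))"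
    using log_word_weaken[OF V, of "case_nat 0 (\<lambda>i. Suc (Suc i))"] by simp
  then have "log_fin X (\<lambda>w s. letter (V w (s 0) (\<lambda>i. s (Suc (Suc i)))) (s (Suc 0)))"
    by (rule log_word_letter[OF _ log_fun_var])
  then show "log_fin X (\<lambda>w s. letter (V w (E w (\<lambda>i. s (Suc i))) (\<lambda>i. s
      (Suc i))) (s 0))"
    by (intro log_fin_let[OF log_fun_weaken[OF E], where F = "\<lambda>w x s. letter (V w x
        (\<lambda>i. s (Suc i))) (s 0)"])
qed

lemma log_word_comp1:
  "log_word X (\<lambda>w s. V w (s 0)) \<Longrightarrow> log_fun X E \<Longrightarrow> log_word X
      (\<lambda>w s. V w (E w s))"
  by (rule log_word_let[where V = "\<lambda>w x s. V w x"])

lemma log_word_finite: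
  assumes "log_fin X V" shows "log_word X V"
proof (rule log_wordI)
  show "log_fun X (\<lambda>w s. length (V w s))" by (rule log_fin_lc[OF assms])
  obtain C where C: "finite C" "\<And>w s. w \<in> lists X \<Longrightarrow> V w s \<in> C"
    by (rule log_fin_range[OF assms]) blast
  define L where "L = Max (insert 0 (length ` C))"
  have L: "length (V w s) \<le> L" if "w \<in> lists X" for w s
    unfolding L_def using C that by (intro Max_ge) auto
  have "log_fin X (\<lambda>w s. letter (V w (\<lambda>i. s (Suc i))) (min (s 0) L))"
    by (rule log_fin_map2[OF log_fin_weaken[OF assms] log_fin_min[OF log_fun_var]])
  moreover have eq: "letter (V w s) (min p L) = letter (V w s) p" if "w \<in> lists X" for w s p
    using L[OF that, of s] by (simp add: letter_def min_def)
  ultimately show "log_fin X (\<lambda>w s. letter (V w (\<lambda>i. s (Suc i))) (s 0))"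
    by (rule log_fin_cong)
qed

lemma log_pred_word_eq:
  assumes "log_word X U" "log_word X V" shows "log_pred X (\<lambda>w s. U w s = V w s)"
proof -
  have "log_pred X (\<lambda>w s. length (U w s) = length (V w s) \<and>
      (\<forall>p<length (U w s). letter (U w s) p = letter (V w s) p))"
  proof (intro log_pred_conj log_pred_eq log_word_length assms log_pred_all[where P = "\<lambda>w
      p s. letter (U w s) p = letter (V w s) p"])
    show "log_pred X (\<lambda>w s. letter (U w (\<lambda>i. s (Suc i))) (s 0) = letter (V w
        (\<lambda>i. s (Suc i))) (s 0))"
      using log_fin_lcb[OF log_fin_pair[OF log_word_letter[OF log_word_weaken[OF assms(1)]
          log_fun_var]
            log_word_letter[OF log_word_weaken[OF assms(2)] log_fun_var]], of "\<lambda>(x, y). x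
                = y"] by simp
  qed
  moreover have eq: "length u = length v \<and> (\<forall>p<length u. letter u p = letter v p)
      \<longleftrightarrow> u = v" for u v :: "'b list"
    by (auto simp: letter_def list_eq_iff_nth_eq)
  ultimately show ?thesis unfolding eq by simp
qed

lemma letter_append: "letter (u @ v) p =
   (if p < length u then letter u p else letter v (p - length u))"
  by (auto simp: letter_def nth_append)

lemma log_word_append:
  assumes "log_word X U" "log_word X V" shows "log_word X (\<lambda>w s. U w s @ V w s)"
proof (rule log_wordI)
  show "log_fun X (\<lambda>w s. length (U w s @ V w s))"
    unfolding length_append by (intro log_fun_add log_word_length assms)
  note U = log_word_weaken[OF assms(1)] and V = log_word_weaken[OF assms(2)]
  show "log_fin X (\<lambda>w s. letter (U w (\<lambda>i. s (Suc i)) @ V w (\<lambda>i. s (Suc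
      i))) (s 0))"
    unfolding letter_append
    by (intro log_fin_if log_pred_less log_word_letter log_fun_diff log_fun_var log_word_length U V)
qed

lemma log_word_if:
  assumes "log_pred X P" "log_word X U" "log_word X V" shows "log_word X (\<lambda>w s. if P w s
      then U w s else V w s)"
proof (rule log_wordI)
  show "log_fun X (\<lambda>w s. length (if P w s then U w s else V w s))"
    unfolding if_distrib[of length] by (intro log_fun_if log_word_length assms)
  have P: "log_pred X (\<lambda>w s. P w (\<lambda>i. s (Suc i)))"
    by (rule log_pred_weaken[OF assms(1)])
  note U = log_word_weaken[OF assms(2)] and V = log_word_weaken[OF assms(3)]
  show "log_fin X (\<lambda>w s. letter (if P w (\<lambda>i. s (Suc i)) then U w (\<lambda>i. s
      (Suc i)) else V w (\<lambda>i. s (Suc i))) (s 0))"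
    unfolding if_distrib[of "\<lambda>u. letter u _"]
    by (intro log_fin_if P log_word_letter log_fun_var U V)
qed

lemma log_word_map:
  assumes "log_word X V" shows "log_word X (\<lambda>w s. map g (V w s))"
proof (rule log_wordI)
  show "log_fun X (\<lambda>w s. length (map g (V w s)))"
    unfolding length_map by (rule log_word_length[OF assms])
  have "letter (map g v) p = map_option g (letter v p)" for v p
    by (simp add: letter_def)
  then show "log_fin X (\<lambda>w s. letter (map g (V w (\<lambda>i. s (Suc i)))) (s 0))"
    using log_fin_map[OF log_word_letter[OF log_word_weaken[OF assms] log_fun_var], of "map_option
        g"] by simp
qed

lemma log_word_rev:
  assumes "log_word X V" shows "log_word X (\<lambda>w s. rev (V w s))"
proof (rule log_wordI)
  show "log_fun X (\<lambda>w s. length (rev (V w s)))"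
    unfolding length_rev by (rule log_word_length[OF assms])
  have eq: "letter (rev v) p = (if p < length v then letter v (length v - Suc p) else None)" for v
      :: "'b list" and p
    by (auto simp: letter_def rev_nth)
  note V = log_word_weaken[OF assms]
  show "log_fin X (\<lambda>w s. letter (rev (V w (\<lambda>i. s (Suc i)))) (s 0))"
    unfolding eq by (intro log_fin_if log_pred_less log_word_letter log_fun_diff log_fun_Suc
        log_fun_var log_word_length V log_fin_const)
qed

lemma log_word_input:
  assumes "finite X" shows "log_word X (\<lambda>w s. w)"
proof (rule log_wordI)
  show "log_fun X (\<lambda>w s. length w)"
    using log_fun_pred[OF log_fun_length] by simp
  have eq: "letter w p = (case input_at w (Suc p) of Letter a \<Rightarrow> Some a | _
      \<Rightarrow> None)" for w :: "'a list" and p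
    by (simp add: letter_def input_at_def)
  show "log_fin X (\<lambda>w s. letter w (s 0))"
    unfolding eq by (rule log_fin_map[OF log_fin_input[OF assms]]) (intro log_fun_Suc log_fun_var)
qed

text \<open>
  The letter at \<open>p\<close> lies in the piece \<open>i\<close> for which the pieces before
      \<open>i\<close> have total length at most
  \<open>p\<close>, while \<open>p\<close> minus that length is a position in the piece.
\<close>

lemma letter_concat:
  "letter (concat (map f [0..<n])) p = Some z \<longleftrightarrow>
     (\<exists>i<n. (\<Sum>j<i. length (f j)) \<le> p \<and> letter (f i) (p - (\<Sum>j<i. length
         (f j))) = Some z)"
proof (induction n)
  case 0
  show ?case by (simp add: letter_def)
next
  case (Suc n)
  have len: "length (concat (map f [0..<k])) = (\<Sum>j<k. length (f j))" for k
    by (induction k) simp_all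
  have sub: "(\<Sum>j<Suc i. length (f j)) \<le> (\<Sum>j<n. length (f j))" if "i < n" for i
    using that by (intro sum_mono2) auto
  have split: "letter (concat (map f [0..<Suc n])) p =
      (if p < (\<Sum>j<n. length (f j)) then letter (concat (map f [0..<n])) p
       else letter (f n) (p - (\<Sum>j<n. length (f j))))"
    by (simp add: letter_append len)
  show ?case
  proof (cases "p < (\<Sum>j<n. length (f j))")
    case True
    then have "\<not> (\<Sum>j<n. length (f j)) \<le> p" by simp
    then show ?thesis
      unfolding split Ex_less_Suc if_P[OF True] Suc.IH by blast
  next
    case False
    have "letter (f i) (p - (\<Sum>j<i. length (f j))) = None" if "i < n" for i
      using False sub[OF that] by (simp add: letter_def)
    then have "\<not> (\<exists>i<n. (\<Sum>j<i. length (f j)) \<le> p \<and>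
        letter (f i) (p - (\<Sum>j<i. length (f j))) = Some z)"
      by simp
    then show ?thesis
      unfolding split Ex_less_Suc if_not_P[OF False] using False[unfolded not_less] by blast
  qed
qed

lemma log_word_concat:
  assumes V: "log_word X (\<lambda>w s. V w (s 0) (\<lambda>i. s (Suc i)))" and N: "log_fun X N"
  shows "log_word X (\<lambda>w s. concat (map (\<lambda>i. V w i s) [0..<N w s]))"
proof (rule log_wordI)
  have len: "length (concat (map f [0..<n])) = (\<Sum>i<n. length (f i))" for f :: "nat
      \<Rightarrow> 'b list" and n
    by (induction n) simp_all
  show "log_fun X (\<lambda>w s. length (concat (map (\<lambda>i. V w i s) [0..<N w s])))"
    unfolding len by (rule log_fun_sum[where F = "\<lambda>w i s. length (V w i s)", OF N]) (rule
        log_word_length[OF V])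
  let ?L = "\<lambda>w s. letter (concat (map (\<lambda>i. V w i (\<lambda>i. s (Suc i))) [0..<N w
      (\<lambda>i. s (Suc i))])) (s 0)"
  obtain C where C: "finite C" "\<And>w s. w \<in> lists X \<Longrightarrow> letter (V w (s (Suc
      0)) (\<lambda>i. s (Suc (Suc i)))) (s 0) \<in> C"
    by (rule log_fin_range[OF conjunct2[OF V[unfolded log_word_def]]]) blast
  have C': "letter (V w i s) p \<in> C" if "w \<in> lists X" for w i s p
    using C(2)[OF that, of "case_nat p (case_nat i s)"] by simp
  have some: "log_pred X (\<lambda>w s. ?L w s = Some z)" for z
    unfolding letter_concat
  proof (rule log_pred_ex[where P = "\<lambda>w i s. (\<Sum>j<i. length (V w j (\<lambda>i. s (Suc
      i)))) \<le> s 0 \<and>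
       letter (V w i (\<lambda>i. s (Suc i))) (s 0 - (\<Sum>j<i. length (V w j (\<lambda>i. s (Suc
           i))))) = Some z",
       OF log_fun_weaken[OF N] log_pred_conj])
    have sum: "log_fun X (\<lambda>w s. \<Sum>j<s 0. length (V w j (\<lambda>i. s (Suc (Suc i)))))"
      by (rule log_fun_sum[where F = "\<lambda>w j s. length (V w j (\<lambda>i. s (Suc (Suc
          i))))", OF log_fun_var])
         (use log_word_length[OF log_word_weaken[OF V, of "case_nat 0 (\<lambda>i. Suc (Suc (Suc
             i)))"]] in simp)
    show "log_pred X (\<lambda>w s. (\<Sum>j<s 0. length (V w j (\<lambda>i. s (Suc (Suc i)))))
        \<le> s (Suc 0))"
      by (intro log_pred_le sum log_fun_var)
    have "log_word X (\<lambda>w s. V w (s 0) (\<lambda>i. s (Suc (Suc i))))"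
      using log_word_weaken[OF V, of "case_nat 0 (\<lambda>i. Suc (Suc i))"] by simp
    then have "log_fin X (\<lambda>w s. letter (V w (s 0) (\<lambda>i. s (Suc (Suc i))))
        (s (Suc 0) - (\<Sum>j<s 0. length (V w j (\<lambda>i. s (Suc (Suc i)))))))"
      by (rule log_word_letter) (intro log_fun_diff log_fun_var sum)
    then show "log_pred X (\<lambda>w s. letter (V w (s 0) (\<lambda>i. s (Suc (Suc i))))
        (s (Suc 0) - (\<Sum>j<s 0. length (V w j (\<lambda>i. s (Suc (Suc i)))))) = Some z)"
      by (rule log_finD)
  qed
  show "log_fin X ?L"
  proof (rule log_finI[of "insert None C"])
    show "?L w s \<in> insert None C" if "w \<in> lists X" for w s
    proof (cases "?L w s")
      case (Some z)
      then obtain i where "letter (V w i (\<lambda>i. s (Suc i)))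
          (s 0 - (\<Sum>j<i. length (V w j (\<lambda>i. s (Suc i))))) = Some z"
        unfolding letter_concat by blast
      with C'[OF that, of i "\<lambda>i. s (Suc i)"] Some show ?thesis by (metis insertI2)
    qed simp
    show "finite (insert None C)" using C(1) by simp
    have "?L w s = None \<longleftrightarrow> \<not> s 0 < (\<Sum>i<N w (\<lambda>i. s (Suc i)).
        length (V w i (\<lambda>i. s (Suc i))))" for w s
      unfolding letter_def len by simp
    moreover have "log_pred X (\<lambda>w s. \<not> s 0 < (\<Sum>i<N w (\<lambda>i. s (Suc i)).
        length (V w i (\<lambda>i. s (Suc i)))))"
    proof (intro log_pred_not log_pred_less log_fun_var)
      have "log_word X (\<lambda>w s. V w (s 0) (\<lambda>i. s (Suc (Suc i))))"
        using log_word_weaken[OF V, of "case_nat 0 (\<lambda>i. Suc (Suc i))"] by simp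
      then show "log_fun X (\<lambda>w s. \<Sum>i<N w (\<lambda>i. s (Suc i)). length (V w i
          (\<lambda>i. s (Suc i))))"
        by (intro log_fun_sum[where F = "\<lambda>w i s. length (V w i (\<lambda>i. s (Suc i)))",
            OF log_fun_weaken[OF N]] log_word_length)
    qed
    ultimately show "log_pred X (\<lambda>w s. ?L w s = z)" for z
      using some by (cases z) simp_all
  qed
qed

section \<open>Writing a word given by its letters\<close>

text \<open>
  Given \<open>v + 1\<close> in the register \<open>1\<close>, the letter \<open>j + v\<close> is
      written, found by counting down to zero.
\<close>

fun emit :: "nat \<Rightarrow> nat \<Rightarrow> 'a com" where
  "emit 0 j = Skip"
| "emit (Suc k) j = Seq (Dec 1) (IfZero 1 (Write j) (emit k (Suc j)))"

lemma letters_emit: "letters (emit k j) \<subseteq> {j..<j + k}"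
proof (induction k arbitrary: j)
  case (Suc k)
  then show ?case using Suc[of "Suc j"] by auto
qed simp

lemma exec_emit:
  assumes "v < k" "\<sigma> 1 = Suc v"
  shows "exec B w (emit k j) (h, \<sigma>, u) (h, \<sigma>(1 := 0), u @ [j + v])"
  using assms
proof (induction k arbitrary: j v \<sigma>)
  case (Suc k)
  have "exec B w (Dec 1) (h, \<sigma>, u) (h, \<sigma>(1 := v), u)"
    using exec_Dec[of \<sigma> 1 B w h u] Suc.prems(2) by simp
  moreover have "exec B w (IfZero 1 (Write j) (emit k (Suc j))) (h, \<sigma>(1 := v), u)
      (h, \<sigma>(1 := 0), u @ [j + v])"
  proof (rule exec_IfZero, cases v)
    case 0
    then show "exec B w (if (\<sigma>(1 := v)) 1 = 0 then Write j else emit k (Suc j)) (h,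
        \<sigma>(1 := v), u)
        (h, \<sigma>(1 := 0), u @ [j + v])"
      using exec_Write[of B w j h "\<sigma>(1 := 0)" u] by simp
  next
    case (Suc v')
    then show "exec B w (if (\<sigma>(1 := v)) 1 = 0 then Write j else emit k (Suc j)) (h,
        \<sigma>(1 := v), u)
        (h, \<sigma>(1 := 0), u @ [j + v])"
      using Suc.IH[of v' "\<sigma>(1 := v)" "Suc j"] Suc.prems
      by (simp del: fun_upd_apply add: fun_upd_same)
  qed
  ultimately show ?case unfolding emit.simps by (rule exec_Seq)
qed simp

text \<open>
  The register \<open>0\<close> runs through the positions of the word, and the register
      \<open>1\<close> holds the code of
  the letter at that position, where the code \<open>0\<close> tells that the word has ended.
\<close>

theorem log_word_imp_logspace_computable:
  fixes f :: "'a list \<Rightarrow> 'b list"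
  assumes fin: "finite X" "finite Y" and f: "f \<in> lists X \<rightarrow> lists Y" and log_word:
      "log_word X (\<lambda>w s. f w)"
  shows "logspace_computable X Y f"
proof -
  obtain ys where ys: "set ys = Y" using finite_list[OF fin(2)] by blast
  have "\<exists>i. i < length ys \<and> ys ! i = y" if "y \<in> Y" for y
    using that unfolding ys[symmetric] in_set_conv_nth .
  then obtain idx where idx: "\<And>y. y \<in> Y \<Longrightarrow> idx y < length ys \<and> ys !
      idx y = y"
    by metis
  define code where "code = (\<lambda>z. case z of None \<Rightarrow> 0 | Some y \<Rightarrow> Suc
      (idx y))"
  define F where "F = (\<lambda>w (s :: nat \<Rightarrow> nat). code (letter (f w) (s 0)))"
  have "log_fun X F"
    unfolding F_def by (rule log_fin_lc[OF log_word_letter[OF log_word log_fun_var]])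
  then obtain c where c: "computes X 2 (\<lambda>_. 0) 1 c F"
    by (rule log_fun_compute[of X F "\<lambda>_. 0" 2 1]) simp_all
  define K where "K = length ys"
  define body where "body = Seq (emit K 0) (Seq (Inc 0) c)"
  define prog where "prog = Seq c (While 1 body)"
  obtain d0 where d0: "\<And>w s. w \<in> lists X \<Longrightarrow> (\<And>i. s i \<le> (length w
      + 2) ^ 0) \<Longrightarrow>
      length (f w) \<le> (length w + 2) ^ d0"
    by (rule log_fun_bound[OF log_word_length[OF log_word], of 0]) blast
  define D where "D = max d0 K"
  obtain e where e: "D \<le> e" "\<And>w \<sigma> e'. w \<in> lists X \<Longrightarrow> (\<And>i.
      \<sigma> i \<le> (length w + 2) ^ D) \<Longrightarrow>
      (\<And>i. 2 \<le> i \<Longrightarrow> \<sigma> i = 0) \<Longrightarrow> e \<le> e'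
          \<Longrightarrow>
      run ((length w + 2) ^ e') w c \<sigma> (\<sigma>(1 := F w (\<lambda>i. \<sigma> 0)))"
    by (rule computes_run[OF c, of D]) blast
  show ?thesis
  proof (rule program_logspace_computable[OF fin f])
    have "letters prog \<subseteq> {0..<0 + K}"
      using c letters_emit[of K 0] by (simp add: prog_def body_def computes_def)
    then show "(\<lambda>i. ys ! i) ` letters prog \<subseteq> Y"
      unfolding ys[symmetric] K_def using nth_mem by fastforce
    fix w assume w: "w \<in> lists X"
    let ?B = "(length w + 2) ^ e"
    let ?n = "length (f w)"
    define S where "S = (\<lambda>p. (\<lambda>_ :: nat. 0 :: nat)(0 := p, 1 := code (letter (f w)
        p)))"
    define U where "U = (\<lambda>p. map idx (take p (f w)))"
    have fY: "f w \<in> lists Y" using f w by blast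
    have n: "?n \<le> (length w + 2) ^ D"
      by (rule order_trans[OF d0[OF w, of "\<lambda>_. 0"] power_le]) (simp_all add: D_def)
    have small: "K \<le> (length w + 2) ^ D"
    proof -
      have "K \<le> 2 ^ K" by (rule less_imp_le[OF less_exp])
      also have "\<dots> \<le> (length w + 2) ^ K" by (rule power_mono) simp_all
      also have "\<dots> \<le> (length w + 2) ^ D" by (rule power_le) (simp add: D_def)
      finally show ?thesis .
    qed
    have letter_Y: "y \<in> Y" if "letter (f w) p = Some y" for p y
      using that fY by (auto simp: letter_def in_lists_conv_set split: if_splits)
    have code: "code (letter (f w) p) \<le> K" for p
      using letter_Y idx by (auto simp: code_def K_def Suc_le_eq split: option.split)
    have update: "run ?B w c \<sigma> (S p)" if "\<sigma> 0 = p" "p \<le> ?n" "\<sigma> 1 \<le> K"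
        "\<And>i. 2 \<le> i \<Longrightarrow> \<sigma> i = 0" for \<sigma> p
    proof -
      have "\<sigma> i \<le> (length w + 2) ^ D" for i
      proof -
        consider "i = 0" | "i = 1" | "2 \<le> i" by linarith
        then show ?thesis
          using that n small by cases (auto intro: order_trans)
      qed
      then have "run ?B w c \<sigma> (\<sigma>(1 := F w (\<lambda>i. \<sigma> 0)))"
        by (rule e(2)[OF w _ that(4)]) simp_all
      moreover have "\<sigma>(1 := F w (\<lambda>i. \<sigma> 0)) = S p"
      proof
        fix i :: nat
        consider "i = 0" | "i = 1" | "2 \<le> i" by linarith
        then show "(\<sigma>(1 := F w (\<lambda>i. \<sigma> 0))) i = S p i"
          using that by cases (simp_all add: S_def F_def)
      qed
      ultimately show ?thesis by simp
    qed
    have loop: "\<exists>h' \<sigma>'. exec ?B w (While 1 body) (h, S p, U p) (h', \<sigma>', map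
        idx (f w))"
      if "p \<le> ?n" "h \<le> length w + 1" for p h
      using that
    proof (induction arbitrary: h rule: inc_induct)
      case base
      have "S ?n 1 = 0" by (simp add: S_def letter_def code_def)
      then show ?case
        using exec_While_done[of "S ?n" 1 ?B w body h "U ?n"] by (auto simp: U_def)
    next
      case (step p)
      have lp: "letter (f w) p = Some (f w ! p)" using step.hyps by (simp add: letter_def)
      then have S1: "S p 1 = Suc (idx (f w ! p))" by (simp add: S_def code_def)
      have "idx (f w ! p) < K" using idx[OF letter_Y[OF lp]] by (simp add: K_def)
      then have "exec ?B w (emit K 0) (h, S p, U p) (h, (S p)(1 := 0), U p @ [0 + idx (f w ! p)])"
        using exec_emit[of "idx (f w ! p)" K "S p" ?B w 0 h "U p"] S1 by simp
      moreover have "U p @ [0 + idx (f w ! p)] = U (Suc p)"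
        using step.hyps by (simp add: U_def take_Suc_conv_app_nth)
      ultimately have r1: "exec ?B w (emit K 0) (h, S p, U p) (h, (S p)(1 := 0), U (Suc p))"
        by simp
      have "p < ?B"
        using less_le_trans[OF step.hyps(2) order_trans[OF n power_le[OF e(1)]]] .
      then have r2: "exec ?B w (Inc 0) (h, (S p)(1 := 0), U (Suc p)) (h, (S p)(1 := 0, 0 := Suc
          p), U (Suc p))"
        using exec_Inc[of "(S p)(1 := 0)" 0 ?B w h "U (Suc p)"] by (simp add: S_def)
      have "run ?B w c ((S p)(1 := 0, 0 := Suc p)) (S (Suc p))"
        by (rule update) (use step.hyps in \<open>simp_all add: S_def\<close>)
      then obtain h' where h': "h' \<le> length w + 1"
          "exec ?B w c (h, (S p)(1 := 0, 0 := Suc p), U (Suc p)) (h', S (Suc p), U (Suc p))"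
        using step.prems unfolding run_def by blast
      have r: "exec ?B w body (h, S p, U p) (h', S (Suc p), U (Suc p))"
        unfolding body_def by (rule exec_Seq[OF r1 exec_Seq[OF r2 h'(2)]])
      obtain h'' \<sigma>' where "exec ?B w (While 1 body) (h', S (Suc p), U (Suc p)) (h'',
          \<sigma>', map idx (f w))"
        using step.IH[OF h'(1)] by blast
      moreover have "S p 1 \<noteq> 0" using S1 by simp
      ultimately show ?case
        using exec_While_step[OF _ r] by blast
    qed
    have "run ?B w c (\<lambda>_. 0) (S 0)" by (rule update) simp_all
    then obtain h where h: "h \<le> length w + 1" "exec ?B w c (0, \<lambda>_. 0, []) (h, S 0, [])"
      unfolding run_def by blast
    obtain h' \<sigma>' where "exec ?B w (While 1 body) (h, S 0, []) (h', \<sigma>', map idx (f w))"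
      using loop[of 0 h] h(1) by (auto simp: U_def)
    with h(2) have "exec ?B w prog (0, \<lambda>_. 0, []) (h', \<sigma>', map idx (f w))"
      unfolding prog_def by (rule exec_Seq)
    moreover have "map (\<lambda>i. ys ! i) (map idx (f w)) = f w"
      using fY idx by (simp add: map_idI in_lists_conv_set)
    ultimately show "\<exists>h \<sigma> u. exec ?B w prog (0, \<lambda>_. 0, []) (h, \<sigma>, u)
        \<and> map (\<lambda>i. ys ! i) u = f w"
      by blast
  qed
qed

section \<open>Applying a transducer to a word given by its letters\<close>

text \<open>
  A tape with \<open>n\<close> squares is read as a number in base \<open>b\<close>. All digits
      beyond the \<open>n\<close>-th are zero,
  so infinitely many blank squares are represented if the blank is the digit \<open>0\<close>.
\<close>

definition digits :: "nat \<Rightarrow> nat \<Rightarrow> nat \<Rightarrow> (nat \<Rightarrow>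
    nat) \<Rightarrow> bool" where
  "digits b n R f \<longleftrightarrow> R < b ^ n \<and> (\<forall>i. R div b ^ i mod b = f i)"

lemma digits_push:
  assumes "digits b n R f" "d < b" shows "digits b (Suc n) (d + b * R) (case_nat d f)"
  unfolding digits_def
proof (intro conjI allI)
  have "Suc R * b \<le> b ^ n * b" using assms by (intro mult_le_mono1) (simp add: digits_def)
  then show "d + b * R < b ^ Suc n" using assms(2) by (simp add: algebra_simps)
  fix i
  show "(d + b * R) div b ^ i mod b = (case i of 0 \<Rightarrow> d | Suc i \<Rightarrow> f i)"
  proof (cases i)
    case 0
    then show ?thesis using assms(2) by simp
  next
    case (Suc j)
    have "(d + b * R) div b ^ i = (d + b * R) div b div b ^ j"
      unfolding Suc power_Suc by (rule div_mult2_eq)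
    also have "(d + b * R) div b = R" using assms(2) by simp
    finally show ?thesis using assms(1) Suc by (simp add: digits_def)
  qed
qed

lemma digits_pop:
  assumes "digits b (Suc n) R f" "0 < b" shows "digits b n (R div b) (\<lambda>i. f (Suc i))"
  unfolding digits_def
proof (intro conjI allI)
  show "R div b < b ^ n"
    using assms by (simp add: digits_def less_mult_imp_div_less mult.commute)
  fix i
  have "R div b div b ^ i = R div b ^ Suc i" by (simp add: div_mult2_eq)
  moreover have "R div b ^ Suc i mod b = f (Suc i)" using assms(1) unfolding digits_def by blast
  ultimately show "R div b div b ^ i mod b = f (Suc i)" by metis
qed

lemma digits_top: "digits b n R f \<Longrightarrow> R mod b = f 0"
  unfolding digits_def by (metis div_by_1 power_0)

lemma digits_cong: "digits b n R f \<Longrightarrow> (\<And>i. f i = g i) \<Longrightarrow> n = m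
    \<Longrightarrow> digits b m R g"
  unfolding digits_def by simp

lemma digits_zero: "0 < b \<Longrightarrow> digits b n 0 (\<lambda>_. 0)"
  unfolding digits_def by simp

lemma prod_encode_mono:
  assumes "a \<le> a'" "b \<le> b'" shows "prod_encode (a, b) \<le> prod_encode (a', b')"
proof -
  have tri: "triangle n = (\<Sum>i<n. Suc i)" for n by (induction n) simp_all
  have "triangle (a + b) \<le> triangle (a' + b')"
    unfolding tri using assms by (intro sum_mono2) auto
  then show ?thesis using assms(1) by (simp add: prod_encode_def)
qed

text \<open>
  If the values up to the time \<open>n + 1\<close> are all at most \<open>n\<close>, two of them
      agree, say at \<open>i < j\<close>. From
  then on the sequence is periodic, so a first halting time after \<open>j\<close> would have
      occurred \<open>j - i\<close>
  steps earlier.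
\<close>

lemma first_halt_bound:
  fixes x :: "nat \<Rightarrow> nat"
  assumes step: "\<And>t. x (Suc t) = g (x t)" and bound: "\<And>t. x t \<le> n"
    and halt: "P (x t0)"
  shows "\<exists>t \<le> n. P (x t)"
proof -
  define t1 where "t1 = (LEAST t. P (x t))"
  have t1: "P (x t1)" "\<And>t. P (x t) \<Longrightarrow> t1 \<le> t"
    unfolding t1_def using halt LeastI Least_le by metis+
  have "t1 \<le> n"
  proof (rule ccontr)
    assume "\<not> t1 \<le> n"
    have "\<not> inj_on x {..Suc n}"
    proof
      assume "inj_on x {..Suc n}"
      moreover have "x ` {..Suc n} \<subseteq> {..n}" using bound by auto
      ultimately have "card {..Suc n} \<le> card {..n}" by (metis card_inj_on_le finite_atMost)
      then show False by simp
    qed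
    then obtain i j where "i \<le> Suc n" "j \<le> Suc n" "x i = x j" "i \<noteq> j"
      unfolding inj_on_def by auto
    then obtain i j where ij: "i < j" "j \<le> Suc n" "x i = x j"
      by (metis linorder_neqE_nat)
    have shift: "x (i + m) = x (j + m)" for m
      by (induction m) (simp_all add: ij step)
    have "j \<le> t1" using ij \<open>\<not> t1 \<le> n\<close> by simp
    then have "x (i + (t1 - j)) = x t1" using shift[of "t1 - j"] by simp
    then have "t1 \<le> i + (t1 - j)" using t1 by simp
    then show False using ij \<open>j \<le> t1\<close> by simp
  qed
  with t1(1) show ?thesis by blast
qed

lemma log_space_bound:
  assumes "real k \<le> real c * log 2 (real m)" "2 \<le> m"
  shows "2 ^ k \<le> m ^ c"
proof -
  have "(2 :: real) ^ k = 2 powr real k" by (simp add: powr_realpow)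
  also have "\<dots> \<le> 2 powr (real c * log 2 (real m))" using assms(1) by simp
  also have "\<dots> = (2 powr log 2 (real m)) powr real c" by (simp add: powr_powr mult.commute)
  also have "\<dots> = real m ^ c" using assms(2) by (simp add: powr_realpow)
  finally have "real (2 ^ k) \<le> real (m ^ c)" by simp
  then show ?thesis by (simp only: of_nat_le_iff)
qed

text \<open>
  A configuration without its output: state, input head, work head, and the work tape divided into
      the
  part \<open>l\<close> to the left of the head and the part \<open>r\<close> from the head on,
      each read outwards from the head.
  A move of the head then multiplies one part by the base and divides the other.
\<close>

definition conf_code :: "nat \<Rightarrow> nat \<Rightarrow> nat \<Rightarrow> nat \<Rightarrow>
    nat \<Rightarrow> nat" where
  "conf_code q h p l r = prod_encode (q, prod_encode (h, prod_encode (p, prod_encode (l, r))))"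

definition code_state :: "nat \<Rightarrow> nat" where "code_state x = fst (prod_decode x)"
definition code_input :: "nat \<Rightarrow> nat" where
  "code_input x = fst (prod_decode (snd (prod_decode x)))"
definition code_pos :: "nat \<Rightarrow> nat" where
  "code_pos x = fst (prod_decode (snd (prod_decode (snd (prod_decode x)))))"
definition code_left :: "nat \<Rightarrow> nat" where
  "code_left x = fst (prod_decode (snd (prod_decode (snd (prod_decode (snd (prod_decode x)))))))"
definition code_right :: "nat \<Rightarrow> nat" where
  "code_right x = snd (prod_decode (snd (prod_decode (snd (prod_decode (snd (prod_decode x)))))))"

lemmas code_defs = code_state_def code_input_def code_pos_def code_left_def code_right_def

lemma conf_code_simps [simp]:
  "code_state (conf_code q h p l r) = q" "code_input (conf_code q h p l r) = h"
  "code_pos (conf_code q h p l r) = p" "code_left (conf_code q h p l r) = l"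
  "code_right (conf_code q h p l r) = r"
  by (simp_all add: conf_code_def code_defs)

lemma log_fun_code:
  assumes "log_fun X E"
  shows "log_fun X (\<lambda>w s. code_state (E w s))" "log_fun X (\<lambda>w s. code_input (E w
      s))"
    "log_fun X (\<lambda>w s. code_pos (E w s))" "log_fun X (\<lambda>w s. code_left (E w s))"
    "log_fun X (\<lambda>w s. code_right (E w s))"
  unfolding code_defs by (intro log_fun_prod_decode assms)+

lemma log_fun_conf_code:
  assumes "log_fun X E1" "log_fun X E2" "log_fun X E3" "log_fun X E4" "log_fun X E5"
  shows "log_fun X (\<lambda>w s. conf_code (E1 w s) (E2 w s) (E3 w s) (E4 w s) (E5 w s))"
  unfolding conf_code_def by (intro log_fun_prod_encode assms)

lemma conf_code_mono:
  assumes "q \<le> q'" "h \<le> h'" "p \<le> p'" "l \<le> l'" "r \<le> r'"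
  shows "conf_code q h p l r \<le> conf_code q' h' p' l' r'"
  unfolding conf_code_def by (intro prod_encode_mono assms)

lemma log_fin_virtual_input:
  assumes "log_word X V" "log_fun X E" shows "log_fin X (\<lambda>w s. input_at (V w s) (E w s))"
proof -
  have eq: "input_at v i =
      (if i = 0 then Left_End
       else case letter v (i - 1) of Some a \<Rightarrow> Letter a | None \<Rightarrow>
           Right_End)" for v :: "'b list" and i
    by (auto simp: input_at_def letter_def)
  show ?thesis
    unfolding eq
    by (intro log_fin_if log_pred_zero assms(2) log_fin_const log_fin_map[OF log_word_letter[OF
        assms(1) log_fun_pred[OF assms(2)]]])
qed

lemma input_at_in:
  assumes "v \<in> lists Y" shows "input_at v i \<in> {Left_End, Right_End} \<union> Letter ` Y"
proof (cases "i = 0 \<or> length v < i")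
  case False
  then have "v ! (i - 1) \<in> set v" by (intro nth_mem) auto
  then show ?thesis using assms False by (auto simp: input_at_def)
qed (auto simp: input_at_def)

context
  fixes M :: "('b, 'c) transducer" and k qm :: nat
begin

text \<open>
  The work symbols themselves serve as digits, except that the blank and the symbol
      \<open>0\<close> are
  exchanged.
\<close>

definition digit :: "nat \<Rightarrow> nat" where
  "digit x = (if x = blank_symbol M then 0 else if x = 0 then blank_symbol M else x)"

text \<open>
  The minimum with \<open>qm\<close> keeps the argument of the transition table in a finite set
      also for numbers
  that are not codes of configurations.
\<close>

definition action :: "'b list \<Rightarrow> nat \<Rightarrow> (nat \<times> nat \<times> move
    \<times> move \<times> 'c list) option" where
  "action v x = transition M (min (code_state x) qm) (input_at v (code_input x))
     (digit (code_right x mod Suc k))"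

definition target :: "'b list \<Rightarrow> nat \<Rightarrow> nat \<times> nat \<times> move
    \<times> move \<times> 'c list" where
  "target v x = (case action v x of None \<Rightarrow> (0, 0, Stay, Stay, []) | Some t
      \<Rightarrow> t)"

definition emitted :: "'b list \<Rightarrow> nat \<Rightarrow> 'c list" where
  "emitted v x = (case target v x of (q, a, d, e, u) \<Rightarrow> u)"

definition code_step :: "'b list \<Rightarrow> nat \<Rightarrow> nat" where
  "code_step v x =
     (if action v x = None then x else
        let a = (case target v x of (q, a, d, e, u) \<Rightarrow> digit a);
            d = (case target v x of (q, a, d, e, u) \<Rightarrow> d);
            e = (case target v x of (q, a, d, e, u) \<Rightarrow> e);
            p = code_pos x; l = code_left x; r = a + Suc k * (code_right x div Suc k)
        in conf_code (case target v x of (q, a, d, e, u) \<Rightarrow> q)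
             (min (if e = Move_Left then code_input x - 1 else
                   if e = Move_Right then code_input x + 1 else code_input x) (length v + 1))
             (if d = Move_Left then p - 1 else if d = Move_Right then p + 1 else p)
             (if d = Move_Left then l div Suc k else if d = Move_Right then a + Suc k * l else l)
             (if d = Move_Left then (if p = 0 then r else l mod Suc k + Suc k * r)
              else if d = Move_Right then code_right x div Suc k else r))"

lemma log_fin_action:
  assumes "log_word X V" "log_fun X E" shows "log_fin X (\<lambda>w s. action (V w s) (E w s))"
proof -
  have "log_fin X (\<lambda>w s. (min (code_state (E w s)) qm, input_at (V w s) (code_input (E w
      s)),
      code_right (E w s) mod Suc k))"
    by (intro log_fin_pair log_fin_min log_fun_code log_fin_virtual_input assms log_fin_less[where
        k = "Suc k"] log_fun_mod) simp
  from log_fin_map[OF this, of "\<lambda>(q, a, x). transition M q a (digit x)"] show ?thesis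
    by (simp add: action_def)
qed

lemma log_fin_target:
  assumes "log_word X V" "log_fun X E" shows "log_fin X (\<lambda>w s. target (V w s) (E w s))"
  unfolding target_def by (rule log_fin_map[OF log_fin_action[OF assms]])

lemma log_fun_code_step:
  assumes "log_word X V" "log_fun X E" shows "log_fun X (\<lambda>w s. code_step (V w s) (E w s))"
proof -
  note T = log_fin_target[OF assms]
  have a: "log_fun X (\<lambda>w s. case target (V w s) (E w s) of (q, a, d, e, u) \<Rightarrow>
      digit a)"
    by (rule log_fin_lc[OF T])
  have q: "log_fun X (\<lambda>w s. case target (V w s) (E w s) of (q, a, d, e, u) \<Rightarrow> q)"
    by (rule log_fin_lc[OF T])
  have d: "log_pred X (\<lambda>w s. (case target (V w s) (E w s) of (q, a, d, e, u) \<Rightarrow>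
      d) = z)" for z
    by (rule log_fin_lcb[OF T])
  have e: "log_pred X (\<lambda>w s. (case target (V w s) (E w s) of (q, a, d, e, u) \<Rightarrow>
      e) = z)" for z
    by (rule log_fin_lcb[OF T])
  have p: "log_pred X (\<lambda>w s. code_pos (E w s) = 0)"
    by (intro log_pred_zero log_fun_code assms(2))
  have n: "log_pred X (\<lambda>w s. action (V w s) (E w s) = None)"
    by (rule log_finD[OF log_fin_action[OF assms]])
  show ?thesis
    unfolding code_step_def Let_def
    by (intro log_fun_if n log_fun_conf_code q d e p a log_fun_min log_fun_add log_fun_mult
        log_fun_mod log_fun_div log_fun_diff log_fun_code log_fun_const
        assms log_word_length)
qed

text \<open>
  The number \<open>n\<close> bounds the squares of the work tape that are ever visited; the
      square \<open>0\<close> is the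
  outermost digit of the left part, beyond which the digits are zero.
\<close>

definition codes :: "nat \<Rightarrow> 'c config \<Rightarrow> nat \<Rightarrow> bool" where
  "codes n c x \<longleftrightarrow>
     (\<exists>l r. x = conf_code (state c) (input_pos c) (work_pos c) l r \<and>
       digits (Suc k) (work_pos c) l
         (\<lambda>i. if i < work_pos c then digit (work_tape c (work_pos c - 1 - i)) else 0) \<and>
       digits (Suc k) (n - work_pos c) r (\<lambda>i. digit (work_tape c (work_pos c + i))))"

definition valid :: "'b list \<Rightarrow> 'c config \<Rightarrow> bool" where
  "valid v c \<longleftrightarrow> state c \<in> states M \<and> (\<forall>j. work_tape c j \<in>
      work_symbols M) \<and>
     input_pos c \<le> length v + 1"

definition next_config :: "'b list \<Rightarrow> 'c config \<Rightarrow> 'c config" where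
  "next_config v c = (case step M v c of None \<Rightarrow> c | Some c' \<Rightarrow> c')"

definition config_at :: "'b list \<Rightarrow> nat \<Rightarrow> 'c config" where
  "config_at v t = (next_config v ^^ t) (initial_config M)"

definition code_at :: "'b list \<Rightarrow> nat \<Rightarrow> nat" where
  "code_at v t = (code_step v ^^ t) (conf_code (start_state M) 0 0 0 0)"

context
  fixes Y :: "'b set" and Z :: "'c set"
  assumes wf: "wf_transducer Y Z M"
    and qm: "\<And>q. q \<in> states M \<Longrightarrow> q \<le> qm"
    and sm: "\<And>a. a \<in> work_symbols M \<Longrightarrow> a \<le> k"
begin

lemma digit_less: "a \<in> work_symbols M \<Longrightarrow> digit a < Suc k"
  using sm wf unfolding digit_def wf_transducer_def by (simp add: less_Suc_eq_le)

lemma digit_digit: "digit (digit a) = a"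
  by (simp add: digit_def)

lemma action_codes:
  assumes "codes n c x" "valid v c"
  shows "action v x = transition M (state c) (input_at v (input_pos c)) (work_tape c (work_pos c))"
proof -
  obtain l r where x: "x = conf_code (state c) (input_pos c) (work_pos c) l r"
      "digits (Suc k) (n - work_pos c) r (\<lambda>i. digit (work_tape c (work_pos c + i)))"
    using assms(1) unfolding codes_def by blast
  have "r mod Suc k = digit (work_tape c (work_pos c))"
    using digits_top[OF x(2)] by simp
  then show ?thesis
    using assms(2) qm by (simp add: action_def x(1) digit_digit valid_def min_absorb1)
qed

lemma valid_step:
  assumes "valid v c" "v \<in> lists Y" "step M v c = Some c'"
  shows "valid v c'"
proof -
  have "input_at v (input_pos c) \<in> {Left_End, Right_End} \<union> Letter ` Y"
    using input_at_in[OF assms(2)] .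
  moreover obtain q s d e u where t:
      "transition M (state c) (input_at v (input_pos c)) (work_tape c (work_pos c)) = Some (q, s,
          d, e, u)"
      "state c' = q" "work_tape c' = (work_tape c)(work_pos c := s)"
      "input_pos c' = min (move_head e (input_pos c)) (length v + 1)"
    using assms(3) by (auto simp: step_def split: option.splits)
  ultimately have "q \<in> states M" "s \<in> work_symbols M"
    using wf assms(1) unfolding wf_transducer_def valid_def by blast+
  then show ?thesis using assms(1) t(2-) by (simp add: valid_def)
qed

lemma codesI:
  assumes "state c = q" "input_pos c = h" "work_pos c = p" "work_tape c = T"
    and "digits (Suc k) p l (\<lambda>i. if i < p then digit (T (p - 1 - i)) else 0)"
    and "digits (Suc k) (n - p) r (\<lambda>i. digit (T (p + i)))"
  shows "codes n c (conf_code q h p l r)"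
  unfolding codes_def assms(1-4)
  by (rule exI[of _ l], rule exI[of _ r]) (intro conjI refl assms(5,6))

lemma code_step_halted:
  assumes "codes n c x" "valid v c" "step M v c = None"
  shows "action v x = None" "code_step v x = x" "emitted v x = []"
proof -
  show a: "action v x = None"
    using assms(3) unfolding action_codes[OF assms(1,2)] by (simp add: step_def split:
        option.splits prod.splits)
  then show "code_step v x = x" "emitted v x = []"
    by (simp_all add: code_step_def emitted_def target_def)
qed

lemma code_step_codes:
  assumes x: "codes n c x" and valid: "valid v c" and v: "v \<in> lists Y"
    and step: "step M v c = Some c'" and n: "work_pos c < n"
  shows "codes n c' (code_step v x) \<and> written c' = written c @ emitted v x"
proof -
  obtain h p T where c: "input_pos c = h" "work_pos c = p" "work_tape c = T" by simp
  obtain q s d e u where act: "action v x = Some (q, s, d, e, u)"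
      and c': "c' = \<lparr>state = q, input_pos = min (move_head e h) (length v + 1),
        work_tape = T(p := s), work_pos = move_head d p, written = written c @ u\<rparr>"
    using step unfolding step_def action_codes[OF x valid] by (auto simp: c split: option.splits)
  obtain l r where xlr: "x = conf_code (state c) h p l r"
      and L: "digits (Suc k) p l (\<lambda>i. if i < p then digit (T (p - 1 - i)) else 0)"
      and R: "digits (Suc k) (n - p) r (\<lambda>i. digit (T (p + i)))"
    using x unfolding codes_def c by blast
  have T: "T j \<in> work_symbols M" for j using valid by (simp add: valid_def c)
  have s: "s \<in> work_symbols M"
    using valid_step[OF valid v step] unfolding valid_def c' by (auto dest: spec[of _ p])
  obtain n' where n': "n - p = Suc n'" using n c by (cases "n - p") auto
  let ?T = "T(p := s)"
  let ?a = "digit s"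
  define r' where "r' = ?a + Suc k * (r div Suc k)"
  have pop: "digits (Suc k) n' (r div Suc k) (\<lambda>i. digit (T (p + Suc i)))"
    using digits_pop[OF R[unfolded n']] by simp
  have R': "digits (Suc k) (n - p) r' (\<lambda>i. digit (?T (p + i)))"
    unfolding r'_def
    by (rule digits_cong[OF digits_push[OF pop digit_less[OF s]]]) (auto simp: n' split: nat.split)
  have emit: "emitted v x = u" by (simp add: emitted_def target_def act)
  have target: "target v x = (q, s, d, e, u)" by (simp add: target_def act)
  have head: "min (if e = Move_Left then h - 1 else if e = Move_Right then h + 1 else h) (length v
      + 1)
      = min (move_head e h) (length v + 1)"
    by (cases e) simp_all
  have f: "code_input x = h" "code_pos x = p" "code_left x = l" "code_right x = r"
    by (simp_all add: xlr)
  have code: "code_step v x = conf_code q (min (move_head e h) (length v + 1))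
      (if d = Move_Left then p - 1 else if d = Move_Right then p + 1 else p)
      (if d = Move_Left then l div Suc k else if d = Move_Right then ?a + Suc k * l else l)
      (if d = Move_Left then (if p = 0 then r' else l mod Suc k + Suc k * r')
       else if d = Move_Right then r div Suc k else r')"
    unfolding code_step_def Let_def target act f prod.case head r'_def
    by (simp only: option.distinct(2) if_False)
  have "codes n c' (code_step v x)"
  proof (cases d)
    case Stay
    have L': "digits (Suc k) p l (\<lambda>i. if i < p then digit (?T (p - 1 - i)) else 0)"
      by (rule digits_cong[OF L]) auto
    have "code_step v x = conf_code q (min (move_head e h) (length v + 1)) p l r'"
      using code Stay by simp
    then show ?thesis by (simp only:) (rule codesI[OF _ _ _ _ L' R']; simp add: c' Stay del:
        fun_upd_apply)
  next
    case Move_Right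
    have L': "digits (Suc k) (Suc p) (?a + Suc k * l)
        (\<lambda>i. if i < Suc p then digit (?T (Suc p - 1 - i)) else 0)"
      by (rule digits_cong[OF digits_push[OF L digit_less[OF s]]]) (auto split: nat.split)
    have R'': "digits (Suc k) (n - Suc p) (r div Suc k) (\<lambda>i. digit (?T (Suc p + i)))"
      by (rule digits_cong[OF pop]) (use n' in auto)
    have "code_step v x = conf_code q (min (move_head e h) (length v + 1)) (Suc p) (?a + Suc k * l)
        (r div Suc k)"
      using code Move_Right by simp
    then show ?thesis by (simp only:) (rule codesI[OF _ _ _ _ L' R'']; simp add: c' Move_Right
        del: fun_upd_apply)
  next
    case Move_Left
    show ?thesis
    proof (cases p)
      case 0
      have "l = 0" using L by (simp add: digits_def 0)
      have L': "digits (Suc k) p l (\<lambda>i. if i < p then digit (?T (p - 1 - i)) else 0)"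
        using digits_zero[of "Suc k" 0] by (simp add: 0 \<open>l = 0\<close>)
      have "code_step v x = conf_code q (min (move_head e h) (length v + 1)) p l r'"
        using code Move_Left 0 \<open>l = 0\<close> by simp
      then show ?thesis by (simp only:) (rule codesI[OF _ _ _ _ L' R']; simp add: c' Move_Left 0
          del: fun_upd_apply)
    next
      case (Suc p')
      have L': "digits (Suc k) p' (l div Suc k) (\<lambda>i. if i < p' then digit (?T (p' - 1 -
          i)) else 0)"
        by (rule digits_cong[OF digits_pop[OF L[unfolded Suc]]]) (auto simp: Suc)
      have top: "l mod Suc k = digit (T p')"
        using digits_top[OF L] Suc by simp
      have R'': "digits (Suc k) (n - p') (l mod Suc k + Suc k * r') (\<lambda>i. digit (?T (p' +
          i)))"
        unfolding top
        by (rule digits_cong[OF digits_push[OF R' digit_less[OF T[of p']]]])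
          (use Suc n' in \<open>auto split: nat.split\<close>)
      have "code_step v x = conf_code q (min (move_head e h) (length v + 1)) p' (l div Suc k)
          (l mod Suc k + Suc k * r')"
        using code Move_Left Suc by simp
      then show ?thesis by (simp only:) (rule codesI[OF _ _ _ _ L' R'']; simp add: c' Move_Left
          Suc del: fun_upd_apply)
    qed
  qed
  then show ?thesis by (simp add: emit c')
qed

lemma config_at_Suc: "config_at v (Suc t) = next_config v (config_at v t)"
  by (simp add: config_at_def)

lemma code_at_Suc: "code_at v (Suc t) = code_step v (code_at v t)"
  by (simp add: code_at_def)

lemma reachable_config_at: "reachable M v (config_at v t)"
proof (induction t)
  case 0
  show ?case by (simp add: reachable_def config_at_def)
next
  case (Suc t)
  show ?case
  proof (cases "step M v (config_at v t)")
    case None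
    then show ?thesis using Suc by (simp add: config_at_Suc next_config_def)
  next
    case (Some c')
    then have "(initial_config M, c') \<in> {(c, c'). step M v c = Some c'}\<^sup>*"
      using rtrancl_into_rtrancl[OF Suc[unfolded reachable_def], of c'] by simp
    then show ?thesis using Some by (simp add: config_at_Suc next_config_def reachable_def)
  qed
qed

lemma reachable_imp_config_at:
  assumes "reachable M v c" shows "\<exists>t. c = config_at v t"
  using assms unfolding reachable_def
proof (induction rule: rtrancl_induct)
  case base
  have "initial_config M = config_at v 0" by (simp add: config_at_def)
  then show ?case ..
next
  case (step c c')
  from step.IH obtain t where "c = config_at v t" ..
  then have "c' = config_at v (Suc t)"
    using step.hyps(2) by (simp add: config_at_Suc next_config_def)
  then show ?case ..
qed

lemma config_at_halted:
  assumes "step M v (config_at v t) = None" "t \<le> t'" shows "config_at v t' = config_at v t"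
  using assms(2)
proof (induction rule: dec_induct)
  case (step j)
  then show ?case using assms(1) by (simp add: config_at_Suc next_config_def)
qed simp

lemma simulation:
  assumes v: "v \<in> lists Y" and n: "\<And>c. reachable M v c \<Longrightarrow> work_pos c < n"
  shows "codes n (config_at v t) (code_at v t) \<and> valid v (config_at v t) \<and>
    written (config_at v t) = concat (map (\<lambda>i. emitted v (code_at v i)) [0..<t])"
proof (induction t)
  case 0
  have M: "start_state M \<in> states M" "blank_symbol M \<in> work_symbols M"
    using wf by (simp_all add: wf_transducer_def)
  have "digits (Suc k) m 0 (\<lambda>i. digit (blank_symbol M))" for m
    using digits_zero[of "Suc k" m] by (simp add: digit_def)
  then have "codes n (initial_config M) (conf_code (start_state M) 0 0 0 0)"
    using digits_zero[of "Suc k" 0] by (intro codesI) (simp_all add: initial_config_def)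
  then show ?case using M by (simp add: config_at_def code_at_def valid_def initial_config_def)
next
  case (Suc t)
  show ?case
  proof (cases "step M v (config_at v t)")
    case None
    note halted = code_step_halted[OF conjunct1[OF Suc] conjunct1[OF conjunct2[OF Suc]] None]
    then show ?thesis
      using Suc None by (simp add: config_at_Suc code_at_Suc next_config_def)
  next
    case (Some c')
    note codes = conjunct1[OF Suc] and valid = conjunct1[OF conjunct2[OF Suc]]
    have "work_pos (config_at v t) < n" by (rule n[OF reachable_config_at])
    note code_step_codes[OF codes valid v Some this] valid_step[OF valid v Some]
    then show ?thesis
      using Suc Some by (simp add: config_at_Suc code_at_Suc next_config_def)
  qed
qed

lemma codes_bound:
  assumes "codes n c x" "valid v c" "work_pos c < n"
  shows "x \<le> conf_code qm (length v + 1) n (Suc k ^ n) (Suc k ^ n)"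
proof -
  obtain l r where x: "x = conf_code (state c) (input_pos c) (work_pos c) l r"
    and "l < Suc k ^ work_pos c" "r < Suc k ^ (n - work_pos c)"
    using assms(1) unfolding codes_def digits_def by blast
  moreover have "Suc k ^ work_pos c \<le> Suc k ^ n" "Suc k ^ (n - work_pos c) \<le> Suc k ^ n"
    using assms(3) by (auto intro: power_increasing)
  ultimately show ?thesis
    unfolding x using assms(2,3) qm unfolding valid_def by (intro conf_code_mono) simp_all
qed

text \<open>
  The bound \<open>N\<close> on the codes is also a bound on the number of steps, by
      \<open>first_halt_bound\<close>. It is a
  polynomial in the length of \<open>v\<close>, since tapes of logarithmic length have
      polynomially many contents.
\<close>

lemma output_by_codes:
  assumes v: "v \<in> lists Y" and space: "in_logspace_on M c v" and out: "outputs_on M v u"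
    and N: "N = conf_code qm (length v + 1) ((length v + 2) ^ c) ((length v + 2) ^ (c * k))
       ((length v + 2) ^ (c * k))"
  shows "code_at v t \<le> N" "concat (map (\<lambda>i. emitted v (code_at v i)) [0..<N]) = u"
proof -
  let ?m = "max 2 (length v)"
  define n where "n = nat \<lfloor>real c * log 2 (real ?m)\<rfloor>"
  have reach: "work_pos cf < n" if "reachable M v cf" for cf
  proof -
    have "real (work_pos cf + 1) \<le> real c * log 2 (real ?m)"
      using space that unfolding in_logspace_on_def by blast
    then have "work_pos cf + 1 \<le> n" unfolding n_def by (rule le_nat_floor)
    then show ?thesis by simp
  qed
  have "real n \<le> real c * log 2 (real ?m)" unfolding n_def by (intro of_nat_floor) simp
  then have "2 ^ n \<le> ?m ^ c" by (rule log_space_bound) simp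
  also have "\<dots> \<le> (length v + 2) ^ c" by (rule power_mono) simp_all
  finally have n: "2 ^ n \<le> (length v + 2) ^ c" .
  have n1: "n \<le> (length v + 2) ^ c"
    using less_imp_le[OF less_exp[of n]] n by (rule order_trans)
  have "Suc k \<le> 2 ^ k" using less_exp[of k] by (simp add: Suc_le_eq)
  then have "Suc k ^ n \<le> (2 ^ k) ^ n" by (rule power_mono) simp
  also have "\<dots> = (2 ^ n) ^ k" by (simp only: power_mult[symmetric] mult.commute)
  also have "\<dots> \<le> ((length v + 2) ^ c) ^ k" by (rule power_mono[OF n]) simp
  finally have n2: "Suc k ^ n \<le> (length v + 2) ^ (c * k)" by (simp only: power_mult)
  note sim = simulation[OF v reach]
  have bound: "code_at v t \<le> N" for t
  proof -
    have "code_at v t \<le> conf_code qm (length v + 1) n (Suc k ^ n) (Suc k ^ n)"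
      using codes_bound sim reach[OF reachable_config_at] by blast
    also have "\<dots> \<le> N" unfolding N by (intro conf_code_mono n1 n2 order_refl)
    finally show ?thesis .
  qed
  then show "code_at v t \<le> N" .
  obtain t0 where t0: "step M v (config_at v t0) = None" "written (config_at v t0) = u"
    using out reachable_imp_config_at unfolding outputs_on_def by blast
  have halted: "action v (code_at v t) = None \<longleftrightarrow> step M v (config_at v t) =
      None" for t
  proof -
    have "action v (code_at v t) = transition M (state (config_at v t))
        (input_at v (input_pos (config_at v t))) (work_tape (config_at v t) (work_pos (config_at v
            t)))"
      by (rule action_codes) (use sim in blast)+
    then show ?thesis by (simp add: step_def split: option.splits prod.splits)
  qed
  obtain t where t: "t \<le> N" "step M v (config_at v t) = None"
    using first_halt_bound[of "code_at v" "code_step v" N "\<lambda>x. action v x = None" t0]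
      code_at_Suc bound t0(1) unfolding halted by blast
  have "config_at v N = config_at v t" by (rule config_at_halted[OF t(2,1)])
  also have "\<dots> = config_at v t0"
    using config_at_halted[OF t(2), of t0] config_at_halted[OF t0(1), of t] by (metis nat_le_linear)
  finally show "concat (map (\<lambda>i. emitted v (code_at v i)) [0..<N]) = u"
    using sim[of N] t0(2) by simp
qed

end

end

lemma log_word_cong:
  assumes "log_word X V" "\<And>w s. w \<in> lists X \<Longrightarrow> V w s = V' w s"
  shows "log_word X V'"
  unfolding log_word_def
proof
  show "log_fun X (\<lambda>w s. length (V' w s))"
    by (rule log_fun_cong[OF log_word_length[OF assms(1)]]) (simp add: assms(2))
  show "log_fin X (\<lambda>w s. letter (V' w (\<lambda>i. s (Suc i))) (s 0))"
    by (rule log_fin_cong[OF conjunct2[OF assms(1)[unfolded log_word_def]]]) (simp add: assms(2))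
qed

text \<open>
  The function \<open>f\<close> is applied without writing its argument down: the code at time
      \<open>t\<close> is obtained by
  recursion, and the result is the concatenation of the words emitted at all times below the bound.
\<close>

theorem log_word_apply:
  assumes f: "logspace_computable Y Z f" and V: "log_word X V"
    and VY: "\<And>w s. w \<in> lists X \<Longrightarrow> V w s \<in> lists Y"
  shows "log_word X (\<lambda>w s. f (V w s))"
proof -
  obtain M c where wf: "wf_transducer Y Z M"
    and M: "\<And>v. v \<in> lists Y \<Longrightarrow> in_logspace_on M c v \<and> outputs_on M v
        (f v)"
    using f unfolding logspace_computable_def by blast
  \<comment> \<open>every state is at most \<open>qm\<close>, and every work symbol is a digit in
      base \<open>Suc k\<close>\<close>
  define qm where "qm = Max (states M)"
  define k where "k = Max (work_symbols M)"
  have qm: "q \<le> qm" if "q \<in> states M" for q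
    using that wf unfolding qm_def wf_transducer_def by simp
  have k: "a \<le> k" if "a \<in> work_symbols M" for a
    using that wf unfolding k_def wf_transducer_def by simp
  define N where "N = (\<lambda>v :: 'a list. conf_code qm (length v + 1) ((length v + 2) ^ c)
     ((length v + 2) ^ (c * k)) ((length v + 2) ^ (c * k)))"
  note out = output_by_codes[OF wf qm k _ conjunct1[OF M] conjunct2[OF M], OF _ _ _ _ _ N_def[THEN
      fun_cong]]
  have N: "log_fun X (\<lambda>w s. N (U w s))" if "log_word X U" for U :: "'c list \<Rightarrow>
      (nat \<Rightarrow> nat) \<Rightarrow> 'a list"
    unfolding N_def by (intro log_fun_conf_code log_fun_const log_fun_power log_fun_add
        log_word_length that)
  have code_rec: "code_at M k qm v t =
      rec_nat (conf_code (start_state M) 0 0 0 0) (\<lambda>t r. code_step M k qm v r) t" for v t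
    by (induction t) (simp_all add: code_at_def)
  have V1: "log_word X (\<lambda>w s. V w (\<lambda>i. s (Suc i)))" by (rule log_word_weaken[OF V])
  have "log_fun X (\<lambda>w s. code_at M k qm (V w (\<lambda>i. s (Suc i))) (s 0))"
    unfolding code_rec
  proof (rule log_fun_rec[where N = "\<lambda>w s. s 0" and H = "\<lambda>w t r s. code_step M k
      qm (V w (\<lambda>i. s (Suc i))) r",
        OF log_fun_var log_fun_const])
    show "log_fun X (\<lambda>w s. code_step M k qm (V w (\<lambda>i. s (Suc (Suc (Suc i))))) (s
        (Suc 0)))"
      by (rule log_fun_code_step[OF log_word_weaken[OF V] log_fun_var])
    show "poly_bounded X (\<lambda>w s. N (V w (\<lambda>i. s (Suc i))))"
      by (rule log_fun_poly_bounded[OF N[OF V1]])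
    show "rec_nat (conf_code (start_state M) 0 0 0 0) (\<lambda>t r. code_step M k qm (V w
        (\<lambda>i. s (Suc i))) r) t
        \<le> N (V w (\<lambda>i. s (Suc i)))" if "w \<in> lists X" for w and s :: "nat
            \<Rightarrow> nat" and t
      unfolding code_rec[symmetric] by (rule out(1)) (simp_all add: VY[OF that])
  qed
  then have "log_fin X (\<lambda>w s. target M k qm (V w (\<lambda>i. s (Suc i))) (code_at M k qm
      (V w (\<lambda>i. s (Suc i))) (s 0)))"
    by (rule log_fin_target[OF V1])
  then have "log_word X (\<lambda>w s. emitted M k qm (V w (\<lambda>i. s (Suc i))) (code_at M k
      qm (V w (\<lambda>i. s (Suc i))) (s 0)))"
    unfolding emitted_def by (rule log_word_finite[OF log_fin_map])
  then have "log_word X (\<lambda>w s. concat (map (\<lambda>i. emitted M k qm (V w s) (code_at M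
      k qm (V w s) i)) [0..<N (V w s)]))"
    by (rule log_word_concat[where V = "\<lambda>w i s. emitted M k qm (V w s) (code_at M k qm (V
        w s) i)", OF _ N[OF V]])
  then show ?thesis
    by (rule log_word_cong) (rule out(2); simp add: VY)
qed

section \<open>Words in groups and normal forms\<close>

lemma word_eval_Nil [simp]: "word_eval G [] = \<one>\<^bsub>G\<^esub>"
  by (simp add: word_eval_def)

lemma word_eval_Cons [simp]: "word_eval G (a # w) = a \<otimes>\<^bsub>G\<^esub> word_eval G w"
  by (simp add: word_eval_def)

lemma (in group) word_eval_closed: "w \<in> lists (carrier G) \<Longrightarrow> word_eval G w
    \<in> carrier G"
  by (induction w) auto

lemma (in group) word_eval_append:
  "u \<in> lists (carrier G) \<Longrightarrow> v \<in> lists (carrier G) \<Longrightarrow>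
     word_eval G (u @ v) = word_eval G u \<otimes> word_eval G v"
  by (induction u) (auto simp: word_eval_closed m_assoc)

lemma (in group) word_eval_inverse_word:
  "v \<in> lists (carrier G) \<Longrightarrow> word_eval G (inverse_word G v) = inv (word_eval G v)"
proof (induction v)
  case (Cons a v)
  then have "map (m_inv G) (rev v) \<in> lists (carrier G)" by (auto simp: in_lists_conv_set)
  then show ?case
    using Cons by (simp add: inverse_word_def word_eval_append word_eval_closed inv_mult_group)
qed (simp add: inverse_word_def)

lemma (in group) word_eval_in_generate:
  "w \<in> lists X \<Longrightarrow> word_eval G w \<in> generate G X"
  by (induction w) (auto intro: generate.one generate.incl generate.eng)

lemma normal_form_functionD:
  assumes "normal_form_function G X f"
  shows "w \<in> lists X \<Longrightarrow> f w \<in> lists X"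
    and "w \<in> lists X \<Longrightarrow> word_eval G (f w) = word_eval G w"
    and "w \<in> lists X \<Longrightarrow> w' \<in> lists X \<Longrightarrow> f w = f w'
        \<longleftrightarrow> word_eval G w = word_eval G w'"
    and "g \<in> carrier G \<Longrightarrow> \<exists>w \<in> lists X. word_eval G w = g"
proof -
  obtain L where L: "L \<subseteq> lists X" "bij_betw (word_eval G) L (carrier G)"
    and f: "\<And>w. w \<in> lists X \<Longrightarrow> f w \<in> L \<and> word_eval G (f w) =
        word_eval G w"
    using assms unfolding normal_form_function_def normal_form_def by blast
  show "f w \<in> lists X" if "w \<in> lists X" using f[OF that] L(1) by blast
  show "word_eval G (f w) = word_eval G w" if "w \<in> lists X" using f[OF that] by simp
  show "f w = f w' \<longleftrightarrow> word_eval G w = word_eval G w'" if "w \<in> lists X" "w'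
      \<in> lists X"
    using inj_on_eq_iff[OF bij_betw_imp_inj_on[OF L(2)], of "f w" "f w'"] f[OF that(1)] f[OF
        that(2)]
    by simp
  show "\<exists>w \<in> lists X. word_eval G w = g" if "g \<in> carrier G"
  proof -
    have "g \<in> word_eval G ` L" using that L(2) by (simp add: bij_betw_def)
    then show ?thesis using L(1) by blast
  qed
qed

text \<open>
  The set of values of a function that depends only on the element and represents it is a normal
  form.
\<close>

lemma normal_form_functionI:
  assumes "\<And>w. w \<in> lists X \<Longrightarrow> f w \<in> lists X"
    and "\<And>w. w \<in> lists X \<Longrightarrow> word_eval G (f w) = word_eval G w"
    and "\<And>w w'. w \<in> lists X \<Longrightarrow> w' \<in> lists X \<Longrightarrow>
        word_eval G w = word_eval G w' \<Longrightarrow> f w = f w'"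
    and "word_eval G ` lists X = carrier G"
  shows "normal_form_function G X f"
  unfolding normal_form_function_def normal_form_def
proof (intro exI[of _ "f ` lists X"] conjI ballI)
  show "bij_betw (word_eval G) (f ` lists X) (carrier G)"
    unfolding bij_betw_def
  proof (rule conjI)
    show "inj_on (word_eval G) (f ` lists X)"
    proof (rule inj_onI)
      fix u v assume "u \<in> f ` lists X" "v \<in> f ` lists X" and eq: "word_eval G u =
          word_eval G v"
      then obtain w w' where w: "w \<in> lists X" "w' \<in> lists X" "u = f w" "v = f w'" by blast
      then have "word_eval G w = word_eval G w'" using eq assms(2) by simp
      then show "u = v" unfolding w(3,4) by (rule assms(3)[OF w(1,2)])
    qed
    have "word_eval G ` f ` lists X = word_eval G ` lists X"
      unfolding image_image using assms(2) by (rule image_cong[OF refl])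
    then show "word_eval G ` f ` lists X = carrier G" using assms(4) by simp
  qed
  show "f ` lists X \<subseteq> lists X" using assms(1) by (rule image_subsetI)
  show "f w \<in> f ` lists X" if "w \<in> lists X" for w using that by (rule imageI)
  show "word_eval G (f w) = word_eval G w" if "w \<in> lists X" for w using that by (rule assms(2))
qed

lemma normal_form_word_eq:
  assumes "normal_form_function G X f" "u \<in> lists X"
  shows "normal_form_word G X f (word_eval G u) = f u"
  unfolding normal_form_word_def
proof (rule the_equality)
  show "f u \<in> f ` lists X \<and> word_eval G (f u) = word_eval G u"
    using assms(2) normal_form_functionD(2)[OF assms] by simp
  fix v assume "v \<in> f ` lists X \<and> word_eval G v = word_eval G u"
  then obtain w where w: "w \<in> lists X" "v = f w" "word_eval G (f w) = word_eval G u" by blast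
  then have "word_eval G w = word_eval G u"
    using normal_form_functionD(2)[OF assms(1) w(1)] by simp
  then show "v = f u" using normal_form_functionD(3)[OF assms(1) w(1) assms(2)] w(2) by simp
qed

section \<open>Ranks in strict linear orders\<close>

text \<open>
  The place of an entry in a sorted list is the number of smaller entries. This turns the
      enumeration
  of a sorted list into counting.
\<close>

lemma sorted_wrt_rank:
  assumes "sorted_wrt (\<lambda>x y. (x, y) \<in> R) xs" "trans R" "irrefl R" "t < length xs"
  shows "card {x \<in> set xs. (x, xs ! t) \<in> R} = t"
proof -
  have lt: "(xs ! i, xs ! j) \<in> R" if "i < j" "j < length xs" for i j
    using assms(1) that by (simp add: sorted_wrt_iff_nth_less)
  have no: "(xs ! i, xs ! t) \<notin> R" if "t \<le> i" "i < length xs" for i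
    using lt[of t i] that assms(2-4) by (cases "i = t") (auto dest: transD simp: irrefl_def)
  have "{x \<in> set xs. (x, xs ! t) \<in> R} = (!) xs ` {..<t}"
  proof (intro equalityI subsetI)
    fix x assume "x \<in> {x \<in> set xs. (x, xs ! t) \<in> R}"
    then obtain i where "i < length xs" "x = xs ! i" "(xs ! i, xs ! t) \<in> R"
      by (auto simp: in_set_conv_nth)
    moreover from this no[of i] have "i < t" by (meson not_le)
    ultimately show "x \<in> (!) xs ` {..<t}" by simp
  next
    fix x assume "x \<in> (!) xs ` {..<t}"
    then obtain i where "i < t" "x = xs ! i" by auto
    then show "x \<in> {x \<in> set xs. (x, xs ! t) \<in> R}"
      using lt[of i t] assms(4) by simp
  qed
  moreover have "inj_on ((!) xs) {..<t}"
  proof (rule inj_onI, rule ccontr)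
    fix i j assume ij: "i \<in> {..<t}" "j \<in> {..<t}" "xs ! i = xs ! j" "i \<noteq> j"
    then consider "i < j" | "j < i" by linarith
    then show False
      using lt[of i j] lt[of j i] ij assms(3,4) by cases (auto simp: irrefl_def)
  qed
  ultimately show ?thesis by (simp add: card_image)
qed

lemma sorted_wrt_exists:
  assumes "trans R" "total_on S R" "finite S"
  shows "\<exists>xs. sorted_wrt (\<lambda>x y. (x, y) \<in> R) xs \<and> set xs = S"
  using assms(3,2)
proof (induction rule: finite_induct)
  case (insert x S)
  then have "total_on S R" by (auto simp: total_on_def)
  then obtain xs where xs: "sorted_wrt (\<lambda>x y. (x, y) \<in> R) xs" "set xs = S"
    using insert.IH by blast
  let ?ys = "filter (\<lambda>y. (y, x) \<in> R) xs @ x # filter (\<lambda>y. (y, x) \<notin> R) xs"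
  have after: "(x, y) \<in> R" if "y \<in> S" "(y, x) \<notin> R" for y
    using that insert.hyps(2) insert.prems unfolding total_on_def by auto
  have "(y, z) \<in> R" if "y \<in> S" "(y, x) \<in> R" "z \<in> S" "(z, x) \<notin> R" for y z
    using transD[OF assms(1) that(2) after[OF that(3,4)]] .
  then have "sorted_wrt (\<lambda>x y. (x, y) \<in> R) ?ys"
    using after by (simp add: sorted_wrt_append sorted_wrt_filter[OF xs(1)] xs(2))
  moreover have "set ?ys = insert x S" using xs(2) by auto
  ultimately show ?case by blast
qed simp

lemma sorted_wrt_distinct:
  assumes "sorted_wrt (\<lambda>x y. (x, y) \<in> R) zs" "irrefl R" shows "distinct zs"
  unfolding distinct_conv_nth
proof (intro allI impI notI)
  fix i j assume ij: "i < length zs" "j < length zs" "i \<noteq> j" "zs ! i = zs ! j"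
  then consider "i < j" | "j < i" by linarith
  then show False
    using sorted_wrt_nth_less[OF assms(1), of i j] sorted_wrt_nth_less[OF assms(1), of j i] ij
        assms(2)
    by cases (auto simp: irrefl_def)
qed

lemma sorted_wrt_unique:
  assumes "sorted_wrt (\<lambda>x y. (x, y) \<in> R) xs" "sorted_wrt (\<lambda>x y. (x, y) \<in>
      R) ys"
    and "set xs = set ys" "trans R" "irrefl R"
  shows "xs = ys"
proof -
  have "card (set xs) = length xs" "card (set ys) = length ys"
    using sorted_wrt_distinct[OF assms(1,5)] sorted_wrt_distinct[OF assms(2,5)] by (simp_all only:
        distinct_card)
  then have len: "length xs = length ys" unfolding assms(3) by simp
  show ?thesis
  proof (rule nth_equalityI[OF len])
    fix t assume t: "t < length xs"
    then have "xs ! t \<in> set ys" unfolding assms(3)[symmetric] by (rule nth_mem)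
    then obtain t' where t': "t' < length ys" "ys ! t' = xs ! t" unfolding in_set_conv_nth by blast
    have "card {x \<in> set ys. (x, xs ! t) \<in> R} = t"
      using sorted_wrt_rank[OF assms(1,4,5) t] unfolding assms(3) .
    moreover have "card {x \<in> set ys. (x, xs ! t) \<in> R} = t'"
      using sorted_wrt_rank[OF assms(2,4,5) t'(1)] unfolding t'(2) .
    ultimately show "xs ! t = ys ! t" using t'(2) by simp
  qed
qed

lemma strict_linear_order_on_lenlex:
  assumes "strict_linear_order_on Y r"
  shows "trans (lenlex r)" "irrefl (lenlex r)" "total_on (lists Y) (lenlex r)"
proof -
  have r: "trans r" "irrefl r" "total_on Y r"
    using assms by (auto simp: strict_linear_order_on_def)
  show "trans (lenlex r)" using r(1) by (rule lenlex_transI)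
  show "irrefl (lenlex r)"
    using lenlex_irreflexive[of r] r(2) by (simp add: irrefl_def)
  have lex: "(u, v) \<in> lex r \<or> (v, u) \<in> lex r"
    if "u \<in> lists Y" "v \<in> lists Y" "length u = length v" "u \<noteq> v" for u v
    using that(3,1,2,4)
  proof (induction rule: list_induct2)
    case (Cons x u y v)
    show ?case
    proof (cases "x = y")
      case True
      then show ?thesis using Cons by auto
    next
      case False
      then have "(x, y) \<in> r \<or> (y, x) \<in> r"
        using Cons.prems r(3) by (simp add: total_on_def)
      then show ?thesis using Cons.hyps by auto
    qed
  qed simp
  show "total_on (lists Y) (lenlex r)"
    unfolding total_on_def
  proof (intro ballI impI)
    fix u v assume "u \<in> lists Y" "v \<in> lists Y" "u \<noteq> v"
    then show "(u, v) \<in> lenlex r \<or> (v, u) \<in> lenlex r"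
      using lex[of u v] by (cases "length u" "length v" rule: linorder_cases) (simp_all add:
          lenlex_conv)
  qed
qed

section \<open>Words in wreath products\<close>

locale two_groups = G: group G + H: group H
  for G :: "('g, 'r) monoid_scheme" and H :: "('h, 's) monoid_scheme"
begin

abbreviation "W \<equiv> wreath_product G H"

sublocale W: group W by (rule group_wreath_product) (rule G.group_axioms, rule H.group_axioms)

lemma carrier_W: "(p, h) \<in> carrier W \<longleftrightarrow>
    p \<in> carrier (sum_group (carrier H) (\<lambda>_. G)) \<and> h \<in> carrier H"
  by (simp add: wreath_product_def semidirect_product_def)

lemma carrier_base: "p \<in> carrier (sum_group (carrier H) (\<lambda>_. G)) \<longleftrightarrow>
    p \<in> (\<Pi>\<^sub>E h \<in> carrier H. carrier G) \<and> finite {h \<in> carrier H. p h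
        \<noteq> \<one>\<^bsub>G\<^esub>}"
  using G.group_axioms by (simp add: carrier_sum_group)

lemma mult_W: "(p, h) \<otimes>\<^bsub>W\<^esub> (p', h') =
    ((\<lambda>k \<in> carrier H. p k \<otimes>\<^bsub>G\<^esub> shift H h p' k), h
        \<otimes>\<^bsub>H\<^esub> h')"
  by (simp add: wreath_product_def semidirect_product_def)

lemma one_W: "\<one>\<^bsub>W\<^esub> = ((\<lambda>k \<in> carrier H. \<one>\<^bsub>G\<^esub>),
    \<one>\<^bsub>H\<^esub>)"
  by (simp add: wreath_product_def semidirect_product_def)

lemma top_carrier: "h \<in> carrier H \<Longrightarrow> top_embed G H h \<in> carrier W"
  by (simp add: top_embed_def carrier_W carrier_base)

lemma at_component_carrier:
  assumes "h \<in> carrier H" "g \<in> carrier G" shows "at_component G H h g \<in> carrier W"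
proof -
  have "{k \<in> carrier H. (if k = h then g else \<one>\<^bsub>G\<^esub>) \<noteq>
      \<one>\<^bsub>G\<^esub>} \<subseteq> {h}" by auto
  then have "finite {k \<in> carrier H. (if k = h then g else \<one>\<^bsub>G\<^esub>) \<noteq>
      \<one>\<^bsub>G\<^esub>}"
    by (rule finite_subset) simp
  moreover have "{k \<in> carrier H. (\<lambda>k \<in> carrier H. if k = h then g else
      \<one>\<^bsub>G\<^esub>) k \<noteq> \<one>\<^bsub>G\<^esub>}
      = {k \<in> carrier H. (if k = h then g else \<one>\<^bsub>G\<^esub>) \<noteq>
          \<one>\<^bsub>G\<^esub>}" by auto
  ultimately show ?thesis using assms by (simp add: at_component_def carrier_W carrier_base)
qed

lemma base_carrier: "g \<in> carrier G \<Longrightarrow> base_embed G H g \<in> carrier W"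
  unfolding base_embed_def by (rule at_component_carrier) simp_all

lemma top_mult: "h \<in> carrier H \<Longrightarrow> h' \<in> carrier H \<Longrightarrow>
    top_embed G H h \<otimes>\<^bsub>W\<^esub> top_embed G H h' = top_embed G H (h
        \<otimes>\<^bsub>H\<^esub> h')"
  by (auto simp: top_embed_def mult_W shift_def)

lemma top_one: "top_embed G H \<one>\<^bsub>H\<^esub> = \<one>\<^bsub>W\<^esub>"
  by (simp add: top_embed_def one_W)

lemma base_mult: "g \<in> carrier G \<Longrightarrow> g' \<in> carrier G \<Longrightarrow>
    base_embed G H g \<otimes>\<^bsub>W\<^esub> base_embed G H g' = base_embed G H (g
        \<otimes>\<^bsub>G\<^esub> g')"
  by (auto simp: base_embed_def at_component_def mult_W shift_def fun_eq_iff)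

lemma base_one: "base_embed G H \<one>\<^bsub>G\<^esub> = \<one>\<^bsub>W\<^esub>"
  by (simp add: base_embed_def at_component_def one_W)

lemma inv_top: "h \<in> carrier H \<Longrightarrow> inv\<^bsub>W\<^esub> top_embed G H h =
    top_embed G H (inv\<^bsub>H\<^esub> h)"
  by (rule W.inv_equality) (simp_all add: top_mult top_one top_carrier)

lemma inv_base: "g \<in> carrier G \<Longrightarrow> inv\<^bsub>W\<^esub> base_embed G H g =
    base_embed G H (inv\<^bsub>G\<^esub> g)"
  by (rule W.inv_equality) (simp_all add: base_mult base_one base_carrier)

lemma eval_map_top:
  "v \<in> lists (carrier H) \<Longrightarrow> word_eval W (map (top_embed G H) v) = top_embed G H
      (word_eval H v)"
  by (induction v) (auto simp: top_one top_mult H.word_eval_closed)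

lemma eval_map_base:
  "u \<in> lists (carrier G) \<Longrightarrow> word_eval W (map (base_embed G H) u) = base_embed G
      H (word_eval G u)"
  by (induction u) (auto simp: base_one base_mult G.word_eval_closed)

lemma base_support_mult:
  assumes "p \<in> carrier (sum_group (carrier H) (\<lambda>_. G))" "h \<in> carrier H"
  shows "(p, \<one>\<^bsub>H\<^esub>) \<otimes>\<^bsub>W\<^esub> top_embed G H h = (p, h)"
proof -
  have "(\<lambda>k \<in> carrier H. p k \<otimes>\<^bsub>G\<^esub> shift H
      \<one>\<^bsub>H\<^esub> (\<lambda>k \<in> carrier H. \<one>\<^bsub>G\<^esub>) k) = p"
  proof
    fix k
    show "(\<lambda>k \<in> carrier H. p k \<otimes>\<^bsub>G\<^esub> shift H
        \<one>\<^bsub>H\<^esub> (\<lambda>k \<in> carrier H. \<one>\<^bsub>G\<^esub>) k) k = p k"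
      using assms(1) unfolding carrier_base
      by (cases "k \<in> carrier H") (auto simp: shift_def PiE_iff extensional_def)
  qed
  then show ?thesis using assms(2) by (simp add: top_embed_def mult_W)
qed

text \<open>
  The word \<open>u\<close> conjugated by \<open>v\<close>, where \<open>v'\<close> represents the
      inverse of \<open>v\<close>.
\<close>

definition block :: "'h list \<Rightarrow> 'g list \<Rightarrow> 'h list \<Rightarrow> (('h
    \<Rightarrow> 'g) \<times> 'h) list" where
  "block v u v' = map (top_embed G H) v @ map (base_embed G H) u @ map (top_embed G H) v'"

lemma eval_block:
  assumes "v \<in> lists (carrier H)" "u \<in> lists (carrier G)" "v' \<in> lists (carrier H)"
    and "word_eval H v' = inv\<^bsub>H\<^esub> word_eval H v"
  shows "word_eval W (block v u v') = at_component G H (word_eval H v) (word_eval G u)"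
    and "block v u v' \<in> lists (carrier W)"
proof -
  have lists: "map (top_embed G H) v \<in> lists (carrier W)" "map (base_embed G H) u \<in> lists
      (carrier W)"
      "map (top_embed G H) v' \<in> lists (carrier W)"
    using assms(1-3) by (auto simp: top_carrier base_carrier)
  then show "block v u v' \<in> lists (carrier W)" unfolding block_def by simp
  have cl: "word_eval H v \<in> carrier H" "word_eval G u \<in> carrier G"
    using assms H.word_eval_closed G.word_eval_closed by auto
  have "word_eval W (block v u v') = top_embed G H (word_eval H v) \<otimes>\<^bsub>W\<^esub>
      (base_embed G H (word_eval G u) \<otimes>\<^bsub>W\<^esub> top_embed G H
          (inv\<^bsub>H\<^esub> word_eval H v))"
    unfolding block_def using lists assms
    by (simp add: W.word_eval_append eval_map_top eval_map_base)
  also have "\<dots> = top_embed G H (word_eval H v) \<otimes>\<^bsub>W\<^esub> base_embed G H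
      (word_eval G u)
      \<otimes>\<^bsub>W\<^esub> top_embed G H (inv\<^bsub>H\<^esub> word_eval H v)"
    using cl by (simp add: W.m_assoc top_carrier base_carrier)
  also have "\<dots> = at_component G H (word_eval H v) (word_eval G u)"
    unfolding base_embed_def
    using conj_at_component[OF G.group_axioms H.group_axioms, of "\<one>\<^bsub>H\<^esub>"
        "word_eval H v" "word_eval G u"] cl
    by simp
  finally show "word_eval W (block v u v') = at_component G H (word_eval H v) (word_eval G u)" .
qed

text \<open>
  Blocks at different elements of \<open>H\<close> do not interact, so every component of the
      product comes from
  at most one block.
\<close>

lemma eval_blocks:
  assumes "\<And>x. x \<in> set xs \<Longrightarrow> word_eval W (b x) = at_component G H (e x) (c
      (e x))"
    and "\<And>x. x \<in> set xs \<Longrightarrow> b x \<in> lists (carrier W)"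
    and "\<And>x. x \<in> set xs \<Longrightarrow> e x \<in> carrier H \<and> c (e x) \<in>
        carrier G"
    and "distinct xs" "inj_on e (set xs)"
  shows "word_eval W (concat (map b xs)) =
    ((\<lambda>k \<in> carrier H. if k \<in> e ` set xs then c k else \<one>\<^bsub>G\<^esub>),
        \<one>\<^bsub>H\<^esub>)"
  using assms
proof (induction xs)
  case Nil
  show ?case by (simp add: one_W restrict_def)
next
  case (Cons x xs)
  have IH: "word_eval W (concat (map b xs)) =
    ((\<lambda>k \<in> carrier H. if k \<in> e ` set xs then c k else \<one>\<^bsub>G\<^esub>),
        \<one>\<^bsub>H\<^esub>)"
    by (rule Cons.IH) (use Cons.prems in auto)
  have "b y \<in> lists (carrier W)" if "y \<in> set xs" for y using Cons.prems(2)[of y] that by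
      simp
  then have "concat (map b xs) \<in> lists (carrier W)" by (auto simp: in_lists_conv_set)
  then have "word_eval W (concat (map b (x # xs))) =
      at_component G H (e x) (c (e x)) \<otimes>\<^bsub>W\<^esub>
        ((\<lambda>k \<in> carrier H. if k \<in> e ` set xs then c k else
            \<one>\<^bsub>G\<^esub>), \<one>\<^bsub>H\<^esub>)"
    using Cons.prems(1)[of x] Cons.prems(2)[of x] by (simp add: W.word_eval_append IH)
  also have "\<dots> = ((\<lambda>k \<in> carrier H. if k \<in> e ` set (x # xs) then c k else
      \<one>\<^bsub>G\<^esub>), \<one>\<^bsub>H\<^esub>)"
  proof -
    have "e x \<notin> e ` set xs" using Cons.prems(4,5) by auto
    moreover have "e y \<in> carrier H" "c (e y) \<in> carrier G" if "y \<in> set (x # xs)" for y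
      using Cons.prems(3)[OF that] by simp_all
    ultimately show ?thesis
      by (auto simp: at_component_def mult_W shift_def fun_eq_iff)
  qed
  finally show ?case .
qed

end

locale wreath_words = two_groups G H
  for G :: "('g, 'r) monoid_scheme" and H :: "('h, 's) monoid_scheme" +
  fixes X :: "'g set" and Y :: "'h set" and r :: "('h \<times> 'h) set"
    and fX :: "'g list \<Rightarrow> 'g list" and fY :: "'h list \<Rightarrow> 'h list"
  assumes X: "finite_symmetric_generating_set G X" and Y: "finite_symmetric_generating_set H Y"
    and one_notin_Y: "\<one>\<^bsub>H\<^esub> \<notin> Y"
    and nf_X: "normal_form_function G X fX" and nf_Y: "normal_form_function H Y fY"
    and fX_Nil: "fX [] = []" and order: "strict_linear_order_on Y r"
begin

abbreviation "Z \<equiv> wreath_generators G H X Y"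

lemma alphabets: "finite X" "finite Y" "X \<subseteq> carrier G" "Y \<subseteq> carrier H" "finite
    Z" "Z \<subseteq> carrier W"
  using X Y top_carrier base_carrier
  by (auto simp: finite_symmetric_generating_set_def wreath_generators_def)

lemma lists_carrier:
  "u \<in> lists X \<Longrightarrow> u \<in> lists (carrier G)" "v \<in> lists Y \<Longrightarrow>
      v \<in> lists (carrier H)"
  "w \<in> lists Z \<Longrightarrow> w \<in> lists (carrier W)"
  using alphabets lists_mono by blast+

lemma block_in_lists: "v \<in> lists Y \<Longrightarrow> u \<in> lists X \<Longrightarrow> v'
    \<in> lists Y \<Longrightarrow> block v u v' \<in> lists Z"
  by (auto simp: block_def wreath_generators_def)

lemma inverse_word_in_lists: "v \<in> lists Y \<Longrightarrow> inverse_word H v \<in> lists Y"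
  using Y by (auto simp: inverse_word_def finite_symmetric_generating_set_def in_lists_conv_set)

lemma base_letter: "fst (base_embed G H x) \<one>\<^bsub>H\<^esub> = x"
  by (simp add: base_embed_def at_component_def)

lemma base_not_top: "base_embed G H x \<notin> top_embed G H ` Y"
  using one_notin_Y by (auto simp: base_embed_def at_component_def top_embed_def)

lemma top_not_base: "y \<in> Y \<Longrightarrow> top_embed G H y \<notin> base_embed G H ` X"
  using one_notin_Y by (auto simp: base_embed_def at_component_def top_embed_def)

lemma snd_top: "snd (top_embed G H y) = y"
  by (simp add: top_embed_def)

lemma top_word_in_lists: "top_word G H Y w \<in> lists Y"
  by (auto simp: top_word_def snd_top)

lemma top_word_append: "top_word G H Y (u @ v) = top_word G H Y u @ top_word G H Y v"
  by (simp add: top_word_def)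

text \<open>
  The letters of \<open>X\<close> read while the current element of \<open>H\<close> is
      \<open>h\<close>.
\<close>

definition letters_above :: "(('h \<Rightarrow> 'g) \<times> 'h) list \<Rightarrow> 'h
    \<Rightarrow> 'g list" where
  "letters_above w h = concat (map (\<lambda>i.
     if w ! i \<in> base_embed G H ` X \<and> word_eval H (top_word G H Y (take i w)) = h
     then [fst (w ! i) \<one>\<^bsub>H\<^esub>] else []) [0..<length w])"

lemma letters_above_in_lists: "letters_above w h \<in> lists X"
  by (auto simp: letters_above_def in_lists_conv_set base_letter split: if_splits)

lemma letters_above_snoc:
  "letters_above (w @ [a]) h = letters_above w h @
     (if a \<in> base_embed G H ` X \<and> word_eval H (top_word G H Y w) = h
      then [fst a \<one>\<^bsub>H\<^esub>] else [])"
proof -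
  let ?f = "\<lambda>w i. if w ! i \<in> base_embed G H ` X \<and> word_eval H (top_word G H Y
      (take i w)) = h
     then [fst (w ! i) \<one>\<^bsub>H\<^esub>] else []"
  have m: "map (?f (w @ [a])) [0..<length w] = map (?f w) [0..<length w]"
    by (rule map_cong[OF refl]) (simp add: nth_append)
  have l: "letters_above (w @ [a]) h =
      concat (map (?f (w @ [a])) [0..<length w] @ [?f (w @ [a]) (length w)])"
    unfolding letters_above_def by simp
  show ?thesis unfolding l m unfolding letters_above_def by simp
qed

text \<open>
  Appending a base letter multiplies the component at the element reached so far from the right, and
  appending a top letter leaves all components unchanged.
\<close>

lemma word_eval_wreath:
  "w \<in> lists Z \<Longrightarrow> snd (word_eval W w) = word_eval H (top_word G H Y w) \<and>
     (\<forall>h \<in> carrier H. component G H w h = word_eval G (letters_above w h))"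
proof (induction w rule: rev_induct)
  case Nil
  show ?case by (simp add: one_W top_word_def letters_above_def component_def)
next
  case (snoc a w)
  then have w: "w \<in> lists Z" and a: "a \<in> Z" by simp_all
  obtain p g where pg: "word_eval W w = (p, g)" by (cases "word_eval W w")
  then have "(p, g) \<in> carrier W" using W.word_eval_closed[OF lists_carrier(3)[OF w]] by simp
  then have pg': "p \<in> (\<Pi>\<^sub>E h \<in> carrier H. carrier G)" and g: "g \<in> carrier H"
    by (simp_all add: carrier_W carrier_base)
  have p: "p k \<in> carrier G" if "k \<in> carrier H" for k
    using pg' that by (rule PiE_mem)
  have IH: "g = word_eval H (top_word G H Y w)"
      "h \<in> carrier H \<Longrightarrow> p h = word_eval G (letters_above w h)" for h
    using snoc.IH[OF w] by (simp_all add: pg component_def)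
  have aW: "a \<in> carrier W" using a alphabets(6) by blast
  have eval: "word_eval W (w @ [a]) = (p, g) \<otimes>\<^bsub>W\<^esub> a"
    using W.word_eval_append[OF lists_carrier(3)[OF w], of "[a]"] aW by (simp add: pg)
  consider x where "x \<in> X" "a = base_embed G H x" | y where "y \<in> Y" "a = top_embed G H y"
    using a by (auto simp: wreath_generators_def)
  then show ?case
  proof cases
    case 1
    have xG: "x \<in> carrier G" using 1(1) alphabets(3) by blast
    have top: "top_word G H Y (w @ [a]) = top_word G H Y w"
      using base_not_top[of x] by (simp add: top_word_append 1(2)) (simp add: top_word_def)
    have "inv\<^bsub>H\<^esub> g \<otimes>\<^bsub>H\<^esub> h = \<one>\<^bsub>H\<^esub>
        \<longleftrightarrow> g = h" if "h \<in> carrier H" for h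
      using that g by (metis H.inv_closed H.inv_inv H.inv_equality H.l_inv)
    then have "word_eval W (w @ [a]) =
        ((\<lambda>h \<in> carrier H. p h \<otimes>\<^bsub>G\<^esub> (if g = h then x else
            \<one>\<^bsub>G\<^esub>)), g)"
      unfolding eval unfolding 1(2) base_embed_def at_component_def mult_W
      using g by (auto simp: shift_def fun_eq_iff)
    moreover have "letters_above (w @ [a]) h = letters_above w h @ (if g = h then [x] else [])"
        for h
      using 1 unfolding letters_above_snoc IH(1)[symmetric] by (simp add: base_letter)
    ultimately show ?thesis
      using IH G.word_eval_append[OF lists_carrier(1)[OF letters_above_in_lists], of "[x]"] xG p
      by (simp add: component_def top)
  next
    case 2
    have yH: "y \<in> carrier H" using 2(1) alphabets(4) by blast
    have top: "top_word G H Y (w @ [a]) = top_word G H Y w @ [y]"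
      using 2 by (simp add: top_word_append) (simp add: top_word_def snd_top)
    have "word_eval W (w @ [a]) = ((\<lambda>h \<in> carrier H. p h), g \<otimes>\<^bsub>H\<^esub>
        y)"
      unfolding eval unfolding 2(2) top_embed_def mult_W
      using g p by (auto simp: shift_def fun_eq_iff)
    moreover have "letters_above (w @ [a]) h = letters_above w h" for h
      using 2 top_not_base unfolding letters_above_snoc by simp
    moreover have "word_eval H (top_word G H Y w @ [y]) = g \<otimes>\<^bsub>H\<^esub> y"
      using H.word_eval_append[OF lists_carrier(2)[OF top_word_in_lists], of "[y]"] yH IH(1) by simp
    ultimately show ?thesis
      using IH(2) by (simp add: component_def top)
  qed
qed

abbreviation "nf_word \<equiv> normal_form_word G X fX"
abbreviation "nf_words \<equiv> fY ` lists Y"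

lemma nf_word:
  assumes "g \<in> carrier G" shows "nf_word g \<in> lists X" "word_eval G (nf_word g) = g"
proof -
  obtain u where u: "u \<in> lists X" "word_eval G u = g"
    using normal_form_functionD(4)[OF nf_X assms] by blast
  then have "nf_word g = fX u" using normal_form_word_eq[OF nf_X u(1)] by simp
  then show "nf_word g \<in> lists X" "word_eval G (nf_word g) = g"
    using normal_form_functionD(1,2)[OF nf_X u(1)] u(2) by simp_all
qed

lemma nf_words_in_lists: "v \<in> nf_words \<Longrightarrow> v \<in> lists Y"
  using normal_form_functionD(1)[OF nf_Y] by auto

lemma inj_on_nf_words: "inj_on (word_eval H) nf_words"
proof (rule inj_onI)
  fix v v' assume "v \<in> nf_words" "v' \<in> nf_words" and eq: "word_eval H v = word_eval H v'"
  then obtain u u' where u: "u \<in> lists Y" "u' \<in> lists Y" "v = fY u" "v' = fY u'" by blast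
  then have "word_eval H u = word_eval H u'"
    using eq normal_form_functionD(2)[OF nf_Y u(1)] normal_form_functionD(2)[OF nf_Y u(2)] by simp
  then show "v = v'" using normal_form_functionD(3)[OF nf_Y u(1,2)] u(3,4) by simp
qed

lemma eval_nf_words: "word_eval H ` nf_words = carrier H"
proof
  show "word_eval H ` nf_words \<subseteq> carrier H"
    using H.word_eval_closed[OF lists_carrier(2)[OF nf_words_in_lists]] by blast
  show "carrier H \<subseteq> word_eval H ` nf_words"
  proof
    fix h assume "h \<in> carrier H"
    then obtain u where u: "u \<in> lists Y" "word_eval H u = h"
      using normal_form_functionD(4)[OF nf_Y] by blast
    then have "word_eval H (fY u) = h" using normal_form_functionD(2)[OF nf_Y u(1)] by simp
    then show "h \<in> word_eval H ` nf_words" using u(1) by blast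
  qed
qed

text \<open>
  For the component function \<open>p\<close> of \<open>w\<close>, the words from which the sorted
      list of conjugators of \<open>w\<close> is
  made.
\<close>

definition support_words :: "('h \<Rightarrow> 'g) \<Rightarrow> 'h list set" where
  "support_words p = {v \<in> nf_words. p (word_eval H v) \<noteq> \<one>\<^bsub>G\<^esub>}"

definition base_word :: "('h \<Rightarrow> 'g) \<Rightarrow> 'h list list \<Rightarrow> (('h
    \<Rightarrow> 'g) \<times> 'h) list" where
  "base_word p vs = concat (map (\<lambda>v. block v (nf_word (p (word_eval H v))) (fY
      (inverse_word H v))) vs)"

lemma finite_support_words:
  assumes "p \<in> carrier (sum_group (carrier H) (\<lambda>_. G))"
  shows "finite (support_words p)"
proof -
  have "word_eval H ` support_words p \<subseteq> {h \<in> carrier H. p h \<noteq>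
      \<one>\<^bsub>G\<^esub>}"
    using eval_nf_words by (auto simp: support_words_def)
  then have "finite (word_eval H ` support_words p)"
    using assms finite_subset unfolding carrier_base by blast
  moreover have "inj_on (word_eval H) (support_words p)"
    using inj_on_nf_words by (rule inj_on_subset) (auto simp: support_words_def)
  ultimately show ?thesis by (rule finite_imageD)
qed

text \<open>
  Blocks at different elements commute, so the order of \<open>vs\<close> is immaterial. This
      gives both the value
  of the normal form and a word for every element of the wreath product.
\<close>

lemma eval_base_word:
  assumes p: "p \<in> carrier (sum_group (carrier H) (\<lambda>_. G))"
    and vs: "set vs = support_words p" "distinct vs"
  shows "base_word p vs \<in> lists Z" "word_eval W (base_word p vs) = (p, \<one>\<^bsub>H\<^esub>)"
proof -
  have v: "v \<in> lists Y" "p (word_eval H v) \<in> carrier G" if "v \<in> set vs" for v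
  proof -
    have "v \<in> nf_words" using that vs(1) by (simp add: support_words_def)
    then show vY: "v \<in> lists Y" by (rule nf_words_in_lists)
    have "word_eval H v \<in> carrier H" by (rule H.word_eval_closed[OF lists_carrier(2)[OF vY]])
    then show "p (word_eval H v) \<in> carrier G"
      by (rule PiE_mem[OF conjunct1[OF p[unfolded carrier_base]]])
  qed
  let ?b = "\<lambda>v. block v (nf_word (p (word_eval H v))) (fY (inverse_word H v))"
  have inv: "fY (inverse_word H v) \<in> lists Y"
      "word_eval H (fY (inverse_word H v)) = inv\<^bsub>H\<^esub> word_eval H v" if "v \<in> set
          vs" for v
    using normal_form_functionD(1,2)[OF nf_Y inverse_word_in_lists[OF v(1)[OF that]]]
      H.word_eval_inverse_word[OF lists_carrier(2)[OF v(1)[OF that]]] by simp_all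
  have b: "?b v \<in> lists Z" if "v \<in> set vs" for v
    by (rule block_in_lists[OF v(1)[OF that] nf_word(1)[OF v(2)[OF that]] inv(1)[OF that]])
  show "base_word p vs \<in> lists Z"
    unfolding base_word_def in_lists_conv_set set_concat set_map
    using b unfolding in_lists_conv_set by blast
  have "word_eval W (base_word p vs) =
      ((\<lambda>k \<in> carrier H. if k \<in> word_eval H ` set vs then p k else
          \<one>\<^bsub>G\<^esub>), \<one>\<^bsub>H\<^esub>)"
    unfolding base_word_def
  proof (rule eval_blocks)
    fix v assume vs': "v \<in> set vs"
    show "?b v \<in> lists (carrier W)" by (rule lists_carrier(3)[OF b[OF vs']])
    show "word_eval W (?b v) = at_component G H (word_eval H v) (p (word_eval H v))"
      using eval_block(1)[OF lists_carrier(2)[OF v(1)[OF vs']] lists_carrier(1)[OF nf_word(1)[OF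
          v(2)[OF vs']]]
          lists_carrier(2)[OF inv(1)[OF vs']] inv(2)[OF vs']] nf_word(2)[OF v(2)[OF vs']] by simp
    show "word_eval H v \<in> carrier H \<and> p (word_eval H v) \<in> carrier G"
      using v(2)[OF vs'] H.word_eval_closed[OF lists_carrier(2)[OF v(1)[OF vs']]] by simp
  next
    show "inj_on (word_eval H) (set vs)"
      unfolding vs(1) using inj_on_nf_words by (rule inj_on_subset) (auto simp: support_words_def)
  qed (rule vs(2))
  also have "(\<lambda>k \<in> carrier H. if k \<in> word_eval H ` set vs then p k else
      \<one>\<^bsub>G\<^esub>) = p"
  proof
    fix k
    have "k \<in> word_eval H ` set vs \<longleftrightarrow> p k \<noteq> \<one>\<^bsub>G\<^esub>"
        if "k \<in> carrier H"
    proof -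
      obtain v where v: "v \<in> nf_words" "k = word_eval H v"
        using \<open>k \<in> carrier H\<close> unfolding eval_nf_words[symmetric] by blast
      show ?thesis
      proof
        assume "k \<in> word_eval H ` set vs"
        then show "p k \<noteq> \<one>\<^bsub>G\<^esub>" unfolding vs(1) support_words_def by
            clarsimp
      next
        assume "p k \<noteq> \<one>\<^bsub>G\<^esub>"
        then have "v \<in> set vs" using v unfolding vs(1) support_words_def by simp
        then show "k \<in> word_eval H ` set vs" unfolding v(2) by (rule imageI)
      qed
    qed
    moreover have "p k = undefined" if "k \<notin> carrier H"
      by (rule PiE_arb[OF conjunct1[OF p[unfolded carrier_base]] that])
    ultimately show "(\<lambda>k \<in> carrier H. if k \<in> word_eval H ` set vs then p k else
        \<one>\<^bsub>G\<^esub>) k = p k"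
      by (cases "k \<in> carrier H") simp_all
  qed
  finally show "word_eval W (base_word p vs) = (p, \<one>\<^bsub>H\<^esub>)" .
qed

lemma conjugators_sorted:
  assumes "p \<in> carrier (sum_group (carrier H) (\<lambda>_. G))"
  defines "vs \<equiv> THE vs. sorted_wrt (\<lambda>v v'. (v, v') \<in> lenlex r) vs \<and> set vs
      = support_words p"
  shows "sorted_wrt (\<lambda>v v'. (v, v') \<in> lenlex r) vs" "set vs = support_words p"
proof -
  note ord = strict_linear_order_on_lenlex[OF order]
  have "total_on (support_words p) (lenlex r)"
    using ord(3) by (rule total_on_subset) (use nf_words_in_lists in \<open>unfold
        support_words_def, blast\<close>)
  then obtain vs' where vs': "sorted_wrt (\<lambda>v v'. (v, v') \<in> lenlex r) vs'" "set vs' =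
      support_words p"
    using sorted_wrt_exists[OF ord(1) _ finite_support_words[OF assms(1)]] by blast
  have "vs = vs'"
    unfolding vs_def
  proof (rule the_equality)
    fix us assume us: "sorted_wrt (\<lambda>v v'. (v, v') \<in> lenlex r) us \<and> set us =
        support_words p"
    show "us = vs'"
      by (rule sorted_wrt_unique[OF conjunct1[OF us] vs'(1) _ ord(1,2)]) (simp add: us vs'(2))
  qed (simp add: vs')
  then show "sorted_wrt (\<lambda>v v'. (v, v') \<in> lenlex r) vs" "set vs = support_words p"
    using vs' by simp_all
qed

abbreviation "wreath_nf \<equiv> wreath_normal_form G H X Y r fX fY"

lemma wnf_alt:
  "conjugators G H Y r fY w = (THE vs. sorted_wrt (\<lambda>v v'. (v, v') \<in> lenlex r) vs \<and>
     set vs = support_words (component G H w))"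
  "wreath_nf w = base_word (component G H w) (conjugators G H Y r fY w) @ map (top_embed G H) (fY
      (top_word G H Y w))"
  by (simp_all add: conjugators_def support_words_def wreath_normal_form_def base_word_def
      block_def)

lemma component_carrier:
  assumes "w \<in> lists Z"
  shows "component G H w \<in> carrier (sum_group (carrier H) (\<lambda>_. G))"
    and "snd (word_eval W w) \<in> carrier H"
proof -
  obtain p h where ph: "word_eval W w = (p, h)" by (cases "word_eval W w")
  have "(p, h) \<in> carrier W"
    unfolding ph[symmetric] by (rule W.word_eval_closed[OF lists_carrier(3)[OF assms]])
  then show "component G H w \<in> carrier (sum_group (carrier H) (\<lambda>_. G))"
    "snd (word_eval W w) \<in> carrier H"
    unfolding carrier_W component_def[abs_def] ph by simp_all
qed

lemma conjugators:
  assumes "w \<in> lists Z"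
  shows "sorted_wrt (\<lambda>v v'. (v, v') \<in> lenlex r) (conjugators G H Y r fY w)"
    and "set (conjugators G H Y r fY w) = support_words (component G H w)"
    and "distinct (conjugators G H Y r fY w)"
proof -
  note vs = conjugators_sorted[OF component_carrier(1)[OF assms], folded wnf_alt(1)]
  show "sorted_wrt (\<lambda>v v'. (v, v') \<in> lenlex r) (conjugators G H Y r fY w)"
    "set (conjugators G H Y r fY w) = support_words (component G H w)" by (rule vs)+
  show "distinct (conjugators G H Y r fY w)"
    using vs(1) strict_linear_order_on_lenlex(2)[OF order] by (rule sorted_wrt_distinct)
qed

lemma eval_top_part:
  "w \<in> lists Z \<Longrightarrow> word_eval W (map (top_embed G H) (fY (top_word G H Y w))) =
     top_embed G H (snd (word_eval W w))"
  using eval_map_top[OF lists_carrier(2)[OF normal_form_functionD(1)[OF nf_Y top_word_in_lists]]]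
    normal_form_functionD(2)[OF nf_Y top_word_in_lists] word_eval_wreath by simp

lemma top_part_in_lists: "map (top_embed G H) (fY (top_word G H Y w)) \<in> lists Z"
  using normal_form_functionD(1)[OF nf_Y top_word_in_lists, of w]
  by (auto simp: wreath_generators_def in_lists_conv_set)

lemma wnf_in_lists: "w \<in> lists Z \<Longrightarrow> wreath_nf w \<in> lists Z"
  unfolding wnf_alt(2)
  using eval_base_word(1)[OF component_carrier(1) conjugators(2,3)] top_part_in_lists by simp

lemma eval_wnf:
  assumes "w \<in> lists Z" shows "word_eval W (wreath_nf w) = word_eval W w"
proof -
  note base = eval_base_word[OF component_carrier(1) conjugators(2,3), OF assms assms assms]
  have "word_eval W (wreath_nf w) = (component G H w, \<one>\<^bsub>H\<^esub>)
      \<otimes>\<^bsub>W\<^esub> top_embed G H (snd (word_eval W w))"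
    unfolding wnf_alt(2)
      W.word_eval_append[OF lists_carrier(3)[OF base(1)] lists_carrier(3)[OF top_part_in_lists]]
      base(2) eval_top_part[OF assms] ..
  also have "\<dots> = (component G H w, snd (word_eval W w))"
    by (rule base_support_mult[OF component_carrier[OF assms]])
  also have "\<dots> = word_eval W w"
    unfolding component_def[abs_def] by (rule prod.collapse)
  finally show ?thesis .
qed

lemma wnf_cong:
  assumes "w \<in> lists Z" "w' \<in> lists Z" "word_eval W w = word_eval W w'" shows "wreath_nf w
      = wreath_nf w'"
proof -
  have c: "component G H w = component G H w'"
    unfolding component_def[abs_def] assms(3) ..
  have "word_eval H (top_word G H Y w) = word_eval H (top_word G H Y w')"
    unfolding conjunct1[OF word_eval_wreath[OF assms(1)], symmetric]
      conjunct1[OF word_eval_wreath[OF assms(2)], symmetric] assms(3) ..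
  then have "fY (top_word G H Y w) = fY (top_word G H Y w')"
    using normal_form_functionD(3)[OF nf_Y top_word_in_lists top_word_in_lists] by simp
  then show ?thesis unfolding wnf_alt c by simp
qed

text \<open>
  Every element is a product of finitely many components and an element of \<open>H\<close>.
\<close>

lemma eval_lists_Z: "word_eval W ` lists Z = carrier W"
proof
  show "word_eval W ` lists Z \<subseteq> carrier W"
    using W.word_eval_closed lists_carrier(3) by blast
  show "carrier W \<subseteq> word_eval W ` lists Z"
  proof
    fix a assume a: "a \<in> carrier W"
    obtain p h where ph: "a = (p, h)" by (cases a)
    then have p: "p \<in> carrier (sum_group (carrier H) (\<lambda>_. G))" and h: "h \<in> carrier
        H"
      using a by (simp_all add: carrier_W)
    obtain vs where vs: "set vs = support_words p" "distinct vs"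
      using finite_distinct_list[OF finite_support_words[OF p]] by blast
    obtain v where v: "v \<in> lists Y" "word_eval H v = h"
      using normal_form_functionD(4)[OF nf_Y h] by blast
    note base = eval_base_word[OF p vs]
    have top: "map (top_embed G H) v \<in> lists Z"
      using v(1) by (auto simp: wreath_generators_def in_lists_conv_set)
    have "word_eval W (base_word p vs @ map (top_embed G H) v) = a"
      unfolding W.word_eval_append[OF lists_carrier(3)[OF base(1)] lists_carrier(3)[OF top]] base(2)
        eval_map_top[OF lists_carrier(2)[OF v(1)]] v(2) base_support_mult[OF p h] ph ..
    moreover have "base_word p vs @ map (top_embed G H) v \<in> lists Z" using base(1) top by simp
    ultimately show "a \<in> word_eval W ` lists Z" by (metis imageI)
  qed
qed

lemma normal_form_wnf: "normal_form_function W Z wreath_nf"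
  by (rule normal_form_functionI[OF wnf_in_lists eval_wnf wnf_cong eval_lists_Z])

lemma generating_Z: "finite_symmetric_generating_set W Z"
  unfolding finite_symmetric_generating_set_def
proof (intro conjI ballI)
  show "inv\<^bsub>W\<^esub> a \<in> Z" if "a \<in> Z" for a
    using that X Y alphabets(3,4) unfolding wreath_generators_def
        finite_symmetric_generating_set_def
    by (auto simp: subset_iff inv_top inv_base)
  show "generate W Z = carrier W"
  proof
    show "generate W Z \<subseteq> carrier W" by (rule W.generate_incl[OF alphabets(6)])
    show "carrier W \<subseteq> generate W Z"
      unfolding eval_lists_Z[symmetric] using W.word_eval_in_generate by blast
  qed
qed (rule alphabets)+

end

section \<open>The normal form in logarithmic space\<close>

lemma lenlex_letter:
  "(u, v) \<in> lenlex r \<longleftrightarrow> length u < length v \<or> length u = length v \<and>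
     (\<exists>p<length u. (\<forall>q<p. letter u q = letter v q) \<and>
        (case letter u p of None \<Rightarrow> False | Some a \<Rightarrow>
          (case letter v p of None \<Rightarrow> False | Some b \<Rightarrow> (a, b) \<in> r)))"
proof -
  have "(u, v) \<in> lex r \<longleftrightarrow> (\<exists>p<length u. (\<forall>q<p. u ! q = v !
      q) \<and> (u ! p, v ! p) \<in> r)"
    if len: "length u = length v"
  proof
    assume "(u, v) \<in> lex r"
    then obtain z x y xs ys where uv: "u = z @ x # xs" "v = z @ y # ys" "(x, y) \<in> r"
      unfolding lex_conv by blast
    then show "\<exists>p<length u. (\<forall>q<p. u ! q = v ! q) \<and> (u ! p, v ! p) \<in> r"
      by (intro exI[of _ "length z"]) (simp add: nth_append)
  next
    assume "\<exists>p<length u. (\<forall>q<p. u ! q = v ! q) \<and> (u ! p, v ! p) \<in> r"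
    then obtain p where p: "p < length u" "\<And>q. q < p \<Longrightarrow> u ! q = v ! q" "(u !
        p, v ! p) \<in> r"
      by blast
    have "take p u = take p v"
      using p(1,2) len by (simp add: list_eq_iff_nth_eq)
    then have "u = take p u @ u ! p # drop (Suc p) u" "v = take p u @ v ! p # drop (Suc p) v"
      using id_take_nth_drop[of p u] id_take_nth_drop[of p v] p(1) len by simp_all
    then show "(u, v) \<in> lex r"
      unfolding lex_conv using p(3) len by blast
  qed
  then have "(u, v) \<in> lex r \<longleftrightarrow> (\<exists>p<length u. (\<forall>q<p. letter
      u q = letter v q) \<and>
        (case letter u p of None \<Rightarrow> False | Some a \<Rightarrow>
          (case letter v p of None \<Rightarrow> False | Some b \<Rightarrow> (a, b) \<in> r)))"
    if len: "length u = length v"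
    using len by (simp add: letter_def cong: conj_cong)
  then show ?thesis unfolding lenlex_conv by auto
qed

lemma log_pred_lenlex:
  assumes "log_word X U" "log_word X V"
  shows "log_pred X (\<lambda>w s. (U w s, V w s) \<in> lenlex r)"
proof -
  let ?R = "\<lambda>x y. case x of None \<Rightarrow> False | Some a \<Rightarrow> (case y of
      None \<Rightarrow> False | Some b \<Rightarrow> (a, b) \<in> r)"
  note U = log_word_weaken[OF assms(1)] and V = log_word_weaken[OF assms(2)]
  have eq: "log_pred X (\<lambda>w s. \<forall>q<s 0. letter (U w (\<lambda>i. s (Suc i))) q =
      letter (V w (\<lambda>i. s (Suc i))) q)"
  proof (rule log_pred_all[where P = "\<lambda>w q s. letter (U w (\<lambda>i. s (Suc i))) q =
      letter (V w (\<lambda>i. s (Suc i))) q",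
        OF log_fun_var])
    show "log_pred X (\<lambda>w s. letter (U w (\<lambda>i. s (Suc (Suc i)))) (s 0) = letter (V w
        (\<lambda>i. s (Suc (Suc i)))) (s 0))"
      using log_fin_lcb[OF log_fin_pair[OF log_word_letter[OF U log_fun_var] log_word_letter[OF V
          log_fun_var]], of "\<lambda>(x, y). x = y"] by simp
  qed
  have lt: "log_pred X (\<lambda>w s. ?R (letter (U w (\<lambda>i. s (Suc i))) (s 0)) (letter (V w
      (\<lambda>i. s (Suc i))) (s 0)))"
    using log_fin_lcb[OF log_fin_pair[OF log_word_letter[OF U log_fun_var] log_word_letter[OF V
        log_fun_var]], of "\<lambda>(x, y). ?R x y"] by simp
  show ?thesis
    unfolding lenlex_letter
    by (intro log_pred_disj log_pred_conj log_pred_less log_pred_eq log_word_length assms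
        log_pred_ex[where P = "\<lambda>w p s. (\<forall>q<p. letter (U w s) q = letter (V w s) q)
            \<and>
          ?R (letter (U w s) p) (letter (V w s) p)"] eq lt)
qed

lemma upt_split: "i \<le> n \<Longrightarrow> [0..<n] = [0..<i] @ [i..<n]"
  using upt_add_eq_append[of 0 i "n - i"] by simp

lemma concat_single:
  assumes "i < n" "\<And>j. j < n \<Longrightarrow> j \<noteq> i \<Longrightarrow> f j = []"
  shows "concat (map f [0..<n]) = f i"
proof -
  have n: "[0..<n] = [0..<i] @ i # [Suc i..<n]"
    using upt_split[OF less_imp_le[OF assms(1)]] upt_conv_Cons[OF assms(1)] by simp
  have "concat (map f [0..<i]) = []" "concat (map f [Suc i..<n]) = []"
    using assms by simp_all
  note nil = this
  show ?thesis
    unfolding n map_append list.map concat_append concat.simps nil append_Nil append_Nil2 ..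
qed

locale wreath_logspace = wreath_words G H X Y r fX fY
  for G :: "('g, 'r) monoid_scheme" and H :: "('h, 's) monoid_scheme"
    and X :: "'g set" and Y :: "'h set" and r :: "('h \<times> 'h) set"
    and fX :: "'g list \<Rightarrow> 'g list" and fY :: "'h list \<Rightarrow> 'h list" +
  assumes logspace_X: "logspace_computable X X fX" and logspace_Y: "logspace_computable Y Y fY"
begin

text \<open>
  The normal form of the element of \<open>H\<close> that is current after \<open>j\<close>
      letters of \<open>w\<close>. Every conjugator has
  this form.
\<close>

definition prefix_nf :: "(('h \<Rightarrow> 'g) \<times> 'h) list \<Rightarrow> nat \<Rightarrow>
    'h list" where
  "prefix_nf w j = fY (top_word G H Y (take j w))"

text \<open>
  The word \<open>u\<^sub>i\<close> of the block at the conjugator \<open>prefix_nf w j\<close>,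
      empty if the component is trivial.
\<close>

definition above_nf :: "(('h \<Rightarrow> 'g) \<times> 'h) list \<Rightarrow> nat \<Rightarrow>
    'g list" where
  "above_nf w j = fX (letters_above w (word_eval H (prefix_nf w j)))"

text \<open>
  Each conjugator is represented by the first of its positions.
\<close>

definition relevant :: "(('h \<Rightarrow> 'g) \<times> 'h) list \<Rightarrow> nat \<Rightarrow>
    bool" where
  "relevant w j \<longleftrightarrow> above_nf w j \<noteq> [] \<and> (\<forall>i<j. prefix_nf w i
      \<noteq> prefix_nf w j)"

definition rank :: "(('h \<Rightarrow> 'g) \<times> 'h) list \<Rightarrow> nat \<Rightarrow> nat"
    where
  "rank w j = (\<Sum>i<length w. of_bool (relevant w i \<and> (prefix_nf w i, prefix_nf w j) \<in>
      lenlex r))"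

definition block_at :: "(('h \<Rightarrow> 'g) \<times> 'h) list \<Rightarrow> nat \<Rightarrow>
    (('h \<Rightarrow> 'g) \<times> 'h) list" where
  "block_at w j = block (prefix_nf w j) (above_nf w j) (fY (inverse_word H (prefix_nf w j)))"

lemma prefix_nf_in_lists: "prefix_nf w j \<in> lists Y"
  unfolding prefix_nf_def by (rule normal_form_functionD(1)[OF nf_Y top_word_in_lists])

lemma eval_prefix_nf: "word_eval H (prefix_nf w j) = word_eval H (top_word G H Y (take j w))"
  unfolding prefix_nf_def by (rule normal_form_functionD(2)[OF nf_Y top_word_in_lists])

lemma prefix_nf_eq_iff: "prefix_nf w i = prefix_nf w j \<longleftrightarrow>
    word_eval H (top_word G H Y (take i w)) = word_eval H (prefix_nf w j)"
  unfolding eval_prefix_nf unfolding prefix_nf_def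
  by (rule normal_form_functionD(3)[OF nf_Y top_word_in_lists top_word_in_lists])

lemma log_word_letters: "log_fin Z (\<lambda>w s. letter w (s i))"
  by (rule log_word_letter[OF log_word_input[OF alphabets(5)] log_fun_var])

lemma log_word_top_word: "log_word Z (\<lambda>w s. top_word G H Y (take (s 0) w))"
proof -
  let ?f = "\<lambda>x. case x of None \<Rightarrow> [] | Some a \<Rightarrow> if a \<in>
      top_embed G H ` Y then [snd a] else []"
  have eq: "top_word G H Y (take j w) = concat (map (\<lambda>i. ?f (letter w i)) [0..<j])" for w j
  proof (induction j)
    case (Suc j)
    have "top_word G H Y (take (Suc j) w) = top_word G H Y (take j w) @ ?f (letter w j)"
      by (cases "j < length w")
         (simp_all add: take_Suc_conv_app_nth top_word_append letter_def, simp add: top_word_def)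
    then show ?case using Suc by simp
  qed (simp add: top_word_def)
  show ?thesis
    unfolding eq
    by (rule log_word_concat[where V = "\<lambda>w i s. ?f (letter w i)", OF log_word_finite[OF
        log_fin_map[OF log_word_letters]] log_fun_var])
qed

lemma log_word_prefix_nf: "log_fun Z E \<Longrightarrow> log_word Z (\<lambda>w s. prefix_nf w (E
    w s))"
  unfolding prefix_nf_def
  by (rule log_word_comp1[OF log_word_apply[OF logspace_Y log_word_top_word top_word_in_lists]])

text \<open>
  Equality in \<open>H\<close> is tested by comparing normal forms, so only words given by their
      letters occur.
\<close>

lemma above_nf_alt:
  "above_nf w j = fX (concat (map (\<lambda>i.
     if (case letter w i of None \<Rightarrow> False | Some a \<Rightarrow> a \<in> base_embed G H
         ` X) \<and> prefix_nf w i = prefix_nf w j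
     then (case letter w i of None \<Rightarrow> [] | Some a \<Rightarrow> [fst a
         \<one>\<^bsub>H\<^esub>]) else []) [0..<length w]))"
  unfolding above_nf_def letters_above_def prefix_nf_eq_iff
  by (intro arg_cong[of _ _ fX] arg_cong[of _ _ concat] map_cong refl) (simp add: letter_def)

lemma log_word_above_nf: "log_fun Z E \<Longrightarrow> log_word Z (\<lambda>w s. above_nf w (E w
    s))"
proof (rule log_word_comp1[where V = above_nf])
  let ?V = "\<lambda>w i j. if (case letter w i of None \<Rightarrow> False | Some a \<Rightarrow>
      a \<in> base_embed G H ` X) \<and>
        prefix_nf w i = prefix_nf w j
     then (case letter w i of None \<Rightarrow> [] | Some a \<Rightarrow> [fst a
         \<one>\<^bsub>H\<^esub>]) else []"
  have "log_word Z (\<lambda>w s. ?V w (s 0) (s (Suc 0)))"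
    by (intro log_word_if log_pred_conj log_fin_lcb[OF log_word_letters] log_pred_word_eq
        log_word_prefix_nf log_fun_var
        log_word_finite[OF log_fin_map[OF log_word_letters]] log_word_finite[OF log_fin_const])
  then have "log_word Z (\<lambda>w s. concat (map (\<lambda>i. ?V w i (s 0)) [0..<length w]))"
    by (rule log_word_concat[where V = "\<lambda>w i s. ?V w i (s 0)", OF _ log_word_length[OF
        log_word_input[OF alphabets(5)]]])
  then show "log_word Z (\<lambda>w s. above_nf w (s 0))"
    unfolding above_nf_alt
    by (rule log_word_apply[OF logspace_X])
       (auto simp: in_lists_conv_set letter_def base_letter split: if_splits)
qed

lemma log_pred_relevant: "log_fun Z E \<Longrightarrow> log_pred Z (\<lambda>w s. relevant w (E w
    s))"
proof -
  have "log_pred Z (\<lambda>w s. relevant w (s 0))"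
    unfolding relevant_def
    by (intro log_pred_conj log_pred_not log_pred_word_eq log_word_above_nf log_fun_var
        log_word_finite[OF log_fin_const]
        log_pred_all[where P = "\<lambda>w i s. prefix_nf w i \<noteq> prefix_nf w (s 0)"]
            log_word_prefix_nf)
  then show "log_fun Z E \<Longrightarrow> log_pred Z (\<lambda>w s. relevant w (E w s))"
    unfolding log_pred_def by (rule log_fun_comp1[where A = "\<lambda>w j. of_bool (relevant w j)"])
qed

lemma log_fun_rank: "log_fun Z E \<Longrightarrow> log_fun Z (\<lambda>w s. rank w (E w s))"
proof (rule log_fun_comp1[where A = rank])
  show "log_fun Z (\<lambda>w s. rank w (s 0))"
    unfolding rank_def
    by (rule log_fun_sum[where F = "\<lambda>w i s. of_bool (relevant w i \<and> (prefix_nf w i,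
        prefix_nf w (s 0)) \<in> lenlex r)",
          OF log_word_length[OF log_word_input[OF alphabets(5)]]])
       (intro log_pred_conj[unfolded log_pred_def] log_pred_relevant[unfolded log_pred_def]
           log_pred_lenlex[unfolded log_pred_def]
          log_word_prefix_nf log_fun_var)
qed

lemma log_word_block_at: "log_fun Z E \<Longrightarrow> log_word Z (\<lambda>w s. block_at w (E w
    s))"
proof (rule log_word_comp1[where V = block_at])
  have "log_word Z (\<lambda>w s. fY (inverse_word H (prefix_nf w (s 0))))"
    by (rule log_word_apply[OF logspace_Y _ inverse_word_in_lists[OF prefix_nf_in_lists]])
       (unfold inverse_word_def, intro log_word_map log_word_rev log_word_prefix_nf log_fun_var)
  then show "log_word Z (\<lambda>w s. block_at w (s 0))"
    unfolding block_at_def block_def by (intro log_word_append log_word_map log_word_prefix_nf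
        log_word_above_nf log_fun_var)
qed

text \<open>
  As \<open>fX [] = []\<close>, a component is trivial exactly if its normal form is empty.
\<close>

lemma component_prefix_nf:
  assumes "w \<in> lists Z"
  shows "nf_word (component G H w (word_eval H (prefix_nf w j))) = above_nf w j"
    and "component G H w (word_eval H (prefix_nf w j)) \<noteq> \<one>\<^bsub>G\<^esub>
        \<longleftrightarrow> above_nf w j \<noteq> []"
proof -
  let ?u = "letters_above w (word_eval H (prefix_nf w j))"
  have "word_eval H (prefix_nf w j) \<in> carrier H"
    by (rule H.word_eval_closed[OF lists_carrier(2)[OF prefix_nf_in_lists]])
  then have c: "component G H w (word_eval H (prefix_nf w j)) = word_eval G ?u"
    using word_eval_wreath[OF assms] by blast
  show "nf_word (component G H w (word_eval H (prefix_nf w j))) = above_nf w j"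
    unfolding c above_nf_def by (rule normal_form_word_eq[OF nf_X letters_above_in_lists])
  have "fX ?u = fX [] \<longleftrightarrow> word_eval G ?u = word_eval G []"
    by (rule normal_form_functionD(3)[OF nf_X letters_above_in_lists]) simp
  then show "component G H w (word_eval H (prefix_nf w j)) \<noteq> \<one>\<^bsub>G\<^esub>
      \<longleftrightarrow> above_nf w j \<noteq> []"
    unfolding c above_nf_def fX_Nil word_eval_Nil by simp
qed

lemma inj_on_relevant: "inj_on (prefix_nf w) {j. j < length w \<and> relevant w j}"
proof (rule inj_onI)
  fix i j assume "i \<in> {j. j < length w \<and> relevant w j}" "j \<in> {j. j < length w \<and>
      relevant w j}"
    and "prefix_nf w i = prefix_nf w j"
  then have "\<not> i < j" "\<not> j < i" unfolding relevant_def by auto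
  then show "i = j" by simp
qed

lemma support_words_component:
  assumes w: "w \<in> lists Z"
  shows "support_words (component G H w) = prefix_nf w ` {j. j < length w \<and> relevant w j}"
proof
  show "prefix_nf w ` {j. j < length w \<and> relevant w j} \<subseteq> support_words (component G
      H w)"
  proof
    fix v assume "v \<in> prefix_nf w ` {j. j < length w \<and> relevant w j}"
    then obtain j where "relevant w j" "v = prefix_nf w j" by blast
    moreover have "prefix_nf w j \<in> nf_words" for j
      unfolding prefix_nf_def using top_word_in_lists by (rule imageI)
    ultimately show "v \<in> support_words (component G H w)"
      using component_prefix_nf(2)[OF w, of j] unfolding support_words_def relevant_def by simp
  qed
  show "support_words (component G H w) \<subseteq> prefix_nf w ` {j. j < length w \<and> relevant
      w j}"
  proof
    fix v assume v: "v \<in> support_words (component G H w)"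
    have v': "v \<in> nf_words" "component G H w (word_eval H v) \<noteq> \<one>\<^bsub>G\<^esub>"
      using v by (simp_all add: support_words_def)
    have "word_eval H v \<in> carrier H"
      by (rule H.word_eval_closed[OF lists_carrier(2)[OF nf_words_in_lists[OF v'(1)]]])
    then have "component G H w (word_eval H v) = word_eval G (letters_above w (word_eval H v))"
      using word_eval_wreath[OF w] by blast
    then have "letters_above w (word_eval H v) \<noteq> []" using v'(2) by auto
    then obtain i where i: "i < length w" "word_eval H (top_word G H Y (take i w)) = word_eval H v"
      unfolding letters_above_def by (auto split: if_splits)
    have "prefix_nf w i = v"
    proof (rule inj_onD[OF inj_on_nf_words])
      show "word_eval H (prefix_nf w i) = word_eval H v" unfolding eval_prefix_nf by (rule i(2))
      show "prefix_nf w i \<in> nf_words" unfolding prefix_nf_def using top_word_in_lists by (rule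
          imageI)
    qed (rule v'(1))
    \<comment> \<open>the first position with this normal form is the relevant one\<close>
    define j where "j = (LEAST i. prefix_nf w i = v)"
    have j: "prefix_nf w j = v" unfolding j_def by (rule LeastI) (rule \<open>prefix_nf w i =
        v\<close>)
    have "j \<le> i" unfolding j_def by (rule Least_le) (rule \<open>prefix_nf w i = v\<close>)
    have "prefix_nf w i' \<noteq> v" if "i' < j" for i'
      using not_less_Least[OF that[unfolded j_def]] .
    then have "relevant w j"
      using component_prefix_nf(2)[OF w, of j] v'(2) j unfolding relevant_def by simp
    then show "v \<in> prefix_nf w ` {j. j < length w \<and> relevant w j}"
      using j i(1) \<open>j \<le> i\<close> by (intro image_eqI[of _ _ j]) simp_all
  qed
qed

lemma rank_eq_card:
  assumes "w \<in> lists Z"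
  shows "rank w j = card {v \<in> support_words (component G H w). (v, prefix_nf w j) \<in> lenlex
      r}"
proof -
  let ?I = "{i. i < length w \<and> relevant w i}"
  have "rank w j = card ({..<length w} \<inter> {i. relevant w i \<and> (prefix_nf w i, prefix_nf
      w j) \<in> lenlex r})"
    unfolding rank_def sum_of_bool_eq[OF finite_lessThan] by simp
  also have "{..<length w} \<inter> {i. relevant w i \<and> (prefix_nf w i, prefix_nf w j) \<in>
      lenlex r}
      = {i \<in> ?I. (prefix_nf w i, prefix_nf w j) \<in> lenlex r}" by blast
  also have "card \<dots> = card (prefix_nf w ` {i \<in> ?I. (prefix_nf w i, prefix_nf w j) \<in>
      lenlex r})"
    by (rule card_image[symmetric], rule inj_on_subset[OF inj_on_relevant]) blast
  also have "prefix_nf w ` {i \<in> ?I. (prefix_nf w i, prefix_nf w j) \<in> lenlex r}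
      = {v \<in> support_words (component G H w). (v, prefix_nf w j) \<in> lenlex r}"
    unfolding support_words_component[OF assms] by blast
  finally show ?thesis .
qed

text \<open>
  For \<open>t\<close> below the number of conjugators, exactly one position is relevant and has
      rank \<open>t\<close>, and its
  conjugator is the entry \<open>t\<close> of the sorted list; for larger \<open>t\<close> there
      is none.
\<close>

lemma base_word_by_ranks:
  assumes w: "w \<in> lists Z"
  shows "base_word (component G H w) (conjugators G H Y r fY w) =
    concat (map (\<lambda>t. concat (map (\<lambda>j. if relevant w j \<and> rank w j = t then
        block_at w j else [])
      [0..<length w])) [0..<length w])"
proof -
  define vs where "vs = conjugators G H Y r fY w"
  let ?I = "{i. i < length w \<and> relevant w i}"
  note conj = conjugators[OF w, folded vs_def]
  have set_vs: "set vs = prefix_nf w ` ?I"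
    unfolding conj(2) support_words_component[OF w] ..
  have rank: "rank w j = t" if "t < length vs" "prefix_nf w j = vs ! t" for t j
    unfolding rank_eq_card[OF w] that(2) conj(2)[symmetric]
    by (rule sorted_wrt_rank[OF conj(1) strict_linear_order_on_lenlex(1,2)[OF order] that(1)])
  define g where "g = (\<lambda>t. concat (map (\<lambda>j. if relevant w j \<and> rank w j = t
      then block_at w j else [])
      [0..<length w]))"
  define h where "h = (\<lambda>v. block v (nf_word (component G H w (word_eval H v))) (fY
      (inverse_word H v)))"
  have occurs: "\<exists>t<length vs. prefix_nf w j = vs ! t" if "j < length w" "relevant w j" for j
  proof -
    have "prefix_nf w j \<in> set vs" unfolding set_vs using that by blast
    then show ?thesis unfolding in_set_conv_nth by metis
  qed
  have g_h: "g t = h (vs ! t)" if t: "t < length vs" for t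
  proof -
    have "vs ! t \<in> prefix_nf w ` ?I" unfolding set_vs[symmetric] using t by (rule nth_mem)
    then obtain j where j: "j < length w" "relevant w j" "prefix_nf w j = vs ! t" by auto
    have "g t = (if relevant w j \<and> rank w j = t then block_at w j else [])"
      unfolding g_def
    proof (rule concat_single[OF j(1)])
      fix i assume i: "i < length w" "i \<noteq> j"
      have "\<not> (relevant w i \<and> rank w i = t)"
      proof
        assume rel: "relevant w i \<and> rank w i = t"
        then obtain t' where t': "t' < length vs" "prefix_nf w i = vs ! t'"
          using occurs[OF i(1)] by blast
        then have "t' = t" using rank[OF t'] rel by simp
        then have "prefix_nf w i = prefix_nf w j" using t'(2) j(3) by simp
        then have "i = j" using inj_onD[OF inj_on_relevant, of w i j] i(1) rel j(1,2) by simp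
        then show False using i(2) by simp
      qed
      then show "(if relevant w i \<and> rank w i = t then block_at w i else []) = []"
        by (rule if_not_P)
    qed
    also have "\<dots> = block_at w j" using j(2) rank[OF t j(3)] by simp
    also have "\<dots> = h (vs ! t)"
      unfolding block_at_def h_def j(3)[symmetric] component_prefix_nf(1)[OF w] ..
    finally show ?thesis .
  qed
  have g_Nil: "g t = []" if t: "length vs \<le> t" for t
  proof -
    have "\<not> (relevant w j \<and> rank w j = t)" if "j < length w" for j
      using occurs[OF that] rank t by auto
    then have "(if relevant w j \<and> rank w j = t then block_at w j else []) = []" if "j <
        length w" for j
      using that by (intro if_not_P)
    then show ?thesis
      unfolding g_def by (simp only: concat_eq_Nil_conv) (simp add: image_subset_iff)
  qed
  have "length vs \<le> length w"
  proof -
    have "length vs = card (set vs)" by (rule distinct_card[OF conj(3), symmetric])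
    also have "\<dots> \<le> card ?I" unfolding set_vs by (rule card_image_le) simp
    also have "\<dots> \<le> card {..<length w}" by (rule card_mono) auto
    finally show ?thesis by simp
  qed
  then have "[0..<length w] = [0..<length vs] @ [length vs..<length w]"
    by (rule upt_split)
  then have "concat (map g [0..<length w]) = concat (map g [0..<length vs]) @ concat (map g
      [length vs..<length w])"
    by simp
  also have "concat (map g [length vs..<length w]) = []" using g_Nil by simp
  also have "map g [0..<length vs] = map h vs"
    using g_h by (intro nth_equalityI) simp_all
  finally have "concat (map g [0..<length w]) = concat (map h vs)" by simp
  then show ?thesis unfolding base_word_def vs_def[symmetric] g_def h_def by simp
qed

theorem logspace_wnf: "logspace_computable Z Z wreath_nf"
proof (rule log_word_imp_logspace_computable[OF alphabets(5,5)])
  show "wreath_nf \<in> lists Z \<rightarrow> lists Z" using wnf_in_lists by blast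
  let ?B = "\<lambda>w j t. if relevant w j \<and> rank w j = t then block_at w j else []"
  have B: "log_word Z (\<lambda>w s. ?B w (s 0) (s (Suc 0)))"
    by (intro log_word_if log_pred_conj log_pred_relevant log_pred_eq log_fun_rank log_fun_var
        log_word_block_at log_word_finite[OF log_fin_const])
  note len = log_word_length[OF log_word_input[OF alphabets(5)]]
  have "log_word Z (\<lambda>w s. concat (map (\<lambda>j. ?B w j (s 0)) [0..<length w]))"
    by (rule log_word_concat[where V = "\<lambda>w j s. ?B w j (s 0)", OF B len])
  then have base: "log_word Z (\<lambda>w s. concat (map (\<lambda>t. concat (map (\<lambda>j. ?B
      w j t) [0..<length w])) [0..<length w]))"
    by (rule log_word_concat[where V = "\<lambda>w t s. concat (map (\<lambda>j. ?B w j t)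
        [0..<length w])", OF _ len])
  have top: "log_word Z (\<lambda>w s. map (top_embed G H) (prefix_nf w (length w)))"
    by (intro log_word_map log_word_prefix_nf len)
  show "log_word Z (\<lambda>w s. wreath_nf w)"
  proof (rule log_word_cong[OF log_word_append[OF base top]])
    fix w assume "w \<in> lists Z"
    then show "concat (map (\<lambda>t. concat (map (\<lambda>j. ?B w j t) [0..<length w]))
        [0..<length w]) @
        map (top_embed G H) (prefix_nf w (length w)) = wreath_nf w"
      unfolding wnf_alt(2) base_word_by_ranks[OF \<open>w \<in> lists Z\<close>] prefix_nf_def by
          simp
  qed
qed

end

theorem theorem22:
  fixes G :: "('g, 'r) monoid_scheme" and H :: "('h, 's) monoid_scheme"
    and X :: "'g set" and Y :: "'h set" and r :: "('h \<times> 'h) set"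
    and fX :: "'g list \<Rightarrow> 'g list" and fY :: "'h list \<Rightarrow> 'h list"
  assumes "group G" and "group H"
    and "finite_symmetric_generating_set G X" and "finite_symmetric_generating_set H Y"
    and "\<one>\<^bsub>G\<^esub> \<notin> X" and "\<one>\<^bsub>H\<^esub> \<notin> Y"
    and "logspace_normal_form_function G X fX" and "logspace_normal_form_function H Y fY"
    and "fX [] = []" and "fY [] = []"
    and "strict_linear_order_on Y r"
  shows "logspace_normal_form_function (wreath_product G H) (wreath_generators G H X Y)
           (wreath_normal_form G H X Y r fX fY)
         \<and> has_logspace_normal_form (wreath_product G H)"
proof -
  interpret G: group G by fact
  interpret H: group H by fact
  interpret wreath_logspace G H X Y r fX fY
    by unfold_locales (use assms in \<open>simp_all add: logspace_normal_form_function_def\<close>)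
  have "logspace_normal_form_function W Z wreath_nf"
    unfolding logspace_normal_form_function_def using normal_form_wnf logspace_wnf ..
  moreover have "has_logspace_normal_form W"
    unfolding has_logspace_normal_form_def using generating_Z calculation by blast
  ultimately show ?thesis ..
qed

end
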